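(* Let $\mathcal L$ be a finite distributive lattice with poset of join-irreducible elements $(P,<)$ and let $K=\overline{C(I^h,I^m)}\subset\mathbb R^{\mathcal L}$. Then the following hold. (a) For every face $F$ of $K$ there exist $m(F)\in\mathbb N$ and order relations $<_1^F,\dots,<_{m(F)}^F$ on $P$ such that for any $w\in C(I^h,I^F)$ (the relative interior of $F$) we have $$\Theta_{O(P,<)}(\psi(w))=\{O(P,<_1^F),\dots,O(P,<_{m(F)}^F)\}.$$ (b) For every face $F$ of $K$ the variety $Y^F$ is semitoric (its irreducible components are toric varieties), with irreducible components $H(\mathcal M_{<_1^F}),\dots,H(\mathcal M_{<_{m(F)}^F})\subset\mathbb P(\mathbb C^{\mathcal L})$ for the orders $<_1^F,\dots,<_{m(F)}^F$ provided by part (a). (c) The map sending $F$ to $\{O(P,<_1^F),\dots,O(P,<_{m(F)}^F)\}$ is a bijection between the faces of $K$ and the regular subdivisions of $O(P,<)$ into order polytopes of partial orders on $P$.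
   Context: Lattice and order polytopes. $(\mathcal L,\vee,\wedge)$ is a finite distributive lattice with induced order $<$. $P$ is the set of join-irreducible elements of $\mathcal L$ (non-minimal $a$ such that $a=b\vee c$ implies $a=b$ or $a=c$), with the induced order $<$. For a partial order $<'$ on $P$, $\mathcal J(P,<')$ is the set of order ideals (lower sets) of $(P,<')$. The map $\iota:\mathcal L\to\mathcal J(P,<)$, $\iota(a)=\{p\in P: p\le a\}$, is a lattice isomorphism (Birkhoff). Put $v_a=\mathbf 1_{\iota(a)}\in\mathbb R^P$ (indicator function). The order polytope $O(P,<')\subset\mathbb R^P$ consists of $x$ with $0\le x_p\le 1$ for all $p$ and $x_p\le x_q$ whenever $p>'q$; its vertices are the indicator functions of the order ideals of $(P,<')$, so the vertex set $V$ of $O(P,<)$ is $\{v_a:a\in\mathcal L\}$. $\psi:\mathbb R^{\mathcal L}\to\mathbb R^V$ is the linear isomorphism with $\psi(w)_{v_a}=w_a$. Initial ideals. $R=\mathbb C[\{X_a,a\in\mathcal L\}]$. For $w\in\mathbb R^{\mathcal L}$ let $\mathrm{grad}_w$ be the $\mathbb R$-grading on $R$ with $\mathrm{grad}_w(X_a)=w_a$; for nonzero $p\in R$, $\mathrm{in}_w p$ is the nonzero $\mathrm{grad}_w$-homogeneous component of $p$ of least grading, and $\mathrm{in}_w I$ is the linear span of $\{\mathrm{in}_w p: p\in I\}$. $C(I,J)=\{w\in\mathbb R^{\mathcal L}:\mathrm{in}_w I=J\}$. The Hibi ideal $I^h\subset R$ is generated by all $X_aX_b-X_{a\vee b}X_{a\wedge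 b}$, $a,b\in\mathcal L$; $I^m\subset R$ is generated by all $X_aX_b$ with $a,b$ incomparable. $K=\overline{C(I^h,I^m)}$ is a full-dimensional polyhedral cone. Faces of $K$ include $K$ itself and the minimal face. For each face $F$ of $K$, $\mathrm{in}_w I^h$ is the same for all $w$ in the relative interior of $F$; this ideal is denoted $I^F$, and $C(I^h,I^F)$ is the relative interior of $F$. $Y^F\subset\mathbb P(\mathbb C^{\mathcal L})$ is the zero set of $I^F$. Hibi varieties of sublattices. An order $<'$ on $P$ is stronger than $<$ if $p<q$ implies $p<'q$ (this is the case whenever $O(P,<')\subset O(P,<)$). For such $<'$ one has $\mathcal J(P,<')\subset\mathcal J(P,<)$, and $\mathcal M_{<'}=\iota^{-1}(\mathcal J(P,<'))$ is a sublattice of $\mathcal L$. $H(\mathcal M_{<'})\subset\mathbb P(\mathbb C^{\mathcal M_{<'}})\subset\mathbb P(\mathbb C^{\mathcal L})$ is the Hibi variety of the lattice $\mathcal M_{<'}$, i.e. the variety cut out in $\mathbb P(\mathbb C^{\mathcal L})$ by the $X_c$ with $c\notin\mathcal M_{<'}$ and the $X_aX_b-X_{a\vee b}X_{a\wedge b}$ with $a,b\in\mathcal M_{<'}$. Regular subdivisions. For an $n$-dimensional convex polytope $Q\subset \mathbb R^n$ with vertex set $V$ and $c\in\mathbb R^V$, let $T\subset\mathbb R^n\times\mathbb R$ be the convex hull of the union of the rays $\{v\}\times\{x\le c_v\}$, $v\in V$. The projections to $\mathbb R^n$ of the bounded facets of $T$ form a polyhedral subdivision of $Q$, denoted $\Theta_Q(c)$;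 subdivisions of this form are called regular. *)

theory Defs
  imports "HOL-Analysis.Analysis" "HOL-Library.Poly_Mapping"
begin

section \<open>Join-irreducibles, order ideals and order polytopes\<close>

text \<open>
  The lattice is the universe of a type of sort \<open>{finite, distrib_lattice}\<close>, so that
  \<open>\<real>\<^sup>L\<close> is \<open>(real, 'a) vec\<close>. The space \<open>\<real>\<^sup>P\<close>, for the subset \<open>P\<close> of join-irreducibles, is the
  coordinate subspace of \<open>(real, 'a) vec\<close> of vectors vanishing outside \<open>P\<close>; full-dimensionality
  and facets are relative notions in the library, hence unaffected by the embedding.
  A partial order on \<open>P\<close> is represented by its reflexive relation: \<open>(p, q) \<in> r\<close> means
  that \<open>p\<close> is below or equal to \<open>q\<close>.
\<close>

definition join_irreducibles :: "'a::lattice set" where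
  "join_irreducibles = {a. (\<exists>b. b < a) \<and> (\<forall>b c. a = sup b c \<longrightarrow> a = b \<or> a = c)}"

definition jirr_order :: "'a::lattice rel" where
  "jirr_order = {(p, q). p \<in> join_irreducibles \<and> q \<in> join_irreducibles \<and> p \<le> q}"

definition order_ideals :: "'a::lattice rel \<Rightarrow> 'a set set" where
  "order_ideals r = {S. S \<subseteq> join_irreducibles \<and> (\<forall>q\<in>S. \<forall>p. (p, q) \<in> r \<longrightarrow> p \<in> S)}"

definition birkhoff :: "'a::lattice \<Rightarrow> 'a set" where
  "birkhoff a = {p \<in> join_irreducibles. p \<le> a}"

definition birkhoff_vertex :: "'a::{finite,lattice} \<Rightarrow> (real, 'a) vec" where
  "birkhoff_vertex a = (\<chi> p. indicator (birkhoff a) p)"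

definition order_polytope :: "'a::{finite,lattice} rel \<Rightarrow> (real, 'a) vec set" where
  "order_polytope r =
    {x. (\<forall>p. p \<notin> join_irreducibles \<longrightarrow> x $ p = 0) \<and>
        (\<forall>p\<in>join_irreducibles. 0 \<le> x $ p \<and> x $ p \<le> 1) \<and>
        (\<forall>p q. (q, p) \<in> r \<longrightarrow> x $ p \<le> x $ q)}"

text \<open>Elements of \<open>\<real>\<^sup>V\<close> are functions of which only the values on \<open>V\<close> matter.\<close>

definition psi :: "(real, 'a) vec \<Rightarrow> (real, 'a::{finite,lattice}) vec \<Rightarrow> real" where
  "psi w v = w $ the_inv birkhoff_vertex v"

definition sublattice_of_order :: "'a::lattice rel \<Rightarrow> 'a set" where
  "sublattice_of_order r = birkhoff -` order_ideals r"


section \<open>Regular subdivisions\<close>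

definition regular_subdivision ::
    "'v::euclidean_space set \<Rightarrow> ('v \<Rightarrow> real) \<Rightarrow> 'v set set" where
  "regular_subdivision Q c =
    (let T = convex hull (\<Union>v\<in>{v. v extreme_point_of Q}. {v} \<times> {x. x \<le> c v})
     in {fst ` G | G. G facet_of T \<and> bounded G})"


section \<open>Polynomials and initial ideals\<close>

type_synonym 'x cpoly = "('x \<Rightarrow>\<^sub>0 nat) \<Rightarrow>\<^sub>0 complex"

definition var :: "'x \<Rightarrow> 'x cpoly" where
  "var a = Poly_Mapping.single (Poly_Mapping.single a 1) 1"

definition eval_poly :: "('x \<Rightarrow> complex) \<Rightarrow> 'x cpoly \<Rightarrow> complex" where
  "eval_poly x p =
    (\<Sum>m\<in>Poly_Mapping.keys p. Poly_Mapping.lookup p m *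
      (\<Prod>a\<in>Poly_Mapping.keys m. x a ^ Poly_Mapping.lookup m a))"

definition ideal_generated :: "'x cpoly set \<Rightarrow> 'x cpoly set" where
  "ideal_generated S = module.span (*) S"

definition complex_span :: "'x cpoly set \<Rightarrow> 'x cpoly set" where
  "complex_span S = module.span (\<lambda>c p. Poly_Mapping.single 0 c * p) S"

definition monom_grading :: "(real, 'a) vec \<Rightarrow> ('a::finite \<Rightarrow>\<^sub>0 nat) \<Rightarrow> real" where
  "monom_grading w m = (\<Sum>a\<in>UNIV. real (Poly_Mapping.lookup m a) * w $ a)"

definition graded_component :: "(real, 'a) vec \<Rightarrow> real \<Rightarrow> 'a::finite cpoly \<Rightarrow> 'a cpoly" where
  "graded_component w g p =
    (\<Sum>m | m \<in> Poly_Mapping.keys p \<and> monom_grading w m = g.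
      Poly_Mapping.single m (Poly_Mapping.lookup p m))"

text \<open>Only meaningful for \<open>p \<noteq> 0\<close>.\<close>

definition initial_form :: "(real, 'a) vec \<Rightarrow> 'a::finite cpoly \<Rightarrow> 'a cpoly" where
  "initial_form w p = graded_component w (Min (monom_grading w ` Poly_Mapping.keys p)) p"

definition initial_ideal :: "(real, 'a) vec \<Rightarrow> 'a::finite cpoly set \<Rightarrow> 'a cpoly set" where
  "initial_ideal w I = complex_span {initial_form w p | p. p \<in> I \<and> p \<noteq> 0}"

definition initial_cone :: "'a::finite cpoly set \<Rightarrow> 'a cpoly set \<Rightarrow> (real, 'a) vec set" where
  "initial_cone I J = {w. initial_ideal w I = J}"

definition hibi_ideal :: "'a::lattice cpoly set" where
  "hibi_ideal = ideal_generated
    {var a * var b - var (sup a b) * var (inf a b) | a b. True}"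

definition monomial_hibi_ideal :: "'a::lattice cpoly set" where
  "monomial_hibi_ideal = ideal_generated
    {var a * var b | a b. \<not> a \<le> b \<and> \<not> b \<le> a}"

definition hibi_cone :: "(real, 'a::{finite,lattice}) vec set" where
  "hibi_cone = closure (initial_cone hibi_ideal monomial_hibi_ideal)"

text \<open>The library relation \<open>face_of\<close> also admits the empty face, excluded here.\<close>

definition hibi_faces :: "(real, 'a::{finite,lattice}) vec set set" where
  "hibi_faces = {F. F face_of hibi_cone \<and> F \<noteq> {}}"

definition face_ideal :: "(real, 'a::{finite,lattice}) vec set \<Rightarrow> 'a cpoly set" where
  "face_ideal F = (THE J. \<forall>w\<in>rel_interior F. initial_ideal w hibi_ideal = J)"


section \<open>Projective varieties\<close>

text \<open>Points of the projective space are the lines through the origin in \<open>(complex, 'a) vec\<close>.\<close>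

definition proj_line :: "(complex, 'a::finite) vec \<Rightarrow> (complex, 'a) vec set" where
  "proj_line x = {c *s x | c. True}"

definition proj_space :: "(complex, 'a::finite) vec set set" where
  "proj_space = {proj_line x | x. x \<noteq> 0}"

definition proj_zeros :: "'a::finite cpoly set \<Rightarrow> (complex, 'a) vec set set" where
  "proj_zeros S = {L \<in> proj_space. \<forall>p\<in>S. \<forall>x\<in>L. eval_poly (($) x) p = 0}"

definition homogeneous :: "nat \<Rightarrow> 'a::finite cpoly \<Rightarrow> bool" where
  "homogeneous d p \<longleftrightarrow> (\<forall>m\<in>Poly_Mapping.keys p. (\<Sum>a\<in>UNIV. Poly_Mapping.lookup m a) = d)"

definition zariski_closed :: "(complex, 'a::finite) vec set set \<Rightarrow> bool" where
  "zariski_closed Z \<longleftrightarrow> (\<exists>S. (\<forall>p\<in>S. \<exists>d. homogeneous d p) \<and> Z = proj_zeros S)"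

definition zariski_irreducible :: "(complex, 'a::finite) vec set set \<Rightarrow> bool" where
  "zariski_irreducible Z \<longleftrightarrow> Z \<noteq> {} \<and>
    (\<forall>A B. zariski_closed A \<and> zariski_closed B \<and> Z \<subseteq> A \<union> B \<longrightarrow> Z \<subseteq> A \<or> Z \<subseteq> B)"

definition irreducible_components ::
    "(complex, 'a::finite) vec set set \<Rightarrow> (complex, 'a) vec set set set" where
  "irreducible_components Y =
    {Z. Z \<subseteq> Y \<and> zariski_irreducible Z \<and>
        (\<forall>Z'. Z' \<subseteq> Y \<and> zariski_irreducible Z' \<and> Z \<subseteq> Z' \<longrightarrow> Z' = Z)}"

definition face_variety ::
    "(real, 'a::{finite,lattice}) vec set \<Rightarrow> (complex, 'a) vec set set" where
  "face_variety F = proj_zeros (face_ideal F)"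

definition hibi_variety :: "'a::{finite,lattice} set \<Rightarrow> (complex, 'a) vec set set" where
  "hibi_variety M = proj_zeros
    ({var c | c. c \<notin> M} \<union>
     {var a * var b - var (sup a b) * var (inf a b) | a b. a \<in> M \<and> b \<in> M})"


section \<open>Toric varieties\<close>

text \<open>
  The torus of rank \<open>n\<close> consists of the sequences with nonzero entries at the positions
  \<open>i < n\<close>, padded by ones, so that multiplication is pointwise.
\<close>

definition alg_torus :: "nat \<Rightarrow> (nat \<Rightarrow> complex) set" where
  "alg_torus n = {t. (\<forall>i<n. t i \<noteq> 0) \<and> (\<forall>i\<ge>n. t i = 1)}"

text \<open>
  Morphisms are maps given locally by polynomials. For maps to a projective space this is a
  tuple of polynomials without common zero at the point under consideration; Laurent
  polynomials in the torus coordinates are not needed, as denominators can be cleared.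
\<close>

definition torus_morphism :: "nat \<Rightarrow> ((nat \<Rightarrow> complex) \<Rightarrow> (complex, 'a::finite) vec set) \<Rightarrow> bool" where
  "torus_morphism n f \<longleftrightarrow>
    (\<forall>t0\<in>alg_torus n. \<exists>G :: 'a \<Rightarrow> nat cpoly.
       (\<chi> a. eval_poly t0 (G a)) \<noteq> 0 \<and>
       (\<forall>t\<in>alg_torus n. (\<chi> a. eval_poly t (G a)) \<noteq> 0 \<longrightarrow>
          f t = proj_line (\<chi> a. eval_poly t (G a))))"

text \<open>
  For maps from a product of a torus and a projective variety, the torus coordinates are the
  variables \<open>Inl i\<close> and the homogeneous coordinates are the variables \<open>Inr a\<close>.
\<close>

definition torus_times_morphism ::
    "nat \<Rightarrow> (complex, 'a::finite) vec set set \<Rightarrow>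
     ((nat \<Rightarrow> complex) \<Rightarrow> (complex, 'a) vec set \<Rightarrow> (complex, 'a) vec set) \<Rightarrow> bool" where
  "torus_times_morphism n X f \<longleftrightarrow>
    (\<forall>t0\<in>alg_torus n. \<forall>L0\<in>X. \<exists>d. \<exists>G :: 'a \<Rightarrow> (nat + 'a) cpoly.
       (\<forall>a. \<forall>m\<in>Poly_Mapping.keys (G a). (\<Sum>b\<in>UNIV. Poly_Mapping.lookup m (Inr b)) = d) \<and>
       (\<exists>x\<in>L0. (\<chi> a. eval_poly (case_sum t0 (($) x)) (G a)) \<noteq> 0) \<and>
       (\<forall>t\<in>alg_torus n. \<forall>L\<in>X. \<forall>x\<in>L.
          (\<chi> a. eval_poly (case_sum t (($) x)) (G a)) \<noteq> 0 \<longrightarrow>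
          f t L = proj_line (\<chi> a. eval_poly (case_sum t (($) x)) (G a))))"

definition morphism_to_torus ::
    "nat \<Rightarrow> (complex, 'a::finite) vec set set \<Rightarrow>
     ((complex, 'a) vec set \<Rightarrow> nat \<Rightarrow> complex) \<Rightarrow> bool" where
  "morphism_to_torus n U f \<longleftrightarrow> f ` U \<subseteq> alg_torus n \<and>
    (\<forall>L0\<in>U. \<forall>i<n. \<exists>d g h. homogeneous d g \<and> homogeneous d h \<and>
       (\<exists>x\<in>L0. eval_poly (($) x) h \<noteq> 0) \<and>
       (\<forall>L\<in>U. \<forall>x\<in>L. eval_poly (($) x) h \<noteq> 0 \<longrightarrow>
          f L i = eval_poly (($) x) g / eval_poly (($) x) h))"

definition torus_action ::
    "nat \<Rightarrow> 'p set \<Rightarrow> ((nat \<Rightarrow> complex) \<Rightarrow> 'p \<Rightarrow> 'p) \<Rightarrow> bool" where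
  "torus_action n X act \<longleftrightarrow>
    (\<forall>t\<in>alg_torus n. \<forall>x\<in>X. act t x \<in> X) \<and>
    (\<forall>x\<in>X. act (\<lambda>_. 1) x = x) \<and>
    (\<forall>s\<in>alg_torus n. \<forall>t\<in>alg_torus n. \<forall>x\<in>X. act (\<lambda>i. s i * t i) x = act s (act t x))"

text \<open>
  A toric variety is an irreducible variety \<open>X\<close> containing a torus as a Zariski open subset
  (the image \<open>U\<close> of \<open>\<phi>\<close>) such that the action of the torus on itself extends to an algebraic
  action on \<open>X\<close>. Normality is not required.
\<close>

definition toric_variety :: "(complex, 'a::finite) vec set set \<Rightarrow> bool" where
  "toric_variety X \<longleftrightarrow> zariski_closed X \<and> zariski_irreducible X \<and>
    (\<exists>n U \<phi> act.
       (\<exists>A. zariski_closed A \<and> U = X - A) \<and>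
       bij_betw \<phi> (alg_torus n) U \<and> torus_morphism n \<phi> \<and>
       morphism_to_torus n U (the_inv_into (alg_torus n) \<phi>) \<and>
       torus_action n X act \<and> torus_times_morphism n X act \<and>
       (\<forall>s\<in>alg_torus n. \<forall>t\<in>alg_torus n. act s (\<phi> t) = \<phi> (\<lambda>i. s i * t i)))"

definition semitoric :: "(complex, 'a::finite) vec set set \<Rightarrow> bool" where
  "semitoric Y \<longleftrightarrow> zariski_closed Y \<and> (\<forall>Z\<in>irreducible_components Y. toric_variety Z)"

end

theory Submission
  imports Defs "HOL-Computational_Algebra.Polynomial"
begin

text \<open>
  The cone \<open>K\<close> consists of the supermodular functions \<open>w\<close>, and its faces are cut out by the set of
  pairs on which \<open>w a + w b \<le> w (a \<or> b) + w (a \<and> b)\<close> is an equality. All objects attached to \<open>w\<close>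
  depend on these modular pairs only.

  A cell of the regular subdivision consists of the lattice elements where an affine function
  \<open>l \<ge> w\<close> is tight. As \<open>l - w\<close> is nonnegative and submodular, the tight set is a sublattice, and a
  full-dimensional one is the set of ideals of a stronger order. Conversely a sublattice on which \<open>w\<close>
  is modular lies in a cell: the product of its variables straightens to a product along a
  chain, a chain lies in some cell, and \<open>l - w\<close> has the same sum over both products. So
  the cells are the maximal sublattices consisting of modular pairs.

  Straightening also gives the initial ideal: the toric parametrization \<open>X\<^sub>a \<mapsto> s \<Prod>\<^bsub>p \<le> a\<^esub> t\<^sub>p\<close>
  separates chain monomials, and the weight of a monomial is at most that of its chain form, hence the
  initial ideal is generated by the binomials of the modular pairs and the monomials \<open>X\<^sub>a X\<^sub>b\<close> of the
  other pairs. The support of a zero is a sublattice of modular pairs, which lies in a cell \<open>M\<close>, so the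
  zero set is the union of the Hibi varieties of the cells. Each of these is the closure of a
  torus orbit.
\<close>

section \<open>Regular subdivisions\<close>

text \<open>The signs fit as follows: for incomparable a, b the initial form of a Hibi binomial is
  X_a X_b exactly when w a + w b < w (sup a b) + w (inf a b), and for supermodular w this strict
  inequality keeps a and b out of a common cell. The squared size of \<open>birkhoff a\<close>
  satisfies it at all incomparable pairs; it yields both a weight in C(I^h, I^m) and the termination
  measure of straightening. In place of a Groebner basis there are linear functionals collecting the
  coefficients of one multidegree. They vanish on I^h, so no chain monomial lies in the initial
  ideal of a supermodular weight; that is why the initial ideal remembers supermodularity and the
  modular pairs. The delicate point is that a cell is only found over relatively interior points of
  the polytope, while a chain may span a simplex in its boundary. The barycenter has to be moved
  inside, and the level sets of the moved point recover the chain. This uses only that cells are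
  order polytopes, so it also applies to a height function not yet known to be supermodular, as
  surjectivity in (c) requires.\<close>

definition tight_set :: "'v::euclidean_space set \<Rightarrow> ('v \<Rightarrow> real) \<Rightarrow> 'v \<Rightarrow> real \<Rightarrow> 'v set" where
  "tight_set V c \<alpha> \<beta> = {v\<in>V. \<alpha> \<bullet> v + \<beta> = c v}"

text \<open>The inclusion into the affine hull says that the tight set is full-dimensional relative
  to \<open>V\<close>, so that the face over it is a facet. The relative form matters because the
  order polytope spans only a coordinate subspace.\<close>

definition upper_cell :: "'v::euclidean_space set \<Rightarrow> ('v \<Rightarrow> real) \<Rightarrow> 'v set \<Rightarrow> bool" where
  "upper_cell V c T \<longleftrightarrow> (\<exists>\<alpha> \<beta>. (\<forall>v\<in>V. c v \<le> \<alpha> \<bullet> v + \<beta>) \<and> T = tight_set V c \<alpha> \<beta> \<and> V \<subseteq> affine hull T)"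

definition hypograph :: "'v::euclidean_space set \<Rightarrow> ('v \<Rightarrow> real) \<Rightarrow> ('v \<times> real) set" where
  "hypograph V c = convex hull (\<Union>v\<in>V. {v} \<times> {x. x \<le> c v})"

lemma affine_fun_zero_on_hull:
  assumes "\<And>v. v \<in> T \<Longrightarrow> \<alpha> \<bullet> v + \<beta> = 0" and "x \<in> affine hull T"
  shows "\<alpha> \<bullet> x + \<beta> = (0::real)"
proof -
  have "affine hull T \<subseteq> {x. \<alpha> \<bullet> x = - \<beta>}"
    by (rule hull_minimal) (use assms(1) in \<open>auto simp: affine_hyperplane add_eq_0_iff\<close>)
  with assms(2) show ?thesis by auto
qed

lemma not_in_affine_hull_separated:
  fixes x :: "'v::euclidean_space"
  assumes "x \<notin> affine hull T"
  obtains \<alpha> \<beta> where "\<And>v. v \<in> T \<Longrightarrow> \<alpha> \<bullet> v + \<beta> = 0" "\<alpha> \<bullet> x + \<beta> \<noteq> 0"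
proof -
  obtain \<F> where F: "affine hull T = \<Inter>\<F>" "\<And>h. h \<in> \<F> \<Longrightarrow> \<exists>a b. a \<noteq> 0 \<and> h = {x. a \<bullet> x = b}"
    using affine_hull_finite_intersection_hyperplanes[of T] by metis
  with assms obtain h where h: "h \<in> \<F>" "x \<notin> h" by auto
  with F(2) obtain a b where ab: "h = {x. a \<bullet> x = b}" by blast
  have "T \<subseteq> h" using h F(1) hull_subset[of T affine] by auto
  with ab h show thesis by (intro that[of a "- b"]) auto
qed

locale height_function =
  fixes V :: "'v::euclidean_space set" and c :: "'v \<Rightarrow> real"
  assumes finite_V: "finite V" and V_nonempty: "V \<noteq> {}"
begin

text \<open>Heights below \<open>c v\<close> may be spread over several rays; only their weighted
  total counts, so a single upper bound on \<open>t\<close> replaces them.\<close>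

lemma hypograph_iff:
  "(x, t) \<in> hypograph V c \<longleftrightarrow>
    (\<exists>u. (\<forall>v\<in>V. 0 \<le> u v) \<and> sum u V = 1 \<and> x = (\<Sum>v\<in>V. u v *\<^sub>R v) \<and> t \<le> (\<Sum>v\<in>V. u v * c v))"
  (is "_ \<longleftrightarrow> ?P (x, t)")
proof
  let ?R = "{y. \<exists>u. (\<forall>v\<in>V. 0 \<le> u v) \<and> sum u V = 1 \<and> fst y = (\<Sum>v\<in>V. u v *\<^sub>R v) \<and> snd y \<le> (\<Sum>v\<in>V. u v * c v)}"
  have "hypograph V c \<subseteq> ?R"
    unfolding hypograph_def
  proof (rule hull_minimal)
    show "(\<Union>v\<in>V. {v} \<times> {x. x \<le> c v}) \<subseteq> ?R"
    proof clarsimp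
      fix v t assume v: "v \<in> V" "t \<le> c v"
      have eq: "(\<Sum>z\<in>V. (if z = v then 1 else 0) *\<^sub>R z) = v" "(\<Sum>z\<in>V. (if z = v then 1 else 0) * c z) = c v"
        using v finite_V by (simp_all add: if_distrib[of "\<lambda>r. r *\<^sub>R _"] if_distrib[of "\<lambda>r. r * _"] cong: if_cong)
      show "\<exists>u. (\<forall>v\<in>V. 0 \<le> u v) \<and> sum u V = 1 \<and> v = (\<Sum>v\<in>V. u v *\<^sub>R v) \<and> t \<le> (\<Sum>v\<in>V. u v * c v)"
        by (rule exI[of _ "\<lambda>z. if z = v then 1 else 0"]) (use v eq finite_V in auto)
    qed
    show "convex ?R"
    proof (rule convexI, clarsimp)
      fix t1 t2 and u1 u2 :: "'v \<Rightarrow> real" and a b :: real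
      assume h: "0 \<le> a" "0 \<le> b" "a + b = 1" "\<forall>v\<in>V. 0 \<le> u1 v" "sum u1 V = 1" "t1 \<le> (\<Sum>v\<in>V. u1 v * c v)"
        "\<forall>v\<in>V. 0 \<le> u2 v" "sum u2 V = 1" "t2 \<le> (\<Sum>v\<in>V. u2 v * c v)"
      let ?u = "\<lambda>v. a * u1 v + b * u2 v"
      have "\<forall>v\<in>V. 0 \<le> ?u v" using h by auto
      moreover have "sum ?u V = 1" using h by (simp add: sum.distrib flip: sum_distrib_left)
      moreover have "a *\<^sub>R (\<Sum>v\<in>V. u1 v *\<^sub>R v) + b *\<^sub>R (\<Sum>v\<in>V. u2 v *\<^sub>R v) = (\<Sum>v\<in>V. ?u v *\<^sub>R v)"
        by (simp add: scaleR_right.sum scaleR_add_left sum.distrib)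
      moreover have "a * t1 + b * t2 \<le> (\<Sum>v\<in>V. ?u v * c v)"
      proof -
        have "a * t1 + b * t2 \<le> a * (\<Sum>v\<in>V. u1 v * c v) + b * (\<Sum>v\<in>V. u2 v * c v)"
          using h by (intro add_mono mult_left_mono)
        also have "\<dots> = (\<Sum>v\<in>V. ?u v * c v)" by (simp add: sum_distrib_left sum.distrib algebra_simps)
        finally show ?thesis .
      qed
      ultimately show "\<exists>u. (\<forall>v\<in>V. 0 \<le> u v) \<and> sum u V = 1 \<and>
           a *\<^sub>R (\<Sum>v\<in>V. u1 v *\<^sub>R v) + b *\<^sub>R (\<Sum>v\<in>V. u2 v *\<^sub>R v) = (\<Sum>v\<in>V. u v *\<^sub>R v) \<and>
           a * t1 + b * t2 \<le> (\<Sum>v\<in>V. u v * c v)" by (intro exI[of _ ?u] conjI)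
    qed
  qed
  moreover assume "(x, t) \<in> hypograph V c"
  ultimately have "(x, t) \<in> ?R" by (rule subsetD)
  then show "\<exists>u. (\<forall>v\<in>V. 0 \<le> u v) \<and> sum u V = 1 \<and> x = (\<Sum>v\<in>V. u v *\<^sub>R v) \<and> t \<le> (\<Sum>v\<in>V. u v * c v)"
    by simp
next
  assume "\<exists>u. (\<forall>v\<in>V. 0 \<le> u v) \<and> sum u V = 1 \<and> x = (\<Sum>v\<in>V. u v *\<^sub>R v) \<and> t \<le> (\<Sum>v\<in>V. u v * c v)"
  then obtain u where u: "\<And>v. v\<in>V \<Longrightarrow> 0 \<le> u v" "sum u V = 1" "x = (\<Sum>v\<in>V. u v *\<^sub>R v)" "t \<le> (\<Sum>v\<in>V. u v * c v)"
    by auto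
  \<comment> \<open>Lowering every vertex height by the same amount \<open>d\<close> lowers the
    combination by \<open>d\<close>, as the weights sum to one.\<close>
  define d where "d = (\<Sum>v\<in>V. u v * c v) - t"
  have "(\<Sum>v\<in>V. u v *\<^sub>R (v, c v - d)) \<in> hypograph V c"
    unfolding hypograph_def
    by (rule convex_sum) (use u finite_V in \<open>auto intro!: hull_inc simp: d_def\<close>)
  moreover have "(\<Sum>v\<in>V. u v *\<^sub>R (v, c v - d)) = (x, t)"
  proof (rule prod_eqI)
    have "(\<Sum>v\<in>V. u v * (c v - d)) = (\<Sum>v\<in>V. u v * c v) - sum u V * d"
      by (simp add: right_diff_distrib sum_subtractf sum_distrib_right)
    then show "snd (\<Sum>v\<in>V. u v *\<^sub>R (v, c v - d)) = snd (x, t)"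
      using u by (simp add: snd_sum d_def)
  qed (use u in \<open>simp add: fst_sum\<close>)
  ultimately show "(x, t) \<in> hypograph V c" by simp
qed

lemma hypograph_down: "(x, t) \<in> hypograph V c \<Longrightarrow> s \<le> t \<Longrightarrow> (x, s) \<in> hypograph V c"
  unfolding hypograph_iff by (blast intro: order_trans)

lemma hypograph_vertex: "v \<in> V \<Longrightarrow> t \<le> c v \<Longrightarrow> (v, t) \<in> hypograph V c"
  unfolding hypograph_def by (rule hull_inc) auto

lemma fst_hypograph: "fst ` hypograph V c = convex hull V"
proof -
  have "x \<in> fst ` hypograph V c \<longleftrightarrow> x \<in> convex hull V" for x
  proof -
    have "x \<in> fst ` hypograph V c \<longleftrightarrow> (\<exists>t. (x, t) \<in> hypograph V c)" by force
    also have "\<dots> \<longleftrightarrow> x \<in> convex hull V"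
      unfolding hypograph_iff convex_hull_finite[OF finite_V] by auto
    finally show ?thesis .
  qed
  then show ?thesis by blast
qed

lemma convex_hypograph: "convex (hypograph V c)"
  by (simp add: hypograph_def)

lemma hypograph_le:
  assumes "\<And>v. v \<in> V \<Longrightarrow> c v \<le> \<alpha> \<bullet> v + \<beta>" and "(x, t) \<in> hypograph V c"
  shows "t \<le> \<alpha> \<bullet> x + \<beta>"
proof -
  obtain u where u: "\<And>v. v\<in>V \<Longrightarrow> 0 \<le> u v" "sum u V = 1" "x = (\<Sum>v\<in>V. u v *\<^sub>R v)" "t \<le> (\<Sum>v\<in>V. u v * c v)"
    using assms(2) unfolding hypograph_iff by blast
  have "(\<Sum>v\<in>V. u v * c v) \<le> (\<Sum>v\<in>V. u v * (\<alpha> \<bullet> v + \<beta>))"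
    using u assms by (intro sum_mono mult_left_mono) auto
  also have "\<dots> = \<alpha> \<bullet> x + \<beta>"
    using u by (simp add: inner_sum_right algebra_simps sum.distrib flip: sum_distrib_left)
  finally show ?thesis using u by simp
qed

text \<open>All slacks \<alpha> \<bullet> v + \<beta> - c v are nonnegative, so a convex combination
  that reaches the hyperplane gives positive weight to tight vertices only.\<close>

lemma hypograph_upper_face:
  assumes "\<And>v. v \<in> V \<Longrightarrow> c v \<le> \<alpha> \<bullet> v + \<beta>"
  shows "hypograph V c \<inter> {(x, t). t = \<alpha> \<bullet> x + \<beta>} = convex hull ((\<lambda>v. (v, c v)) ` tight_set V c \<alpha> \<beta>)"
    (is "?L = ?R")
proof
  show "?R \<subseteq> ?L"
  proof (rule hull_minimal)
    show "(\<lambda>v. (v, c v)) ` tight_set V c \<alpha> \<beta> \<subseteq> ?L"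
      by (auto simp: tight_set_def intro: hypograph_vertex)
    have "{(x, t). t = \<alpha> \<bullet> x + \<beta>} = {y. (\<alpha>, -1) \<bullet> y = - \<beta>}"
      by (auto simp: inner_prod_def)
    then have "convex {(x, t). t = \<alpha> \<bullet> x + \<beta>}" by (simp add: convex_hyperplane)
    then show "convex ?L" by (intro convex_Int convex_hypograph)
  qed
  show "?L \<subseteq> ?R"
  proof clarsimp
    fix x assume "(x, \<alpha> \<bullet> x + \<beta>) \<in> hypograph V c"
    then obtain u where u: "\<And>v. v\<in>V \<Longrightarrow> 0 \<le> u v" "sum u V = 1" "x = (\<Sum>v\<in>V. u v *\<^sub>R v)" "\<alpha> \<bullet> x + \<beta> \<le> (\<Sum>v\<in>V. u v * c v)"
      unfolding hypograph_iff by blast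
    have x: "\<alpha> \<bullet> x + \<beta> = (\<Sum>v\<in>V. u v * (\<alpha> \<bullet> v + \<beta>))"
      using u by (simp add: inner_sum_right algebra_simps sum.distrib flip: sum_distrib_left)
    have nn: "\<And>v. v \<in> V \<Longrightarrow> 0 \<le> u v * (\<alpha> \<bullet> v + \<beta> - c v)" using u assms by auto
    have "(\<Sum>v\<in>V. u v * (\<alpha> \<bullet> v + \<beta> - c v)) \<le> 0"
      using u(4) unfolding x by (simp add: right_diff_distrib sum_subtractf)
    then have "(\<Sum>v\<in>V. u v * (\<alpha> \<bullet> v + \<beta> - c v)) = 0"
      by (intro antisym sum_nonneg nn)
    then have z: "u v * (\<alpha> \<bullet> v + \<beta> - c v) = 0" if "v \<in> V" for v
      using sum_nonneg_eq_0_iff[OF finite_V, of "\<lambda>v. u v * (\<alpha> \<bullet> v + \<beta> - c v)"] nn that by auto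
    then have uz: "u v = 0" if "v \<in> V - tight_set V c \<alpha> \<beta>" for v using that by (force simp: tight_set_def)
    have sub: "tight_set V c \<alpha> \<beta> \<subseteq> V" by (auto simp: tight_set_def)
    have "(\<Sum>v\<in>tight_set V c \<alpha> \<beta>. u v *\<^sub>R (v, c v)) \<in> ?R"
    proof (rule convex_sum)
      show "finite (tight_set V c \<alpha> \<beta>)" using sub finite_V by (rule finite_subset)
      show "sum u (tight_set V c \<alpha> \<beta>) = 1"
        using sum.mono_neutral_left[OF finite_V sub, of u] uz u(2) by auto
    qed (use u sub in \<open>auto intro: hull_inc\<close>)
    also have "(\<Sum>v\<in>tight_set V c \<alpha> \<beta>. u v *\<^sub>R (v, c v)) = (\<Sum>v\<in>V. u v *\<^sub>R (v, c v))"
      by (rule sum.mono_neutral_left[OF finite_V sub]) (use uz in \<open>auto simp: zero_prod_def\<close>)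
    also have "\<dots> = (x, \<Sum>v\<in>V. u v * c v)"
      by (rule prod_eqI) (use u in \<open>simp_all add: fst_sum snd_sum\<close>)
    also have "(\<Sum>v\<in>V. u v * c v) = \<alpha> \<bullet> x + \<beta>"
      unfolding x
    proof (rule sum.cong[OF refl])
      fix v assume "v \<in> V"
      from z[OF this] show "u v * c v = u v * (\<alpha> \<bullet> v + \<beta>)" by auto
    qed
    finally show "(x, \<alpha> \<bullet> x + \<beta>) \<in> ?R" .
  qed
qed

text \<open>The hypograph is unbounded downwards, which forces a nonzero vertical coefficient
  \<open>s\<close> to be negative; dividing by it turns the supporting hyperplane into the graph of
  an affine function above \<open>c\<close>.\<close>

lemma nonvertical_support:
  assumes y: "y \<in> hypograph V c" and a: "\<And>z. z \<in> hypograph V c \<Longrightarrow> (\<alpha>0, s) \<bullet> y \<le> (\<alpha>0, s) \<bullet> z"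
    and "s \<noteq> 0"
  shows "\<exists>\<alpha> \<beta>. (\<forall>v\<in>V. c v \<le> \<alpha> \<bullet> v + \<beta>) \<and>
    {z. (\<alpha>0, s) \<bullet> z = (\<alpha>0, s) \<bullet> y} = {(x, t). t = \<alpha> \<bullet> x + \<beta>}"
proof -
  obtain x0 t0 where y0: "y = (x0, t0)" by (cases y)
  have "(x0, t0 - 1) \<in> hypograph V c" using y y0 by (auto intro: hypograph_down)
  from a[OF this] have s: "s < 0" using \<open>s \<noteq> 0\<close> by (simp add: y0 algebra_simps)
  define b where "b = (\<alpha>0, s) \<bullet> y"
  define \<alpha> where "\<alpha> = (- (1 / s)) *\<^sub>R \<alpha>0"
  define \<beta> where "\<beta> = b / s"
  have "(\<alpha>0, s) \<bullet> (x, t) = b \<longleftrightarrow> t = \<alpha> \<bullet> x + \<beta>" for x t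
    using s by (simp add: \<alpha>_def \<beta>_def field_simps)
  then have "{z. (\<alpha>0, s) \<bullet> z = b} = {(x, t). t = \<alpha> \<bullet> x + \<beta>}" by (auto simp del: inner_Pair)
  moreover have "t \<le> \<alpha> \<bullet> x + \<beta>" if "(x, t) \<in> hypograph V c" for x t
    using a[OF that, folded b_def] s by (simp add: \<alpha>_def \<beta>_def field_simps)
  then have "\<forall>v\<in>V. c v \<le> \<alpha> \<bullet> v + \<beta>" using hypograph_vertex by blast
  ultimately show ?thesis unfolding b_def by blast
qed

lemma upper_face_of:
  assumes "\<And>v. v \<in> V \<Longrightarrow> c v \<le> \<alpha> \<bullet> v + \<beta>"
  shows "(hypograph V c \<inter> {(x, t). t = \<alpha> \<bullet> x + \<beta>}) face_of hypograph V c"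
proof -
  have eq: "{(x, t). t = \<alpha> \<bullet> x + \<beta>} = {y. (- \<alpha>, 1) \<bullet> y = \<beta>}"
    by (auto simp: inner_prod_def)
  show ?thesis unfolding eq
    by (rule face_of_Int_supporting_hyperplane_le[OF convex_hypograph])
      (use hypograph_le[of \<alpha> \<beta>] assms in \<open>force simp: inner_prod_def\<close>)
qed

text \<open>The rays contribute exactly one direction, the vertical one: the affine hull is that of
  a flat copy of \<open>V\<close> and one further point below it.\<close>

lemma aff_dim_hypograph: "aff_dim (hypograph V c) = aff_dim V + 1"
proof -
  obtain v0 where v0: "v0 \<in> V" using V_nonempty by auto
  let ?Z = "(\<lambda>v. (v, 0::real)) ` V"
  have lin: "linear (\<lambda>v. (v::'v, 0::real))" by (intro linearI) auto
  have d: "aff_dim ?Z = aff_dim V"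
    by (rule aff_dim_injective_linear_image[OF lin]) (auto simp: inj_on_def)
  have "affine hull ?Z \<subseteq> {y. (0, 1) \<bullet> y = 0}"
    by (rule hull_minimal) (auto simp: affine_hyperplane simp del: inner_Pair_0)
  then have "(v0, -1) \<notin> affine hull ?Z" by (auto simp: inner_prod_def)
  then have d1: "aff_dim (insert (v0, -1) ?Z) = aff_dim V + 1" using d by (simp add: aff_dim_insert)
  have "affine hull (hypograph V c) = affine hull (insert (v0, -1) ?Z)"
  proof
    have mem: "(v, t) \<in> affine hull (insert (v0, -1) ?Z)" if "v \<in> V" for v t
    proof -
      have "1 *\<^sub>R (v, 0::real) + (-t) *\<^sub>R ((v0, -1) - (v0, 0)) \<in> affine hull (insert (v0, -1) ?Z)"
        using v0 that mem_affine_3_minus[OF affine_affine_hull, of "(v,0)" "insert (v0, -1) ?Z" "(v0,-1)" "(v0,0)" "-t"]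
        by (auto simp: hull_inc)
      then show ?thesis by simp
    qed
    have "hypograph V c \<subseteq> affine hull (insert (v0, -1) ?Z)"
      unfolding hypograph_def
      by (rule hull_minimal) (use mem affine_imp_convex in auto)
    then show "affine hull (hypograph V c) \<subseteq> affine hull (insert (v0, -1) ?Z)"
      by (simp add: hull_minimal)
    have mem2: "(v, t) \<in> affine hull (hypograph V c)" if v: "v \<in> V" for v t
    proof -
      have "(v, c v) + (c v - t) *\<^sub>R ((v, c v - 1) - (v, c v)) \<in> affine hull (hypograph V c)"
        using v by (intro mem_affine_3_minus[OF affine_affine_hull]) (auto intro!: hull_inc hypograph_vertex)
      then show ?thesis by simp
    qed
    show "affine hull (insert (v0, -1) ?Z) \<subseteq> affine hull (hypograph V c)"
      by (rule hull_minimal) (use mem2 v0 in auto)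
  qed
  then show ?thesis using d1 by (metis aff_dim_affine_hull)
qed

lemma aff_dim_upper_face:
  "aff_dim (convex hull ((\<lambda>v. (v, c v)) ` tight_set V c \<alpha> \<beta>)) = aff_dim (tight_set V c \<alpha> \<beta>)"
proof -
  have lin: "linear (\<lambda>v. (v::'v, \<alpha> \<bullet> v))" by (intro linearI) (auto simp: inner_right_distrib)
  have "(\<lambda>v. (v, c v)) ` tight_set V c \<alpha> \<beta> = (+) (0, \<beta>) ` (\<lambda>v. (v, \<alpha> \<bullet> v)) ` tight_set V c \<alpha> \<beta>"
    unfolding image_image by (rule image_cong) (auto simp: tight_set_def)
  then have "aff_dim ((\<lambda>v. (v, c v)) ` tight_set V c \<alpha> \<beta>) = aff_dim ((\<lambda>v. (v, \<alpha> \<bullet> v)) ` tight_set V c \<alpha> \<beta>)"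
    by (simp only: aff_dim_translation_eq)
  also have "\<dots> = aff_dim (tight_set V c \<alpha> \<beta>)"
    by (rule aff_dim_injective_linear_image[OF lin]) (auto simp: inj_on_def)
  finally show ?thesis by (simp only: aff_dim_convex_hull)
qed

lemma fst_convex_hull_graph: "fst ` (convex hull ((\<lambda>v. (v, c v)) ` T)) = convex hull T"
proof -
  have "fst ` (convex hull ((\<lambda>v. (v, c v)) ` T)) = convex hull (fst ` (\<lambda>v. (v, c v)) ` T)"
    by (rule convex_hull_linear_image) (simp add: linear_fst)
  then show ?thesis by (simp add: image_image)
qed

lemma aff_dim_eq_iff_hull: "T \<subseteq> V \<Longrightarrow> aff_dim T = aff_dim V \<longleftrightarrow> V \<subseteq> affine hull T"
proof
  assume T: "T \<subseteq> V"
  show "V \<subseteq> affine hull T" if d: "aff_dim T = aff_dim V"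
  proof
    fix v assume v: "v \<in> V"
    have "insert v T \<subseteq> V" using T v by auto
    then have "aff_dim (insert v T) \<le> aff_dim V" by (rule aff_dim_subset)
    then show "v \<in> affine hull T" using d by (auto simp: aff_dim_insert split: if_splits)
  qed
  show "aff_dim T = aff_dim V" if "V \<subseteq> affine hull T"
    using aff_dim_subset[OF T] aff_dim_subset[OF that] by simp
qed

text \<open>By comparison of dimensions, a facet is cut out by a supporting hyperplane at one of its
  relatively interior points; boundedness excludes vertical hyperplanes.\<close>

lemma bounded_facet_iff:
  "G facet_of hypograph V c \<and> bounded G \<longleftrightarrow>
    (\<exists>\<alpha> \<beta>. (\<forall>v\<in>V. c v \<le> \<alpha> \<bullet> v + \<beta>) \<and> V \<subseteq> affine hull tight_set V c \<alpha> \<beta> \<and>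
       G = convex hull ((\<lambda>v. (v, c v)) ` tight_set V c \<alpha> \<beta>))"
proof
  assume "\<exists>\<alpha> \<beta>. (\<forall>v\<in>V. c v \<le> \<alpha> \<bullet> v + \<beta>) \<and> V \<subseteq> affine hull tight_set V c \<alpha> \<beta> \<and>
       G = convex hull ((\<lambda>v. (v, c v)) ` tight_set V c \<alpha> \<beta>)"
  then obtain \<alpha> \<beta> where h: "\<And>v. v\<in>V \<Longrightarrow> c v \<le> \<alpha> \<bullet> v + \<beta>" "V \<subseteq> affine hull tight_set V c \<alpha> \<beta>"
    "G = convex hull ((\<lambda>v. (v, c v)) ` tight_set V c \<alpha> \<beta>)" by auto
  have sub: "tight_set V c \<alpha> \<beta> \<subseteq> V" by (auto simp: tight_set_def)
  have "G face_of hypograph V c"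
    using upper_face_of[OF h(1)] hypograph_upper_face[OF h(1)] h(3) by simp
  moreover have "tight_set V c \<alpha> \<beta> \<noteq> {}" using h(2) V_nonempty by auto
  then have "G \<noteq> {}" unfolding h(3) by simp
  moreover have "aff_dim G = aff_dim (hypograph V c) - 1"
    unfolding h(3) aff_dim_upper_face aff_dim_hypograph using h(2) aff_dim_eq_iff_hull[OF sub] by simp
  moreover have "bounded G" unfolding h(3)
    using finite_subset[OF sub finite_V] by (intro bounded_convex_hull finite_imp_bounded) auto
  ultimately show "G facet_of hypograph V c \<and> bounded G" by (simp add: facet_of_def)
next
  let ?H = "hypograph V c"
  assume "G facet_of ?H \<and> bounded G"
  then have G: "G face_of ?H" "G \<noteq> {}" "aff_dim G = aff_dim ?H - 1" "bounded G" by (auto simp: facet_of_def)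
  have "rel_interior G \<noteq> {}"
    using G face_of_imp_convex rel_interior_eq_empty by blast
  then obtain y where y: "y \<in> rel_interior G" by auto
  have Gsub: "G \<subseteq> ?H" using G face_of_imp_subset by blast
  have yG: "y \<in> G" using y rel_interior_subset by blast
  have "G \<noteq> ?H" using G by auto
  then have "disjnt G (rel_interior ?H)" using face_of_disjoint_rel_interior[OF G(1)] by (auto simp: disjnt_def)
  then have "y \<notin> rel_interior ?H" using yG by (auto simp: disjnt_def)
  then obtain a where a: "a \<noteq> 0" "\<And>z. z \<in> ?H \<Longrightarrow> a \<bullet> y \<le> a \<bullet> z" "\<And>z. z \<in> rel_interior ?H \<Longrightarrow> a \<bullet> y < a \<bullet> z"
    using supporting_hyperplane_rel_boundary[OF convex_hypograph subsetD[OF Gsub yG]] by blast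
  note a2 = a(2)
  define b where "b = a \<bullet> y"
  have face: "(?H \<inter> {z. a \<bullet> z = b}) face_of ?H"
    by (rule face_of_Int_supporting_hyperplane_ge[OF convex_hypograph]) (simp add: b_def a2)
  have GsubF: "G \<subseteq> ?H \<inter> {z. a \<bullet> z = b}"
  proof (rule subset_of_face_of[OF face Gsub])
    show "(?H \<inter> {z. a \<bullet> z = b}) \<inter> rel_interior G \<noteq> {}"
      using y yG Gsub by (auto simp: b_def)
  qed
  have "rel_interior ?H \<noteq> {}" using yG Gsub convex_hypograph rel_interior_eq_empty by blast
  then obtain z where z: "z \<in> rel_interior ?H" by auto
  then have "z \<in> ?H" "a \<bullet> z \<noteq> b" using a(3)[OF z] rel_interior_subset b_def by auto
  then have "?H \<inter> {z. a \<bullet> z = b} \<noteq> ?H" by blast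
  then have "aff_dim (?H \<inter> {z. a \<bullet> z = b}) < aff_dim ?H"
    by (rule face_of_aff_dim_lt[OF convex_hypograph face])
  moreover have gf: "G face_of (?H \<inter> {z. a \<bullet> z = b})"
    using face_of_subset[OF G(1) GsubF] by auto
  ultimately have Geq: "G = ?H \<inter> {z. a \<bullet> z = b}"
    using face_of_aff_dim_lt[OF face_of_imp_convex[OF face] gf] G(3) by force
  obtain \<alpha>0 s where as: "a = (\<alpha>0, s)" by (cases a)
  obtain x0 t0 where y0: "y = (x0, t0)" by (cases y)
  have s1: "s \<noteq> 0"
  proof
    assume s: "s = 0"
    have mem: "(x0, t) \<in> G" if "t \<le> t0" for t
      using yG Gsub y0 that hypograph_down unfolding Geq by (auto simp: as s b_def)
    obtain B where B: "\<And>z. z \<in> G \<Longrightarrow> norm z \<le> B" using G(4) by (auto simp: bounded_iff)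
    \<comment> \<open>The height \<open>min t0 (- B - 1)\<close> lies on the downward ray below
      \<open>y\<close> and exceeds \<open>B\<close> in absolute value.\<close>
    have "\<bar>min t0 (- B - 1)\<bar> \<le> norm (x0, min t0 (- B - 1))"
      using norm_snd_le[where x = x0 and y = "min t0 (-B-1)"] by simp
    also have "\<dots> \<le> B" by (rule B[OF mem]) simp
    finally show False using B[OF yG] norm_ge_zero[of y] by linarith
  qed
  have "y \<in> ?H" using yG Gsub by blast
  from nonvertical_support[OF this a2[unfolded as] s1, folded as, folded b_def]
  obtain \<alpha> \<beta> where sup: "\<And>v. v \<in> V \<Longrightarrow> c v \<le> \<alpha> \<bullet> v + \<beta>"
      and "{z. a \<bullet> z = b} = {(x, t). t = \<alpha> \<bullet> x + \<beta>}" by metis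
  then have Gt: "G = convex hull ((\<lambda>v. (v, c v)) ` tight_set V c \<alpha> \<beta>)"
    using Geq hypograph_upper_face[OF sup] by simp
  have sub: "tight_set V c \<alpha> \<beta> \<subseteq> V" by (auto simp: tight_set_def)
  have "V \<subseteq> affine hull tight_set V c \<alpha> \<beta>"
    using G(3) unfolding Gt aff_dim_upper_face aff_dim_hypograph by (simp flip: aff_dim_eq_iff_hull[OF sub])
  with sup Gt show "\<exists>\<alpha> \<beta>. (\<forall>v\<in>V. c v \<le> \<alpha> \<bullet> v + \<beta>) \<and> V \<subseteq> affine hull tight_set V c \<alpha> \<beta> \<and>
       G = convex hull ((\<lambda>v. (v, c v)) ` tight_set V c \<alpha> \<beta>)" by blast
qed

lemma regular_subdivision_eq:
  assumes "V = {v. v extreme_point_of Q}"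
  shows "regular_subdivision Q c = {convex hull T | T. upper_cell V c T}"
proof -
  have "regular_subdivision Q c = {fst ` G | G. G facet_of hypograph V c \<and> bounded G}"
    unfolding regular_subdivision_def Let_def hypograph_def assms ..
  also have "\<dots> = {convex hull T | T. upper_cell V c T}"
    unfolding bounded_facet_iff upper_cell_def using fst_convex_hull_graph by (auto; metis)
  finally show ?thesis .
qed

text \<open>The hull of the finitely many top points is compact and the vertical ray is closed.
  Closedness makes the supremum of the heights over a point attained.\<close>

lemma closed_hypograph: "closed (hypograph V c)"
proof -
  let ?K = "convex hull ((\<lambda>v. (v, c v)) ` V)"
  let ?D = "{0::'v} \<times> {..0::real}"
  have "hypograph V c = (\<Union>p\<in>?K. \<Union>q\<in>?D. {p + q})"
  proof
    show "hypograph V c \<subseteq> (\<Union>p\<in>?K. \<Union>q\<in>?D. {p + q})"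
    proof clarify
      fix x t assume "(x, t) \<in> hypograph V c"
      then obtain u where u: "\<And>v. v\<in>V \<Longrightarrow> 0 \<le> u v" "sum u V = 1" "x = (\<Sum>v\<in>V. u v *\<^sub>R v)" "t \<le> (\<Sum>v\<in>V. u v * c v)"
        unfolding hypograph_iff by blast
      have "(\<Sum>v\<in>V. u v *\<^sub>R (v, c v)) \<in> ?K"
        by (rule convex_sum) (use u finite_V in \<open>auto intro: hull_inc\<close>)
      moreover have "(\<Sum>v\<in>V. u v *\<^sub>R (v, c v)) = (x, \<Sum>v\<in>V. u v * c v)"
        by (rule prod_eqI) (use u in \<open>simp_all add: fst_sum snd_sum\<close>)
      ultimately have "(x, \<Sum>v\<in>V. u v * c v) \<in> ?K" by simp
      then show "(x, t) \<in> (\<Union>p\<in>?K. \<Union>q\<in>?D. {p + q})"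
        using u(4) by (intro UN_I[of "(x, \<Sum>v\<in>V. u v * c v)"] UN_I[of "(0, t - (\<Sum>v\<in>V. u v * c v))"]) auto
    qed
    have "?K \<subseteq> hypograph V c"
      by (rule hull_minimal) (auto intro: hypograph_vertex convex_hypograph)
    then show "(\<Union>p\<in>?K. \<Union>q\<in>?D. {p + q}) \<subseteq> hypograph V c"
      using hypograph_down by auto
  qed
  also have "closed \<dots>"
    using finite_V by (intro compact_closed_sums compact_convex_hull finite_imp_compact closed_Times) auto
  finally show ?thesis .
qed

text \<open>The hypograph is supported at its highest point over \<open>x\<close>. A vertical
  supporting hyperplane would properly support the hull of \<open>V\<close> at its relatively
  interior point \<open>x\<close>, which is impossible.\<close>

lemma support_at_rel_interior:
  assumes x: "x \<in> rel_interior (convex hull V)"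
  obtains \<alpha> \<beta> where "\<And>v. v \<in> V \<Longrightarrow> c v \<le> \<alpha> \<bullet> v + \<beta>" "x \<in> convex hull (tight_set V c \<alpha> \<beta>)"
proof -
  let ?H = "hypograph V c"
  define D where "D = {t. (x, t) \<in> ?H}"
  have "x \<in> convex hull V" using x rel_interior_subset by blast
  then obtain t0 where t0: "(x, t0) \<in> ?H" using fst_hypograph by force
  have bdd: "t \<le> Max (c ` V)" if "(z, t) \<in> ?H" for z t
    using hypograph_le[of 0 "Max (c ` V)" z t] that finite_V by auto
  then have bddD: "bdd_above D" by (auto simp: D_def bdd_above_def)
  define h where "h = Sup D"
  have "(x, h) \<in> closure ?H"
    unfolding closure_approachable
  proof (intro allI impI)
    fix e :: real assume e: "e > 0"
    then obtain t where t: "t \<in> D" "h - e < t"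
      using less_cSup_iff[of D "h - e"] bddD t0 by (auto simp: D_def h_def)
    have "t \<le> h" using t bddD by (auto simp: h_def intro: cSup_upper)
    then show "\<exists>y\<in>?H. dist y (x, h) < e"
      using t e by (intro bexI[of _ "(x, t)"]) (auto simp: D_def dist_prod_def dist_real_def)
  qed
  then have hm: "(x, h) \<in> ?H" using closed_hypograph by simp
  \<comment> \<open>Otherwise the vertical segment from \<open>(x, h - 1)\<close> could be prolonged
    beyond \<open>(x, h)\<close>.\<close>
  have nri: "(x, h) \<notin> rel_interior ?H"
  proof
    assume h: "(x, h) \<in> rel_interior ?H"
    have "(x, h - 1) \<in> ?H" using hm by (rule hypograph_down) simp
    then obtain e where e: "e > 1" "(1 - e) *\<^sub>R (x, h - 1) + e *\<^sub>R (x, h) \<in> ?H"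
      using h convex_rel_interior_iff[OF convex_hypograph] hm by blast
    have "(1 - e) *\<^sub>R (x, h - 1) + e *\<^sub>R (x, h) = (x, h + (e - 1))"
      by (auto simp: algebra_simps)
    then have "h + (e - 1) \<in> D" using e by (simp add: D_def)
    then have "h + (e - 1) \<le> h" unfolding h_def by (rule cSup_upper[OF _ bddD])
    then show False using e by simp
  qed
  obtain a where a: "a \<noteq> 0" "\<And>z. z \<in> ?H \<Longrightarrow> a \<bullet> (x, h) \<le> a \<bullet> z"
      "\<And>z. z \<in> rel_interior ?H \<Longrightarrow> a \<bullet> (x, h) < a \<bullet> z"
    using supporting_hyperplane_rel_boundary[OF convex_hypograph hm nri] by blast
  note a2 = a(2)
  obtain \<alpha>0 s where as: "a = (\<alpha>0, s)" by (cases a)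
  have s1: "s \<noteq> 0"
  proof
    assume s: "s = 0"
    have "?H \<noteq> {}" using t0 by auto
    then obtain z where z: "z \<in> rel_interior ?H" using convex_hypograph rel_interior_eq_empty by blast
    then have zlt: "\<alpha>0 \<bullet> x < \<alpha>0 \<bullet> fst z" using a(3)[OF z] by (cases z) (simp add: as s)
    have "fst z \<in> convex hull V" using z rel_interior_subset fst_hypograph by blast
    then obtain e where e: "e > 1" "(1 - e) *\<^sub>R fst z + e *\<^sub>R x \<in> convex hull V"
      using x convex_rel_interior_iff[OF convex_convex_hull] by blast
    then obtain t where "((1 - e) *\<^sub>R fst z + e *\<^sub>R x, t) \<in> ?H" using fst_hypograph by force
    from a2[OF this] have "\<alpha>0 \<bullet> x \<le> (1 - e) * (\<alpha>0 \<bullet> fst z) + e * (\<alpha>0 \<bullet> x)"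
      by (simp add: as s inner_right_distrib)
    then have "(e - 1) * (\<alpha>0 \<bullet> fst z) \<le> (e - 1) * (\<alpha>0 \<bullet> x)" by (simp add: algebra_simps)
    with e zlt show False by simp
  qed
  from nonvertical_support[OF hm a2[unfolded as] s1]
  obtain \<alpha> \<beta> where sup: "\<And>v. v \<in> V \<Longrightarrow> c v \<le> \<alpha> \<bullet> v + \<beta>"
      and eq: "{z. (\<alpha>0, s) \<bullet> z = (\<alpha>0, s) \<bullet> (x, h)} = {(x, t). t = \<alpha> \<bullet> x + \<beta>}" by metis
  have "(x, h) \<in> ?H \<inter> {(x, t). t = \<alpha> \<bullet> x + \<beta>}" using hm eq by blast
  then have "(x, h) \<in> convex hull ((\<lambda>v. (v, c v)) ` tight_set V c \<alpha> \<beta>)"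
    using hypograph_upper_face[OF sup] by simp
  then have "x \<in> convex hull (tight_set V c \<alpha> \<beta>)" using fst_convex_hull_graph by force
  with sup show thesis by (rule that)
qed

text \<open>Among the supporting functions that touch the envelope above \<open>x\<close>, one with a largest tight set
  works: otherwise it can be tilted about its tight set until a further vertex becomes tight.\<close>

lemma upper_cell_cover:
  assumes x: "x \<in> rel_interior (convex hull V)"
  obtains T where "upper_cell V c T" "x \<in> convex hull T"
proof -
  define P where "P = (\<lambda>(\<alpha>, \<beta>). (\<forall>v\<in>V. c v \<le> \<alpha> \<bullet> v + \<beta>) \<and> x \<in> convex hull (tight_set V c \<alpha> \<beta>))"
  define f where "f = (\<lambda>(\<alpha>, \<beta>). card (tight_set V c \<alpha> \<beta>))"
  have sub: "tight_set V c \<alpha> \<beta> \<subseteq> V" for \<alpha> \<beta> by (auto simp: tight_set_def)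
  obtain \<alpha>1 \<beta>1 where "\<And>v. v \<in> V \<Longrightarrow> c v \<le> \<alpha>1 \<bullet> v + \<beta>1" "x \<in> convex hull (tight_set V c \<alpha>1 \<beta>1)"
    using support_at_rel_interior[OF x] by blast
  then have "P (\<alpha>1, \<beta>1)" by (simp add: P_def)
  then have "\<exists>y. P y" ..
  moreover have "\<forall>y. P y \<longrightarrow> f y < Suc (card V)"
    using sub finite_V by (auto simp: f_def less_Suc_eq_le intro: card_mono)
  ultimately obtain y where y: "P y" "\<And>z. P z \<Longrightarrow> f z \<le> f y"
    using ex_has_greatest_nat[of P _ f "Suc (card V)"] by blast
  obtain \<alpha> \<beta> where ab: "y = (\<alpha>, \<beta>)" by (cases y)
  let ?T = "tight_set V c \<alpha> \<beta>"
  have sup: "\<And>v. v \<in> V \<Longrightarrow> c v \<le> \<alpha> \<bullet> v + \<beta>" and xT: "x \<in> convex hull ?T"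
    using y(1) by (auto simp: P_def ab)
  have "V \<subseteq> affine hull ?T"
  proof (rule ccontr)
    assume "\<not> V \<subseteq> affine hull ?T"
    then obtain v1 where v1: "v1 \<in> V" "v1 \<notin> affine hull ?T" by auto
    obtain \<gamma>0 \<delta>0 where g0: "\<And>v. v \<in> ?T \<Longrightarrow> \<gamma>0 \<bullet> v + \<delta>0 = 0" "\<gamma>0 \<bullet> v1 + \<delta>0 \<noteq> 0"
      using not_in_affine_hull_separated[OF v1(2)] by metis
    obtain \<gamma> \<delta> where g: "\<And>v. v \<in> ?T \<Longrightarrow> \<gamma> \<bullet> v + \<delta> = 0" "\<gamma> \<bullet> v1 + \<delta> < 0"
    proof (cases "\<gamma>0 \<bullet> v1 + \<delta>0 < 0")
      case False
      show thesis
      proof (rule that[of "- \<gamma>0" "- \<delta>0"])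
        show "- \<gamma>0 \<bullet> v + - \<delta>0 = 0" if "v \<in> ?T" for v
          using g0(1)[OF that] unfolding inner_minus_left by linarith
        show "- \<gamma>0 \<bullet> v1 + - \<delta>0 < 0" using g0(2) False unfolding inner_minus_left by linarith
      qed
    qed (use g0 that in blast)
    \<comment> \<open>Only vertices where the tilt function \<gamma> \<bullet> v + \<delta> is
      negative lose height; \<open>r v\<close> is the multiple of the tilt at which such a vertex
      becomes tight, so the least of these multiples keeps the support.\<close>
    define N where "N = {v\<in>V. \<gamma> \<bullet> v + \<delta> < 0}"
    define r where "r = (\<lambda>v. (\<alpha> \<bullet> v + \<beta> - c v) / - (\<gamma> \<bullet> v + \<delta>))"
    have N: "finite N" "N \<noteq> {}" using finite_V v1 g by (auto simp: N_def)
    define \<epsilon> where "\<epsilon> = Min (r ` N)"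
    have "\<epsilon> \<in> r ` N" unfolding \<epsilon>_def using N by (intro Min_in) auto
    then obtain v2 where v2: "v2 \<in> N" "\<epsilon> = r v2" by auto
    have le: "\<epsilon> \<le> r v" if "v \<in> N" for v unfolding \<epsilon>_def using N that by (intro Min_le) auto
    have e0: "0 \<le> \<epsilon>" unfolding v2 r_def using v2(1) sup[of v2] by (auto simp: N_def divide_nonneg_pos)
    let ?\<alpha> = "\<alpha> + \<epsilon> *\<^sub>R \<gamma>" and ?\<beta> = "\<beta> + \<epsilon> * \<delta>"
    have ev: "?\<alpha> \<bullet> v + ?\<beta> = (\<alpha> \<bullet> v + \<beta>) + \<epsilon> * (\<gamma> \<bullet> v + \<delta>)" for v
      by (simp add: inner_add_left algebra_simps)
    have sup': "c v \<le> ?\<alpha> \<bullet> v + ?\<beta>" if "v \<in> V" for v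
    proof (cases "v \<in> N")
      case True
      then have neg: "- (\<gamma> \<bullet> v + \<delta>) > 0" by (simp add: N_def)
      have "\<epsilon> * - (\<gamma> \<bullet> v + \<delta>) \<le> \<alpha> \<bullet> v + \<beta> - c v"
        using le[OF True] unfolding r_def pos_le_divide_eq[OF neg] .
      then show ?thesis unfolding ev by linarith
    next
      case False
      then have "0 \<le> \<gamma> \<bullet> v + \<delta>" using that by (simp add: N_def)
      then show ?thesis unfolding ev using sup[OF that] mult_nonneg_nonneg[OF e0] by force
    qed
    have T': "?T \<subseteq> tight_set V c ?\<alpha> ?\<beta>"
      using g(1) unfolding tight_set_def mem_Collect_eq ev by auto
    have "v2 \<in> tight_set V c ?\<alpha> ?\<beta>"
    proof -
      have nz: "- (\<gamma> \<bullet> v2 + \<delta>) \<noteq> 0" using v2(1) by (simp add: N_def)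
      have "\<epsilon> * - (\<gamma> \<bullet> v2 + \<delta>) = \<alpha> \<bullet> v2 + \<beta> - c v2"
        using v2(2) unfolding r_def nonzero_eq_divide_eq[OF nz] .
      then have "\<epsilon> * (\<gamma> \<bullet> v2 + \<delta>) = c v2 - (\<alpha> \<bullet> v2 + \<beta>)" by linarith
      then show ?thesis using v2(1) unfolding tight_set_def mem_Collect_eq ev by (simp add: N_def)
    qed
    moreover have "v2 \<notin> ?T" using v2(1) g(1) by (force simp: N_def)
    ultimately have "?T \<subset> tight_set V c ?\<alpha> ?\<beta>" using T' by auto
    then have "card ?T < card (tight_set V c ?\<alpha> ?\<beta>)"
      using finite_subset[OF sub finite_V] by (intro psubset_card_mono)
    moreover have "P (?\<alpha>, ?\<beta>)"
      using sup' xT hull_mono[OF T'] by (auto simp: P_def)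
    ultimately show False using y(2)[of "(?\<alpha>, ?\<beta>)"] by (simp add: f_def ab)
  qed
  then have "upper_cell V c ?T" using sup by (auto simp: upper_cell_def)
  then show thesis using xT that by blast
qed

end

section \<open>Birkhoff duality and order polytopes\<close>

abbreviation "jirr \<equiv> join_irreducibles"

lemma exists_least: "\<exists>z :: 'a::{finite,lattice}. \<forall>a. z \<le> a"
  by (rule exI[of _ "Inf_fin UNIV"]) (simp add: Inf_fin.coboundedI)

lemma birkhoff_least: "(\<And>b. z \<le> b) \<Longrightarrow> birkhoff (z :: 'a::lattice) = {}"
proof -
  assume z: "\<And>b. z \<le> b"
  have False if p: "p \<in> jirr" "p \<le> z" for p
  proof -
    obtain b where "b < p" using p(1) by (auto simp: join_irreducibles_def)
    then show False using p(2) z[of b] by (metis leD order_trans)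
  qed
  then show ?thesis by (auto simp: birkhoff_def)
qed

text \<open>Distributivity splits \<open>p\<close> into the join of \<open>inf p b\<close> and
  \<open>inf p c\<close>. Join-irreducibles are therefore join-prime, which makes
  \<open>birkhoff\<close> turn joins into unions.\<close>

lemma jirr_prime:
  fixes p :: "'a::distrib_lattice"
  assumes "p \<in> jirr" "p \<le> sup b c"
  shows "p \<le> b \<or> p \<le> c"
proof -
  have "p = sup (inf p b) (inf p c)"
    using assms(2) by (simp add: inf_sup_distrib1[symmetric] inf_absorb1)
  then have "p = inf p b \<or> p = inf p c" using assms(1) unfolding join_irreducibles_def by blast
  then show ?thesis by (metis inf.cobounded2)
qed

lemma birkhoff_sup: "birkhoff (sup a b :: 'a::distrib_lattice) = birkhoff a \<union> birkhoff b"
  unfolding birkhoff_def by (auto dest: jirr_prime intro: le_supI1 le_supI2)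

lemma birkhoff_inf: "birkhoff (inf a b :: 'a::lattice) = birkhoff a \<inter> birkhoff b"
  unfolding birkhoff_def by auto

text \<open>An element that is neither minimal nor join-irreducible is the join of two strictly
  smaller ones, to which the induction applies.\<close>

lemma birkhoff_subset_iff: "birkhoff a \<subseteq> birkhoff b \<longleftrightarrow> a \<le> (b :: 'a::{finite,lattice})"
proof
  show "a \<le> b" if "birkhoff a \<subseteq> birkhoff b"
    using that
  proof (induction "card {c. c < a}" arbitrary: a rule: less_induct)
    case (less a)
    consider (min) "\<not> (\<exists>c. c < a)" | (jirr) "a \<in> jirr" | (red) b' c' where "a = sup b' c'" "a \<noteq> b'" "a \<noteq> c'"
      unfolding join_irreducibles_def by blast
    then show ?case
    proof cases
      case min
      then have "\<not> inf a b < a" by blast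
      then have "inf a b = a" by (simp add: less_le)
      then show ?thesis by (simp add: inf.order_iff)
    next
      case jirr
      then have "a \<in> birkhoff a" by (simp add: birkhoff_def)
      then show ?thesis using less.prems by (auto simp: birkhoff_def)
    next
      case red
      have l: "b' < a" "c' < a" using red by (simp_all add: less_le sup.cobounded1)
      have "birkhoff b' \<subseteq> birkhoff a" "birkhoff c' \<subseteq> birkhoff a"
        using l by (auto simp: birkhoff_def intro: order_trans dest: less_imp_le)
      moreover have "card {c. c < b'} < card {c. c < a}" "card {c. c < c'} < card {c. c < a}"
        using l by (auto intro!: psubset_card_mono intro: less_trans)
      ultimately have "b' \<le> b" "c' \<le> b" using less by auto
      then show ?thesis using red by simp
    qed
  qed
qed (auto simp: birkhoff_def intro: order_trans)

lemma birkhoff_eq_iff [simp]: "birkhoff a = birkhoff b \<longleftrightarrow> a = (b :: 'a::{finite,lattice})"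
  by (metis birkhoff_subset_iff antisym order_refl)

lemma birkhoff_downset:
  fixes S :: "'a::{finite,distrib_lattice} set"
  assumes "S \<subseteq> jirr"
  shows "\<exists>a. birkhoff a = {p\<in>jirr. \<exists>q\<in>S. p \<le> q}"
  using finite[of S] assms
proof (induction S rule: finite_induct)
  case empty
  obtain z :: 'a where "\<And>b. z \<le> b" using exists_least by blast
  then have "birkhoff z = {}" by (rule birkhoff_least)
  then show ?case by (intro exI[of _ z]) simp
next
  case (insert q S)
  then obtain a where a: "birkhoff a = {p\<in>jirr. \<exists>q\<in>S. p \<le> q}" by auto
  have "birkhoff (sup q a) = {p\<in>jirr. p \<le> q} \<union> {p\<in>jirr. \<exists>q\<in>S. p \<le> q}"
    unfolding birkhoff_sup a by (simp add: birkhoff_def)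
  also have "\<dots> = {p\<in>jirr. \<exists>q\<in>insert q S. p \<le> q}" by auto
  finally show ?case ..
qed

lemma birkhoff_surj:
  fixes S :: "'a::{finite,distrib_lattice} set"
  assumes "S \<subseteq> jirr" "\<And>p q. q \<in> S \<Longrightarrow> p \<in> jirr \<Longrightarrow> p \<le> q \<Longrightarrow> p \<in> S"
  obtains a where "birkhoff a = S"
proof -
  obtain a where "birkhoff a = {p\<in>jirr. \<exists>q\<in>S. p \<le> q}" using birkhoff_downset[OF assms(1)] by auto
  also have "\<dots> = S" using assms by blast
  finally show thesis by (rule that)
qed


section \<open>Order polytopes and their vertices\<close>

abbreviation "bv \<equiv> birkhoff_vertex"

lemma bv_nth: "bv a $ p = of_bool (p \<in> birkhoff a)"
  by (simp add: birkhoff_vertex_def indicator_def of_bool_def)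

lemma axis_inner_bv: "axis p 1 \<bullet> bv a = of_bool (p \<in> jirr \<and> p \<le> a)"
  by (simp add: inner_axis' bv_nth birkhoff_def)

lemma bv_inj [simp]: "bv a = bv b \<longleftrightarrow> a = b"
proof
  assume "bv a = bv b"
  then have "of_bool (p \<in> birkhoff a) = (of_bool (p \<in> birkhoff b) :: real)" for p
    by (metis bv_nth)
  then have "p \<in> birkhoff a \<longleftrightarrow> p \<in> birkhoff b" for p by (metis of_bool_eq_iff)
  then have "birkhoff a = birkhoff b" by blast
  then show "a = b" by simp
qed auto

lemma inj_bv: "inj bv" by (simp add: inj_on_def)

lemma bv_modular: "bv a + bv b = bv (sup a b) + bv (inf a (b::'a::{finite,distrib_lattice}))"
proof (rule vec_eq_iff[THEN iffD2], rule allI)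
  fix p
  show "(bv a + bv b) $ p = (bv (sup a b) + bv (inf a b)) $ p"
    by (cases "p \<in> birkhoff a"; cases "p \<in> birkhoff b") (simp_all add: bv_nth birkhoff_sup birkhoff_inf)
qed

text \<open>Affine functions of the vertices are modular on the lattice, so subtracting one from
  \<open>w\<close> changes no modularity defect.\<close>

lemma affine_bv_modular:
  "(\<alpha> \<bullet> bv a + \<beta>) + (\<alpha> \<bullet> bv b + \<beta>) = (\<alpha> \<bullet> bv (sup a b) + \<beta>) + (\<alpha> \<bullet> bv (inf a (b::'a::{finite,distrib_lattice})) + (\<beta>::real))"
proof -
  have "\<alpha> \<bullet> (bv a + bv b) = \<alpha> \<bullet> (bv (sup a b) + bv (inf a b))" by (rule arg_cong[OF bv_modular])
  then show ?thesis by (simp add: inner_add_right)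
qed

lemma psi_bv [simp]: "psi w (bv a) = w $ a"
  by (simp add: psi_def the_inv_f_f inj_bv)

lemma convex_order_polytope: "convex (order_polytope r)"
proof (rule convexI)
  fix x y :: "(real, 'a) vec" and u v :: real
  assume h: "x \<in> order_polytope r" "y \<in> order_polytope r" "0 \<le> u" "0 \<le> v" "u + v = 1"
  show "u *\<^sub>R x + v *\<^sub>R y \<in> order_polytope r"
    unfolding order_polytope_def
  proof (intro CollectI conjI allI ballI impI)
    fix p :: 'a
    assume p: "p \<in> jirr"
    have "u * x $ p + v * y $ p \<le> u * 1 + v * 1"
      using h p by (intro add_mono mult_left_mono) (auto simp: order_polytope_def)
    then show "(u *\<^sub>R x + v *\<^sub>R y) $ p \<le> 1" using h by simp
    show "0 \<le> (u *\<^sub>R x + v *\<^sub>R y) $ p" using h p by (auto simp: order_polytope_def)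
  next
    fix p q :: 'a
    assume "(q, p) \<in> r"
    then have "u * x $ p + v * y $ p \<le> u * x $ q + v * y $ q"
      using h by (intro add_mono mult_left_mono) (auto simp: order_polytope_def)
    then show "(u *\<^sub>R x + v *\<^sub>R y) $ p \<le> (u *\<^sub>R x + v *\<^sub>R y) $ q" by simp
  qed (use h in \<open>auto simp: order_polytope_def\<close>)
qed

lemma bv_in_order_polytope_iff: "bv a \<in> order_polytope r \<longleftrightarrow> a \<in> sublattice_of_order r"
proof -
  have s: "birkhoff a \<subseteq> jirr" by (auto simp: birkhoff_def)
  have "bv a \<in> order_polytope r \<longleftrightarrow> (\<forall>p q. (q, p) \<in> r \<longrightarrow> p \<in> birkhoff a \<longrightarrow> q \<in> birkhoff a)"
  proof -
    have "p \<notin> jirr \<Longrightarrow> p \<notin> birkhoff a" for p using s by blast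
    then show ?thesis by (simp add: order_polytope_def bv_nth)
  qed
  also have "\<dots> \<longleftrightarrow> a \<in> sublattice_of_order r"
    unfolding sublattice_of_order_def order_ideals_def vimage_def mem_Collect_eq using s by blast
  finally show ?thesis .
qed

text \<open>Coordinates decrease along the order, so for a point of an order polytope and
  \<open>0 < t\<close> these superlevel sets are order ideals.\<close>

definition level :: "(real, 'a::{finite,lattice}) vec \<Rightarrow> real \<Rightarrow> 'a set" where
  "level x t = {p\<in>jirr. t \<le> x $ p}"

lemma level_subset: "level x t \<subseteq> jirr"
  by (simp add: level_def)

text \<open>The ideal condition only compares coordinates, so it passes from \<open>x\<close> to its
  superlevel sets. This is how a lattice element is recovered from a point that is merely near to
  it.\<close>

lemma level_in_order_polytope:
  assumes "x \<in> order_polytope r" "birkhoff a = level x t" "0 < t" "t \<le> 1"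
  shows "bv a \<in> order_polytope r"
proof -
  have "q \<in> level x t" if "p \<in> level x t" "(q, p) \<in> r" for p q
  proof -
    have "t \<le> x $ q" using that assms(1) unfolding level_def order_polytope_def by (blast intro: order_trans)
    \<comment> \<open>A positive threshold excludes indices outside
      \<open>join_irreducibles\<close>, where the coordinates vanish.\<close>
    moreover from this have "q \<in> jirr" using assms(1,3) unfolding order_polytope_def by force
    ultimately show ?thesis by (simp add: level_def)
  qed
  then have "birkhoff a \<in> order_ideals r"
    unfolding assms(2) order_ideals_def mem_Collect_eq using level_subset by blast
  then show ?thesis by (simp add: bv_in_order_polytope_iff sublattice_of_order_def)
qed

lemma exists_level:
  fixes x :: "(real, 'a::{finite,distrib_lattice}) vec"
  assumes "x \<in> order_polytope jirr_order"
  obtains a where "birkhoff a = level x t"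
proof (rule birkhoff_surj[of "level x t"])
  show "level x t \<subseteq> jirr" by (auto simp: level_def)
  fix p q assume "q \<in> level x t" "p \<in> jirr" "p \<le> q"
  moreover from this have "(p, q) \<in> jirr_order" by (auto simp: jirr_order_def level_def)
  ultimately show "p \<in> level x t" using assms by (force simp: level_def order_polytope_def)
qed (rule that)

text \<open>Induction on the number of fractional coordinates: with \<open>s\<close> the largest value below \<open>1\<close>, the point \<open>x\<close>
  is a convex combination of the indicator of \<open>x = 1\<close> and of \<open>min x s / s\<close>, whose levels are levels of \<open>x\<close>.\<close>

lemma order_polytope_levels_hull:
  fixes x :: "(real, 'a::{finite,distrib_lattice}) vec"
  assumes "x \<in> order_polytope jirr_order"
  shows "x \<in> convex hull (bv ` {a. \<exists>t. 0 < t \<and> t \<le> 1 \<and> birkhoff a = level x t})"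
  using assms
proof (induction "card {p\<in>jirr. 0 < x $ p \<and> x $ p < 1}" arbitrary: x rule: less_induct)
  case (less x)
  let ?L = "\<lambda>x. {a. \<exists>t. 0 < t \<and> t \<le> 1 \<and> birkhoff a = level x t}"
  have x0: "\<And>p. p \<notin> jirr \<Longrightarrow> x $ p = 0" "\<And>p. p \<in> jirr \<Longrightarrow> 0 \<le> x $ p" "\<And>p. p \<in> jirr \<Longrightarrow> x $ p \<le> 1"
    "\<And>p q. (q, p) \<in> jirr_order \<Longrightarrow> x $ p \<le> x $ q"
    using less.prems by (auto simp: order_polytope_def)
  obtain a where a: "birkhoff a = level x 1" using exists_level[OF less.prems] by blast
  then have aL: "bv a \<in> convex hull (bv ` ?L x)" by (intro hull_inc imageI CollectI exI[of _ 1]) simp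
  define N where "N = {p\<in>jirr. 0 < x $ p \<and> x $ p < 1}"
  show ?case
  proof (cases "N = {}")
    case True
    have "x = bv a"
    proof (rule vec_eq_iff[THEN iffD2], rule allI)
      fix p
      show "x $ p = bv a $ p"
        using True x0(1)[of p] x0(2)[of p] x0(3)[of p] unfolding N_def bv_nth a level_def
        by (cases "p \<in> jirr") force+
    qed
    then show ?thesis using aL by simp
  next
    case False
    define s where "s = Max ((\<lambda>p. x $ p) ` N)"
    have "s \<in> (\<lambda>p. x $ p) ` N" unfolding s_def using False by (intro Max_in) auto
    then obtain q where q: "q \<in> N" "s = x $ q" by auto
    have s: "0 < s" "s < 1" using q by (auto simp: N_def)
    have smax: "x $ p \<le> s \<or> x $ p = 1" if "p \<in> jirr" for p
    proof (cases "p \<in> N")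
      case True
      then show ?thesis unfolding s_def by (simp add: Max_ge)
    next
      case False
      then show ?thesis using x0(2,3)[OF that] s that unfolding N_def by force
    qed
    define y :: "(real, 'a) vec" where "y = (\<chi> p. min (x $ p) s / s)"
    have y_le: "t \<le> y $ p \<longleftrightarrow> t * s \<le> x $ p" if "t \<le> 1" for p t
      using s that by (simp add: y_def pos_le_divide_eq mult_left_le_one_le mult_le_cancel_right1)
    have yO: "y \<in> order_polytope jirr_order"
      using x0 s unfolding order_polytope_def y_def
      by (auto simp: divide_right_mono min_le_iff_disj intro!: divide_right_mono min.mono)
    have lev: "level y t = level x (t * s)" if "t \<le> 1" for t
      using y_le[OF that] by (simp add: level_def)
    have sub: "?L y \<subseteq> ?L x"
    proof clarify
      fix b and t :: real assume t: "0 < t" "t \<le> 1" "birkhoff b = level y t"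
      then show "\<exists>t'>0. t' \<le> 1 \<and> birkhoff b = level x t'"
        using s lev[of t] by (intro exI[of _ "t * s"]) (auto intro: mult_le_one)
    qed
    have "{p\<in>jirr. 0 < y $ p \<and> y $ p < 1} \<subset> N"
    proof
      show "{p\<in>jirr. 0 < y $ p \<and> y $ p < 1} \<subseteq> N"
      proof clarify
        fix p assume p: "p \<in> jirr" "0 < y $ p" "y $ p < 1"
        then have "0 < min (x $ p) s" "min (x $ p) s < s" using s by (simp_all add: y_def zero_less_divide_iff)
        then show "p \<in> N" using p s smax by (auto simp: N_def)
      qed
      have "y $ q = 1" using s q by (simp add: y_def)
      then show "{p\<in>jirr. 0 < y $ p \<and> y $ p < 1} \<noteq> N" using q by auto
    qed
    then have "card {p\<in>jirr. 0 < y $ p \<and> y $ p < 1} < card N"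
      by (intro psubset_card_mono) auto
    then have "y \<in> convex hull (bv ` ?L y)" using less.hyps[of y] yO unfolding N_def by blast
    then have yx: "y \<in> convex hull (bv ` ?L x)"
      by (rule subsetD[OF hull_mono[OF image_mono[OF sub]], rotated])
    have "x = (1 - s) *\<^sub>R bv a + s *\<^sub>R y"
    proof (rule vec_eq_iff[THEN iffD2], rule allI)
      fix p
      show "x $ p = ((1 - s) *\<^sub>R bv a + s *\<^sub>R y) $ p"
      proof (cases "p \<in> jirr")
        case True
        from smax[OF True] show ?thesis
        proof
          assume "x $ p \<le> s"
          then show ?thesis using s True by (simp add: y_def bv_nth a level_def)
        qed (use s True in \<open>simp add: y_def bv_nth a level_def\<close>)
      qed (use s x0(1) in \<open>simp add: y_def bv_nth a level_def\<close>)
    qed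
    also have "\<dots> \<in> convex hull (bv ` ?L x)"
      using convexD[OF convex_convex_hull aL yx, of "1 - s" s] s by simp
    finally show ?thesis .
  qed
qed

lemma order_polytope_eq_hull:
  fixes r :: "'a::{finite,distrib_lattice} rel"
  assumes "jirr_order \<subseteq> r"
  shows "order_polytope r = convex hull (bv ` sublattice_of_order r)"
proof
  show "convex hull (bv ` sublattice_of_order r) \<subseteq> order_polytope r"
    by (rule hull_minimal) (auto simp: bv_in_order_polytope_iff convex_order_polytope)
  show "order_polytope r \<subseteq> convex hull (bv ` sublattice_of_order r)"
  proof
    fix x assume x: "x \<in> order_polytope r"
    then have x': "x \<in> order_polytope jirr_order" using assms by (auto simp: order_polytope_def)
    have "{a. \<exists>t. 0 < t \<and> t \<le> 1 \<and> birkhoff a = level x t} \<subseteq> sublattice_of_order r"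
      using level_in_order_polytope[OF x] bv_in_order_polytope_iff by blast
    from subsetD[OF hull_mono[OF image_mono[OF this]] order_polytope_levels_hull[OF x']]
    show "x \<in> convex hull (bv ` sublattice_of_order r)" .
  qed
qed

lemma sublattice_of_jirr_order: "sublattice_of_order jirr_order = UNIV"
  by (auto simp: sublattice_of_order_def order_ideals_def birkhoff_def jirr_order_def)

lemma order_polytope_jirr_order: "order_polytope jirr_order = convex hull (range (bv :: 'a::{finite,distrib_lattice} \<Rightarrow> _))"
  using order_polytope_eq_hull[of jirr_order] by (simp add: sublattice_of_jirr_order)

lemma bv_extreme:
  "bv (a :: 'a::{finite,distrib_lattice}) extreme_point_of order_polytope jirr_order"
  unfolding extreme_point_of_def
proof (intro conjI ballI notI)
  show "bv a \<in> order_polytope jirr_order"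
    by (simp add: bv_in_order_polytope_iff sublattice_of_jirr_order)
  fix x y :: "(real, 'a) vec" assume xy: "x \<in> order_polytope jirr_order" "y \<in> order_polytope jirr_order"
  assume "bv a \<in> open_segment x y"
  then obtain u where u: "x \<noteq> y" "0 < u" "u < 1" "bv a = (1 - u) *\<^sub>R x + u *\<^sub>R y"
    by (auto simp: in_segment)
  have "x $ p = y $ p" for p
  proof (cases "p \<in> jirr")
    case True
    have b: "0 \<le> x $ p" "x $ p \<le> 1" "0 \<le> y $ p" "y $ p \<le> 1" using True xy by (auto simp: order_polytope_def)
    have e: "of_bool (p \<in> birkhoff a) = (1 - u) * x $ p + u * y $ p"
      using arg_cong[OF u(4), of "\<lambda>z. z $ p"] by (simp add: bv_nth)
    show ?thesis
    proof (cases "p \<in> birkhoff a")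
      case True
      have "(1 - u) * (1 - x $ p) + u * (1 - y $ p) = 0" using e True by (simp add: algebra_simps)
      then have "(1 - u) * (1 - x $ p) = 0 \<and> u * (1 - y $ p) = 0"
        using b u by (simp add: add_nonneg_eq_0_iff)
      then show ?thesis using u by simp
    next
      case False
      then have "(1 - u) * x $ p = 0 \<and> u * y $ p = 0"
        using e b u by (simp add: add_nonneg_eq_0_iff)
      then show ?thesis using u by simp
    qed
  qed (use xy in \<open>auto simp: order_polytope_def\<close>)
  then have "x = y" by (simp add: vec_eq_iff)
  with u show False by simp
qed

lemma extreme_points_order_polytope:
  "{v. v extreme_point_of order_polytope jirr_order} = range (bv :: 'a::{finite,distrib_lattice} \<Rightarrow> _)"
proof
  show "{v. v extreme_point_of order_polytope jirr_order} \<subseteq> range (bv :: 'a \<Rightarrow> _)"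
    using extreme_point_of_convex_hull unfolding order_polytope_jirr_order by blast
qed (auto intro: bv_extreme)

text \<open>Extremality in the large polytope descends to the smaller hull, whose extreme points are
  among its generators. A cell can therefore be read off its polytope.\<close>

lemma bv_in_hull_iff: "bv a \<in> convex hull (bv ` M) \<longleftrightarrow> a \<in> (M :: 'a::{finite,distrib_lattice} set)"
proof
  assume h: "bv a \<in> convex hull (bv ` M)"
  have sub: "convex hull (bv ` M) \<subseteq> order_polytope jirr_order"
    unfolding order_polytope_jirr_order by (intro hull_mono) auto
  then have "bv a extreme_point_of (convex hull (bv ` M))"
    using bv_extreme[of a] h unfolding extreme_point_of_def by blast
  then have "bv a \<in> bv ` M" by (rule extreme_point_of_convex_hull)
  then show "a \<in> M" by auto
qed (auto intro: hull_inc)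

section \<open>Cells and supermodular functions\<close>

text \<open>The pullback of \<open>upper_cell\<close> along \<open>birkhoff_vertex\<close>: cells
  become sets of lattice elements, so that sublattices can be compared with them directly.\<close>

definition cell :: "(real, 'a::{finite,distrib_lattice}) vec \<Rightarrow> 'a set \<Rightarrow> bool" where
  "cell w M \<longleftrightarrow> (\<exists>\<alpha> \<beta>. (\<forall>a. w $ a \<le> \<alpha> \<bullet> bv a + \<beta>) \<and> M = {a. \<alpha> \<bullet> bv a + \<beta> = w $ a} \<and>
     range bv \<subseteq> affine hull (bv ` M))"

lemma upper_cell_iff: "upper_cell (range bv) (psi w) T \<longleftrightarrow> (\<exists>M. cell w M \<and> T = bv ` M)"
proof -
  have eq: "tight_set (range bv) (psi w) \<alpha> \<beta> = bv ` {a. \<alpha> \<bullet> bv a + \<beta> = w $ a}" for \<alpha> \<beta>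
    by (auto simp: tight_set_def)
  show ?thesis unfolding upper_cell_def cell_def eq by auto
qed

interpretation bvs: height_function "range bv :: (real, 'a::{finite,distrib_lattice}) vec set" c for c
  by unfold_locales auto

lemma regular_subdivision_cells:
  "regular_subdivision (order_polytope jirr_order) (psi w) = {convex hull (bv ` M) | M. cell w M}"
  unfolding bvs.regular_subdivision_eq[OF extreme_points_order_polytope[symmetric]] upper_cell_iff by auto

text \<open>Only the heights at the vertices enter, so every regular subdivision of the polytope
  comes from a weight on the lattice.\<close>

lemma regular_subdivision_psi:
  "regular_subdivision (order_polytope (jirr_order :: 'a::{finite,distrib_lattice} rel)) c
     = regular_subdivision (order_polytope jirr_order) (psi (\<chi> a. c (bv a)))"
proof -
  have "(\<Union>v\<in>range (bv :: 'a \<Rightarrow> _). {v} \<times> {x. x \<le> c v}) = (\<Union>v\<in>range bv. {v} \<times> {x. x \<le> psi (\<chi> a. c (bv a)) v})"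
    by auto
  then show ?thesis unfolding regular_subdivision_def Let_def extreme_points_order_polytope by simp
qed

lemma cell_cover:
  assumes "x \<in> rel_interior (order_polytope jirr_order)"
  obtains M where "cell w M" "x \<in> convex hull (bv ` M)"
  using bvs.upper_cell_cover[of x "psi w"] assms unfolding order_polytope_jirr_order upper_cell_iff by blast

lemma cell_hull_inj: "convex hull (bv ` M) = convex hull (bv ` N) \<longleftrightarrow> M = (N :: 'a::{finite,distrib_lattice} set)"
  using bv_in_hull_iff by blast

section \<open>Supermodular weights and full-dimensional sublattices\<close>

definition supermodular :: "(real, 'a::{finite,distrib_lattice}) vec \<Rightarrow> bool" where
  "supermodular w \<longleftrightarrow> (\<forall>a b. w $ a + w $ b \<le> w $ sup a b + w $ inf a b)"

definition modular_pair :: "(real, 'a::{finite,distrib_lattice}) vec \<Rightarrow> 'a \<Rightarrow> 'a \<Rightarrow> bool" where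
  "modular_pair w a b \<longleftrightarrow> w $ a + w $ b = w $ sup a b + w $ inf a b"

definition sublattice :: "'a::lattice set \<Rightarrow> bool" where
  "sublattice M \<longleftrightarrow> (\<forall>a\<in>M. \<forall>b\<in>M. sup a b \<in> M \<and> inf a b \<in> M)"

lemma sublattice_UNIV: "sublattice UNIV" by (simp add: sublattice_def)

text \<open>With l the affine function of the cell, l - w is nonnegative and, at a modular pair, has
  the same sum over \<open>a\<close>, \<open>b\<close> as over \<open>sup a b\<close>,
  \<open>inf a b\<close>; one sum vanishes iff the other does.\<close>

lemma cell_modular_iff:
  assumes "cell w M" "modular_pair w a b"
  shows "a \<in> M \<and> b \<in> M \<longleftrightarrow> sup a b \<in> M \<and> inf a b \<in> M"
proof -
  obtain \<alpha> \<beta> where ab: "\<And>a. w $ a \<le> \<alpha> \<bullet> bv a + \<beta>" "\<And>a. a \<in> M \<longleftrightarrow> \<alpha> \<bullet> bv a + \<beta> = w $ a"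
      "range bv \<subseteq> affine hull (bv ` M)"
    using assms(1) unfolding cell_def by blast
  show ?thesis
    using ab(1)[of a] ab(1)[of b] ab(1)[of "sup a b"] ab(1)[of "inf a b"] assms(2) affine_bv_modular[of \<alpha> a \<beta> b]
    unfolding ab(2) modular_pair_def by linarith
qed

text \<open>The affine function is modular and dominates \<open>w\<close> at \<open>sup a b\<close>
  and \<open>inf a b\<close>, which gives the inequality opposite to supermodularity.\<close>

lemma cell_modular_pair:
  assumes "cell w M" "supermodular w" "a \<in> M" "b \<in> M"
  shows "modular_pair w a b"
proof -
  obtain \<alpha> \<beta> where ab: "\<And>a. w $ a \<le> \<alpha> \<bullet> bv a + \<beta>" "\<And>a. a \<in> M \<longleftrightarrow> \<alpha> \<bullet> bv a + \<beta> = w $ a"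
      "range bv \<subseteq> affine hull (bv ` M)"
    using assms(1) unfolding cell_def by blast
  have "w $ a + w $ b \<le> w $ sup a b + w $ inf a b" using assms(2) by (simp add: supermodular_def)
  then show ?thesis
    using ab(1)[of "sup a b"] ab(1)[of "inf a b"] assms(3,4) affine_bv_modular[of \<alpha> a \<beta> b]
    unfolding ab(2) modular_pair_def by linarith
qed

lemma cell_sublattice:
  assumes "cell w M" "supermodular w"
  shows "sublattice M"
  using cell_modular_iff[OF assms(1)] cell_modular_pair[OF assms] unfolding sublattice_def by blast

text \<open>The largest relation on the join-irreducibles for which every \<open>birkhoff a\<close>
  with \<open>a\<close> in \<open>M\<close> is an ideal. Antisymmetry requires that \<open>M\<close>
  separates the join-irreducibles.\<close>

definition order_of :: "'a::lattice set \<Rightarrow> 'a rel" where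
  "order_of M = {(p, q). p \<in> jirr \<and> q \<in> jirr \<and> (\<forall>a\<in>M. q \<le> a \<longrightarrow> p \<le> a)}"

lemma jirr_order_subset_order_of: "jirr_order \<subseteq> order_of M"
  by (auto simp: jirr_order_def order_of_def)

locale separating_sublattice =
  fixes M :: "'a::{finite,distrib_lattice} set"
  assumes sublattice: "sublattice M"
    and full: "range bv \<subseteq> affine hull (bv ` M)"
begin

text \<open>The affine-hull condition acts through this rule: a coordinate, or a difference of two,
  that is constant on \<open>M\<close> would be constant on the whole lattice.\<close>

lemma affine_fun_zero:
  assumes "\<And>a. a \<in> M \<Longrightarrow> \<alpha> \<bullet> bv a + \<beta> = 0"
  shows "\<alpha> \<bullet> bv a + \<beta> = 0"
  by (rule affine_fun_zero_on_hull[of "bv ` M"]) (use assms full in auto)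

lemma exists_above: 
  assumes "p \<in> jirr" shows "\<exists>a\<in>M. p \<le> a"
proof (rule ccontr)
  assume h: "\<not> ?thesis"
  have "axis p 1 \<bullet> bv p + 0 = 0"
    by (rule affine_fun_zero) (use h in \<open>simp add: axis_inner_bv\<close>)
  then show False using assms by (simp add: axis_inner_bv)
qed

lemma exists_not_above:
  assumes "p \<in> jirr" shows "\<exists>a\<in>M. \<not> p \<le> a"
proof (rule ccontr)
  assume h: "\<not> ?thesis"
  obtain b where b: "b < p" using assms by (auto simp: join_irreducibles_def)
  have "axis p 1 \<bullet> bv b + (- 1) = 0"
    by (rule affine_fun_zero) (use h assms in \<open>simp add: axis_inner_bv\<close>)
  moreover have "\<not> p \<le> b" using b by (simp add: leD)
  ultimately show False by (simp add: axis_inner_bv)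
qed

lemma exists_separating:
  assumes "p \<in> jirr" "q \<in> jirr" "p \<noteq> q"
  shows "\<exists>a\<in>M. (p \<le> a) \<noteq> (q \<le> a)"
proof (rule ccontr)
  assume h: "\<not> ?thesis"
  have "(axis p 1 - axis q 1) \<bullet> bv a + 0 = 0" for a
    by (rule affine_fun_zero) (use h assms in \<open>simp add: inner_diff_left axis_inner_bv\<close>)
  then have "of_bool (p \<le> a) = (of_bool (q \<le> a) :: real)" for a
    using assms by (simp add: inner_diff_left axis_inner_bv)
  then have "(p \<le> a) = (q \<le> a)" for a by (metis of_bool_eq_iff)
  then show False using assms by (metis antisym order_refl)
qed

lemma partial_order: "partial_order_on jirr (order_of M)"
  unfolding partial_order_on_def preorder_on_def
proof (intro conjI)
  show "refl_on jirr (order_of M)" by (auto simp: refl_on_def order_of_def)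
  show "trans (order_of M)" by (auto simp: trans_def order_of_def)
  show "antisym (order_of M)"
  proof (rule antisymI)
    fix p q assume "(p, q) \<in> order_of M" "(q, p) \<in> order_of M"
    then have "p \<in> jirr" "q \<in> jirr" "\<forall>a\<in>M. (p \<le> a) = (q \<le> a)" unfolding order_of_def by blast+
    then show "p = q" using exists_separating by blast
  qed
qed (auto simp: order_of_def)

lemma finite_inf_in:
  assumes "finite S" "S \<noteq> {}" "S \<subseteq> M"
  shows "Inf_fin S \<in> M"
  using assms
proof (induction S rule: finite_ne_induct)
  case (insert x F)
  then show ?case using sublattice by (simp add: sublattice_def)
qed simp

text \<open>The witness is the meet of all elements of \<open>M\<close> above
  \<open>q\<close>.\<close>

lemma exists_least_above:
  assumes "q \<in> jirr"
  obtains m where "m \<in> M" "birkhoff m = {p. (p, q) \<in> order_of M}"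
proof -
  let ?S = "{a\<in>M. q \<le> a}"
  have ne: "?S \<noteq> {}" using exists_above[OF assms] by auto
  have m: "Inf_fin ?S \<in> M" by (rule finite_inf_in) (use ne in auto)
  have le: "Inf_fin ?S \<le> a" if "a \<in> ?S" for a
    by (rule Inf_fin.coboundedI) (use that in auto)
  have ge: "x \<le> Inf_fin ?S" if "\<And>a. a \<in> ?S \<Longrightarrow> x \<le> a" for x
    by (rule Inf_fin.boundedI) (use that ne in auto)
  have "birkhoff (Inf_fin ?S) = {p. (p, q) \<in> order_of M}"
    using assms le by (auto simp: birkhoff_def order_of_def intro: order_trans intro!: ge)
  then show thesis using m that by blast
qed

lemma exists_bottom: obtains z where "z \<in> M" "birkhoff z = {}"
proof -
  have "M \<noteq> {}" using full by auto
  then have m: "Inf_fin M \<in> M" by (intro finite_inf_in) auto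
  have le: "Inf_fin M \<le> a" if "a \<in> M" for a
    by (rule Inf_fin.coboundedI) (use that in auto)
  have "birkhoff (Inf_fin M) = {}"
    using exists_not_above le unfolding birkhoff_def by (blast intro: order_trans)
  then show thesis using m that by blast
qed

text \<open>An ideal of \<open>order_of M\<close> is the union of the principal ideals of its
  elements; \<open>M\<close> contains these and is closed under joins, and its bottom provides the
  empty ideal.\<close>

lemma sublattice_of_order_of: "sublattice_of_order (order_of M) = M"
proof
  show "M \<subseteq> sublattice_of_order (order_of M)"
    by (auto simp: sublattice_of_order_def order_ideals_def order_of_def birkhoff_def)
  show "sublattice_of_order (order_of M) \<subseteq> M"
  proof
    fix a assume "a \<in> sublattice_of_order (order_of M)"
    then have ideal: "\<And>p q. q \<in> birkhoff a \<Longrightarrow> (p, q) \<in> order_of M \<Longrightarrow> p \<in> birkhoff a"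
      by (auto simp: sublattice_of_order_def order_ideals_def)
    have "\<exists>m\<in>M. birkhoff m = (\<Union>q\<in>S. {p. (p, q) \<in> order_of M})" if "S \<subseteq> jirr" for S
      using finite[of S] that
    proof (induction S rule: finite_induct)
      case empty
      then show ?case using exists_bottom by auto
    next
      case (insert q S)
      then obtain m where m: "m \<in> M" "birkhoff m = (\<Union>q\<in>S. {p. (p, q) \<in> order_of M})" by auto
      obtain n where n: "n \<in> M" "birkhoff n = {p. (p, q) \<in> order_of M}"
        using exists_least_above[of q] insert by auto
      show ?case
        by (rule bexI[of _ "sup n m"]) (use m n sublattice in \<open>auto simp: birkhoff_sup sublattice_def\<close>)
    qed
    moreover have sub: "birkhoff a \<subseteq> jirr" by (auto simp: birkhoff_def)
    ultimately obtain m where m: "m \<in> M" "birkhoff m = (\<Union>q\<in>birkhoff a. {p. (p, q) \<in> order_of M})" by blast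
    have "birkhoff a \<subseteq> birkhoff m" unfolding m(2) using sub by (auto simp: order_of_def)
    moreover have "birkhoff m \<subseteq> birkhoff a" unfolding m(2) using ideal by blast
    ultimately have "birkhoff m = birkhoff a" by (rule antisym[rotated])
    then show "a \<in> M" using m by simp
  qed
qed

lemma order_polytope_order_of: "order_polytope (order_of M) = convex hull (bv ` M)"
  by (simp add: order_polytope_eq_hull[OF jirr_order_subset_order_of] sublattice_of_order_of)

end

section \<open>Chains lie in cells\<close>

lemma cell_separating:
  assumes "cell w M" "supermodular w"
  shows "separating_sublattice M"
  using cell_sublattice[OF assms] assms(1) by (auto simp: separating_sublattice_def cell_def)

text \<open>The level sets of the barycenter of a chain are the ideals of the chain, and they persist under a small
  perturbation into the relative interior.\<close>

lemma chain_in_order_cell: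
  assumes cells: "\<And>M. cell w M \<Longrightarrow> \<exists>r. convex hull (bv ` M) = order_polytope r"
    and chain: "\<And>a b. a \<in> C \<Longrightarrow> b \<in> C \<Longrightarrow> a \<le> b \<or> b \<le> a"
  obtains M where "cell w M" "C \<subseteq> M"
proof (cases "C = {}")
  case True
  have "rel_interior (order_polytope (jirr_order :: 'a rel)) \<noteq> {}"
    by (subst rel_interior_eq_empty) (auto simp: convex_order_polytope order_polytope_jirr_order)
  then obtain x where "x \<in> rel_interior (order_polytope (jirr_order :: 'a rel))" by auto
  then obtain M where "cell w M" by (rule cell_cover)
  then show thesis using True that by auto
next
  case False
  let ?O = "order_polytope (jirr_order :: 'a rel)"
  have "rel_interior ?O \<noteq> {}"
    by (subst rel_interior_eq_empty) (auto simp: convex_order_polytope order_polytope_jirr_order)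
  then obtain z where z: "z \<in> rel_interior ?O" by auto
  then have zO: "z \<in> ?O" using rel_interior_subset by blast
  define n where "n = card C"
  have n0: "n > 0" unfolding n_def using False by (simp add: card_gt_0_iff)
  define x0 where "x0 = (\<Sum>c\<in>C. (1 / real n) *\<^sub>R bv c)"
  have x0_nth: "x0 $ p = real (card {c\<in>C. p \<le> c}) / real n" if "p \<in> jirr" for p
  proof -
    have "x0 $ p = (\<Sum>c\<in>C. of_bool (p \<le> c)) / real n"
      using that by (simp add: x0_def bv_nth birkhoff_def flip: sum_divide_distrib)
    also have "(\<Sum>c\<in>C. of_bool (p \<le> c)) = real (card {c\<in>C. p \<le> c})"
      by (simp add: of_bool_def sum.If_cases Int_def)
    finally show ?thesis .
  qed
  have x0O: "x0 \<in> ?O" unfolding x0_def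
    by (rule convex_sum) (use n0 in \<open>auto simp: convex_order_polytope n_def bv_in_order_polytope_iff sublattice_of_jirr_order\<close>)
  \<comment> \<open>The coordinates of \<open>x0\<close> are multiples of \<open>1 / n\<close>; a
    shift by at most a quarter of this spacing cannot cross a threshold midway between two of
    them.\<close>
  define e where "e = 1 / (4 * real n)"
  have e: "0 < e" "e \<le> 1" using n0 by (auto simp: e_def)
  define x where "x = x0 - e *\<^sub>R (x0 - z)"
  have "x \<in> rel_interior ?O" unfolding x_def
    by (rule rel_interior_convex_shrink[OF convex_order_polytope z x0O e])
  then obtain M where M: "cell w M" "x \<in> convex hull (bv ` M)" by (rule cell_cover)
  obtain r where r: "convex hull (bv ` M) = order_polytope r" using cells[OF M(1)] by blast
  have close: "\<bar>x $ p - x0 $ p\<bar> \<le> e" if "p \<in> jirr" for p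
  proof -
    have "0 \<le> x0 $ p" "x0 $ p \<le> 1" "0 \<le> z $ p" "z $ p \<le> 1" using x0O zO that by (auto simp: order_polytope_def)
    then have "\<bar>x0 $ p - z $ p\<bar> \<le> 1" by linarith
    then have "e * \<bar>x0 $ p - z $ p\<bar> \<le> e * 1" using e by (intro mult_left_mono) auto
    then show ?thesis using e by (simp add: x_def abs_mult)
  qed
  have "C \<subseteq> M"
  proof
    fix c assume c: "c \<in> C"
    define k where "k = card {c'\<in>C. c \<le> c'}"
    have k: "1 \<le> k" "k \<le> n" unfolding k_def n_def using c
      by (auto simp: Suc_le_eq card_gt_0_iff intro: card_mono)
    \<comment> \<open>Midway between \<open>(k - 1) / n\<close> and \<open>k / n\<close>: at
      \<open>x0\<close>, a join-irreducible below \<open>c\<close> has coordinate at least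
      \<open>k / n\<close>, any other at most \<open>(k - 1) / n\<close>.\<close>
    define t where "t = (real k - 1 / 2) / real n"
    have t: "0 < t" "t \<le> 1" using k n0 by (auto simp: t_def)
    have up: "t + e \<le> real k / real n" using n0 by (simp add: t_def e_def field_simps)
    have down: "(real k - 1) / real n + e < t" using n0 by (simp add: t_def e_def field_simps)
    have "p \<le> c \<longleftrightarrow> t \<le> x $ p" if p: "p \<in> jirr" for p
    proof (cases "p \<le> c")
      case True
      then have "{c'\<in>C. c \<le> c'} \<subseteq> {c'\<in>C. p \<le> c'}" by (auto intro: order_trans)
      then have "k \<le> card {c'\<in>C. p \<le> c'}" unfolding k_def by (intro card_mono) auto
      then have "real k / real n \<le> x0 $ p" unfolding x0_nth[OF p] by (simp add: divide_right_mono)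
      then show ?thesis using True close[OF p] up by linarith
    next
      case False
      then have "{c'\<in>C. p \<le> c'} \<subset> {c'\<in>C. c \<le> c'}"
        using chain[OF c] c by (auto intro: order_trans)
      then have "card {c'\<in>C. p \<le> c'} < k" unfolding k_def by (intro psubset_card_mono) auto
      then have "real (card {c'\<in>C. p \<le> c'}) \<le> real k - 1" using k by linarith
      then have "x0 $ p \<le> (real k - 1) / real n" unfolding x0_nth[OF p] by (simp add: divide_right_mono)
      then show ?thesis using False close[OF p] down by linarith
    qed
    then have "birkhoff c = level x t" by (auto simp: birkhoff_def level_def)
    then have "bv c \<in> order_polytope r" using level_in_order_polytope t M(2) r by blast
    then show "c \<in> M" using bv_in_hull_iff r by blast
  qed
  with M(1) show thesis by (rule that)
qed

lemma supermodular_cell_order: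
  assumes "supermodular w" "cell w M"
  shows "\<exists>r. convex hull (bv ` M) = order_polytope r"
  using separating_sublattice.order_polytope_order_of[OF cell_separating[OF assms(2,1)]] by metis

lemma chain_in_cell:
  assumes "supermodular w" "\<And>a b. a \<in> C \<Longrightarrow> b \<in> C \<Longrightarrow> a \<le> b \<or> b \<le> a"
  obtains M where "cell w M" "C \<subseteq> M"
  using chain_in_order_cell[of w C] supermodular_cell_order[OF assms(1)] assms(2) by metis

text \<open>A cell containing \<open>sup a b\<close> and \<open>inf a b\<close> bounds \<open>w a + w b\<close> through its affine function.\<close>

lemma order_cells_imp_supermodular:
  assumes cells: "\<And>M. cell w M \<Longrightarrow> \<exists>r. convex hull (bv ` M) = order_polytope r"
  shows "supermodular w"
  unfolding supermodular_def
proof (intro allI)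
  fix a b
  obtain M where M: "cell w M" "{sup a b, inf a b} \<subseteq> M"
    using chain_in_order_cell[of w "{sup a b, inf a b}", OF cells] by (metis insertE inf_sup_ord(1) le_supI1 order_refl singletonD)
  obtain \<alpha> \<beta> where ab: "\<And>a. w $ a \<le> \<alpha> \<bullet> bv a + \<beta>" "\<And>a. a \<in> M \<longleftrightarrow> \<alpha> \<bullet> bv a + \<beta> = w $ a"
      "range bv \<subseteq> affine hull (bv ` M)"
    using M(1) unfolding cell_def by blast
  have "sup a b \<in> M" "inf a b \<in> M" using M(2) by auto
  then show "w $ a + w $ b \<le> w $ sup a b + w $ inf a b"
    using ab(1)[of a] ab(1)[of b] affine_bv_modular[of \<alpha> a \<beta> b] unfolding ab(2) by linarith
qed

text \<open>The two affine functions agree on \<open>M\<close>, which affinely spans all vertices,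
  so they coincide at every vertex and have the same tight set.\<close>

lemma cell_unique:
  assumes "cell w M" "cell w N" "M \<subseteq> N"
  shows "M = N"
proof -
  obtain \<alpha> \<beta> where "\<And>a. w $ a \<le> \<alpha> \<bullet> bv a + \<beta>"
      and ab: "\<And>a. a \<in> M \<longleftrightarrow> \<alpha> \<bullet> bv a + \<beta> = w $ a" "range bv \<subseteq> affine hull (bv ` M)"
    using assms(1) unfolding cell_def by blast
  obtain \<gamma> \<delta> where "\<And>a. w $ a \<le> \<gamma> \<bullet> bv a + \<delta>"
      and cd: "\<And>a. a \<in> N \<longleftrightarrow> \<gamma> \<bullet> bv a + \<delta> = w $ a" and "range bv \<subseteq> affine hull (bv ` N)"
    using assms(2) unfolding cell_def by blast
  have "(\<alpha> - \<gamma>) \<bullet> bv a + (\<beta> - \<delta>) = 0" for a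
  proof (rule affine_fun_zero_on_hull[of "bv ` M"])
    fix v assume "v \<in> bv ` M"
    then obtain a where a: "a \<in> M" "v = bv a" by auto
    then have "\<alpha> \<bullet> bv a + \<beta> = w $ a" "\<gamma> \<bullet> bv a + \<delta> = w $ a" using ab(1) cd assms(3) by blast+
    then show "(\<alpha> - \<gamma>) \<bullet> v + (\<beta> - \<delta>) = 0" using a by (simp add: inner_diff_left)
  qed (use ab(2) in auto)
  then have "\<alpha> \<bullet> bv a + \<beta> = \<gamma> \<bullet> bv a + \<delta>" for a by (simp add: inner_diff_left algebra_simps)
  then show ?thesis using ab(1) cd by auto
qed

section \<open>Straightening of monomials\<close>

type_synonym 'a monom = "'a \<Rightarrow>\<^sub>0 nat"

abbreviation lookup where "lookup \<equiv> Poly_Mapping.lookup"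
abbreviation keys where "keys \<equiv> Poly_Mapping.keys"
abbreviation single where "single \<equiv> Poly_Mapping.single"

text \<open>Additive extension of \<open>f\<close> from variables to monomials; weight, degree and
  the coordinates of the multidegree are instances.\<close>

definition msum :: "('a::finite \<Rightarrow> 'b::comm_semiring_1) \<Rightarrow> 'a monom \<Rightarrow> 'b" where
  "msum f m = (\<Sum>a\<in>UNIV. of_nat (lookup m a) * f a)"

lemma msum_add: "msum f (m + n) = msum f m + msum f n"
  by (simp add: msum_def lookup_add distrib_right sum.distrib)

lemma msum_single: "msum f (single a k) = of_nat k * f a"
proof -
  have "of_nat (lookup (single a k) b) * f b = (if b = a then of_nat k * f b else 0)" for b
    by (simp add: lookup_single when_def)
  then show ?thesis by (simp add: msum_def)
qed

lemma msum_zero [simp]: "msum f 0 = 0" by (simp add: msum_def)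

lemma monom_grading_msum: "monom_grading w = msum (($) w)"
  by (simp add: monom_grading_def msum_def fun_eq_iff)

lemma keys_add_nat: "keys (m + n :: 'a monom) = keys m \<union> keys n"
  by (auto simp: in_keys_iff lookup_add)

lemma single_le_split:
  fixes m :: "'a monom" assumes "a \<in> keys m"
  obtains k where "m = k + single a 1"
proof
  show "m = (m - single a 1) + single a 1"
    using assms by (intro poly_mapping_eqI) (auto simp: lookup_add lookup_minus lookup_single when_def in_keys_iff)
qed

text \<open>The standard monomials: those divisible by no product of two incomparable
  variables.\<close>

definition chain_monom :: "'a::order monom \<Rightarrow> bool" where
  "chain_monom m \<longleftrightarrow> (\<forall>a\<in>keys m. \<forall>b\<in>keys m. a \<le> b \<or> b \<le> a)"

text \<open>Confining the exchanged variables to \<open>M\<close> keeps every step valid on the Hibi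
  variety of \<open>M\<close> and, if all pairs in \<open>M\<close> are modular, weight-preserving;
  \<open>UNIV\<close> gives the unrestricted rewriting.\<close>

inductive straighten :: "'a::lattice set \<Rightarrow> 'a monom \<Rightarrow> 'a monom \<Rightarrow> bool" for M where
  "a \<in> M \<Longrightarrow> b \<in> M \<Longrightarrow> \<not> a \<le> b \<Longrightarrow> \<not> b \<le> a \<Longrightarrow>
    straighten M (k + single a 1 + single b 1) (k + single (sup a b) 1 + single (inf a b) 1)"

lemma straighten_keys:
  assumes "straighten M m n" "sublattice M" "keys m \<subseteq> M"
  shows "keys n \<subseteq> M"
  using assms by (cases rule: straighten.cases) (auto simp: keys_add_nat sublattice_def)

lemma msum_nat_mono: "(\<And>a. f a \<le> g a) \<Longrightarrow> msum f m \<le> (msum g m :: nat)"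
  by (simp add: msum_def sum_mono)

text \<open>The difference is twice the product of the sizes of the two set differences
  \<open>A\<close> and \<open>B\<close>. The squared size thus serves both as termination measure
  and as strictly supermodular weight.\<close>

lemma card_birkhoff_strict:
  fixes a b :: "'a::{finite,distrib_lattice}"
  assumes "\<not> a \<le> b" "\<not> b \<le> a"
  shows "(card (birkhoff a))\<^sup>2 + (card (birkhoff b))\<^sup>2 < (card (birkhoff (sup a b)))\<^sup>2 + (card (birkhoff (inf a b)))\<^sup>2"
proof -
  define A B where "A = birkhoff a - birkhoff b" and "B = birkhoff b - birkhoff a"
  define C where "C = birkhoff a \<inter> birkhoff b"
  have "A \<noteq> {}" "B \<noteq> {}"
    using assms birkhoff_subset_iff[of a b] birkhoff_subset_iff[of b a] unfolding A_def B_def by blast+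
  then have pos: "0 < card A" "0 < card B" by (simp_all add: card_gt_0_iff)
  have "birkhoff a = A \<union> C" "birkhoff b = B \<union> C" "birkhoff (sup a b) = A \<union> B \<union> C" "birkhoff (inf a b) = C"
    by (auto simp: A_def B_def C_def birkhoff_sup birkhoff_inf)
  moreover have "A \<inter> C = {}" "B \<inter> C = {}" "(A \<union> B) \<inter> C = {}" "A \<inter> B = {}" by (auto simp: A_def B_def C_def)
  ultimately have "card (birkhoff a) = card A + card C" "card (birkhoff b) = card B + card C"
    "card (birkhoff (sup a b)) = card A + card B + card C" "card (birkhoff (inf a b)) = card C"
    by (simp_all add: card_Un_disjoint)
  then show ?thesis using pos by (simp add: power2_eq_square algebra_simps)
qed

text \<open>Each step raises the sum of the squared ideal sizes and keeps the degree, while that sum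
  is at most the degree times the square of \<open>CARD('a)\<close>; the remaining gap
  decreases.\<close>

lemma straighten_exists:
  fixes M :: "'a::{finite,distrib_lattice} set"
  assumes "sublattice M" "keys m \<subseteq> M"
  shows "\<exists>n. (straighten M)\<^sup>*\<^sup>* m n \<and> chain_monom n \<and> keys n \<subseteq> M"
  using assms(2)
proof (induction "msum (\<lambda>a::'a. (CARD('a))\<^sup>2) m - msum (\<lambda>a. (card (birkhoff a))\<^sup>2) m" arbitrary: m rule: less_induct)
  case (less m)
  show ?case
  proof (cases "chain_monom m")
    case True
    then show ?thesis using less.prems by blast
  next
    case False
    then obtain a b where ab: "a \<in> keys m" "b \<in> keys m" "\<not> a \<le> b" "\<not> b \<le> a" by (auto simp: chain_monom_def)
    obtain k' where k': "m = k' + single a 1" using single_le_split[OF ab(1)] .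
    have "b \<in> keys k'" using ab by (auto simp: k' keys_add_nat split: if_splits)
    then obtain k where k: "k' = k + single b 1" by (rule single_le_split)
    define n where "n = k + single (sup a b) 1 + single (inf a b) 1"
    have m: "m = k + single a 1 + single b 1" by (simp add: k k' ac_simps)
    have st: "straighten M m n" unfolding m n_def using ab less.prems by (intro straighten.intros) auto
    then have nM: "keys n \<subseteq> M" using straighten_keys assms(1) less.prems by blast
    let ?c = "\<lambda>a::'a. (CARD('a))\<^sup>2" and ?f = "\<lambda>a::'a. (card (birkhoff a))\<^sup>2"
    have "msum ?c n = msum ?c m" by (simp add: m n_def msum_add msum_single)
    moreover have "msum ?f m < msum ?f n"
      using card_birkhoff_strict[OF ab(3,4)] by (simp add: m n_def msum_add msum_single)
    moreover have "msum ?f n \<le> msum ?c n"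
      by (rule msum_nat_mono) (simp add: power2_nat_le_eq_le card_mono)
    ultimately have "msum ?c n - msum ?f n < msum ?c m - msum ?f m" by linarith
    from less.hyps[OF this nM] st show ?thesis by (meson converse_rtranclp_into_rtranclp)
  qed
qed

text \<open>The exponent of the image of a monomial under \<open>X\<^sub>a \<mapsto> s \<Prod>\<^bsub>p \<le> a\<^esub> t\<^sub>p\<close>.\<close>

definition multidegree :: "'a::{finite,lattice} monom \<Rightarrow> nat \<times> ('a \<Rightarrow> nat)" where
  "multidegree m = (msum (\<lambda>_. 1) m, \<lambda>p. if p \<in> jirr then msum (\<lambda>a. of_bool (p \<le> a)) m else 0)"

lemma straighten_msum:
  assumes "straighten M m n" and "\<And>a b. a \<in> M \<Longrightarrow> b \<in> M \<Longrightarrow> f a + f b = f (sup a b) + f (inf a b)"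
  shows "msum f n = msum f m"
  using assms by (cases rule: straighten.cases) (simp add: msum_add msum_single add.assoc)

lemma straightens_msum:
  assumes "(straighten M)\<^sup>*\<^sup>* m n" and "\<And>a b. a \<in> M \<Longrightarrow> b \<in> M \<Longrightarrow> f a + f b = f (sup a b) + f (inf a b)"
  shows "msum f n = msum f m"
  using assms(1) by (induction rule: rtranclp_induct) (use straighten_msum assms(2) in metis)+

lemma of_bool_jirr_modular:
  fixes p :: "'a::distrib_lattice"
  assumes "p \<in> jirr"
  shows "of_bool (p \<le> a) + of_bool (p \<le> b) = (of_bool (p \<le> sup a b) + of_bool (p \<le> inf a b) :: nat)"
  using jirr_prime[OF assms, of a b] by (auto simp: le_supI1 le_supI2)

lemma straightens_multidegree:
  assumes "(straighten M)\<^sup>*\<^sup>* m (n :: 'a::{finite,distrib_lattice} monom)"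
  shows "multidegree n = multidegree m"
proof -
  have "msum (\<lambda>a. of_bool (p \<le> a) :: nat) n = msum (\<lambda>a. of_bool (p \<le> a)) m" if "p \<in> jirr" for p
    using assms by (rule straightens_msum) (rule of_bool_jirr_modular[OF that])
  moreover have "msum (\<lambda>_. 1 :: nat) n = msum (\<lambda>_. 1) m" using assms by (rule straightens_msum) simp
  ultimately show ?thesis unfolding multidegree_def by (intro prod_eqI ext) auto
qed

lemma multidegree_add:
  "multidegree (m + n) = (fst (multidegree m) + fst (multidegree n), \<lambda>p. snd (multidegree m) p + snd (multidegree n) p)"
  by (auto simp: multidegree_def msum_add)

lemma multidegree_cancel: "multidegree (m + k) = multidegree (n + k) \<longleftrightarrow> multidegree m = multidegree n"
  unfolding multidegree_add by (auto simp: prod_eq_iff fun_eq_iff)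

text \<open>The support of the multidegree is the ideal of the largest element of the chain, so the
  top variable can be read off.\<close>

lemma chain_monom_top:
  fixes m :: "'a::{finite,distrib_lattice} monom"
  assumes "chain_monom m" "m \<noteq> 0"
  obtains k a where "m = k + single a 1" "chain_monom k" "birkhoff a = {p\<in>jirr. 0 < snd (multidegree m) p}"
proof -
  have "keys m \<noteq> {}" using assms(2) by simp
  then obtain a where a: "a \<in> keys m" "\<And>b. b \<in> keys m \<Longrightarrow> \<not> a < b"
    using finite_has_maximal[of "keys m"] by (metis finite_keys order_less_le)
  have top: "b \<le> a" if "b \<in> keys m" for b
    using assms(1) a that unfolding chain_monom_def by (metis order_less_le)
  obtain k where k: "m = k + single a 1" using a(1) by (rule single_le_split)
  have "chain_monom k" using assms(1) by (auto simp: chain_monom_def k keys_add_nat)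
  moreover have "0 < snd (multidegree m) p \<longleftrightarrow> p \<le> a" if p: "p \<in> jirr" for p
  proof -
    have "0 < snd (multidegree m) p \<longleftrightarrow> (\<exists>b\<in>keys m. p \<le> b)"
    proof -
      have "snd (multidegree m) p = 0 \<longleftrightarrow> (\<forall>b. p \<le> b \<longrightarrow> lookup m b = 0)"
        using p by (auto simp: multidegree_def msum_def)
      then show ?thesis by (auto simp: in_keys_iff)
    qed
    also have "\<dots> \<longleftrightarrow> p \<le> a" using top a(1) by (blast intro: order_trans)
    finally show ?thesis .
  qed
  then have "birkhoff a = {p\<in>jirr. 0 < snd (multidegree m) p}" by (auto simp: birkhoff_def)
  ultimately show thesis using k that by blast
qed

text \<open>Induction on the degree, removing the top variable, which the multidegree
  determines.\<close>

lemma chain_monom_unique: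
  fixes m n :: "'a::{finite,distrib_lattice} monom"
  assumes "chain_monom m" "chain_monom n" "multidegree m = multidegree n"
  shows "m = n"
  using assms
proof (induction "fst (multidegree m)" arbitrary: m n)
  case 0
  have "m' = 0" if "fst (multidegree m') = 0" for m' :: "'a monom"
    using that by (intro poly_mapping_eqI) (auto simp: multidegree_def msum_def)
  then show ?case using 0 by metis
next
  case (Suc d)
  have nz: "m \<noteq> 0" "n \<noteq> 0" using Suc.hyps(2) Suc.prems(3) by (auto simp: multidegree_def)
  obtain k a where k: "m = k + single a 1" "chain_monom k" "birkhoff a = {p\<in>jirr. 0 < snd (multidegree m) p}"
    using chain_monom_top[OF Suc.prems(1) nz(1)] .
  obtain l b where l: "n = l + single b 1" "chain_monom l" "birkhoff b = {p\<in>jirr. 0 < snd (multidegree n) p}"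
    using chain_monom_top[OF Suc.prems(2) nz(2)] .
  have ab: "a = b" using k(3) l(3) Suc.prems(3) by (metis birkhoff_eq_iff)
  have "multidegree k = multidegree l" using Suc.prems(3) multidegree_cancel unfolding k(1) l(1) ab by blast
  moreover have "d = fst (multidegree k)" using Suc.hyps(2) unfolding k(1) multidegree_add by (simp add: multidegree_def msum_single)
  ultimately have "k = l" using Suc.hyps(1) k l by blast
  then show ?case using k l ab by simp
qed

lemma chain_form_ex1:
  "\<exists>n. chain_monom n \<and> multidegree n = multidegree m \<and> (straighten UNIV)\<^sup>*\<^sup>* m (n :: 'a::{finite,distrib_lattice} monom)"
  using straighten_exists[OF sublattice_UNIV, of m] straightens_multidegree by blast

text \<open>Defined through the multidegree and not through the rewriting, so that independence of
  the order of straightening steps is built in.\<close>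

definition chain_form :: "'a::{finite,distrib_lattice} monom \<Rightarrow> 'a monom" where
  "chain_form m = (THE n. chain_monom n \<and> multidegree n = multidegree m)"

lemma chain_form_eqI: "chain_monom n \<Longrightarrow> multidegree n = multidegree m \<Longrightarrow> chain_form m = n"
  unfolding chain_form_def by (rule the_equality) (auto intro: chain_monom_unique)

lemma chain_form:
  "chain_monom (chain_form m)" "multidegree (chain_form m) = multidegree m" "(straighten UNIV)\<^sup>*\<^sup>* m (chain_form m)"
  using chain_form_ex1[of m] chain_form_eqI by metis+

lemma chain_form_cong: "multidegree m = multidegree n \<Longrightarrow> chain_form m = chain_form n"
  by (simp add: chain_form_def)

text \<open>Rewriting inside \<open>M\<close> ends in a chain monomial of the same multidegree,
  hence in the chain form computed in the whole lattice.\<close>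

lemma straighten_chain_form:
  assumes "sublattice M" "keys m \<subseteq> M"
  shows "(straighten M)\<^sup>*\<^sup>* m (chain_form m)" "keys (chain_form m) \<subseteq> M"
  using straighten_exists[OF assms] straightens_multidegree chain_form_eqI by metis+

lemma modular_sublattice_in_cell:
  assumes w: "supermodular w" and N: "sublattice N" "\<And>a b. a \<in> N \<Longrightarrow> b \<in> N \<Longrightarrow> modular_pair w a b"
  obtains M where "cell w M" "N \<subseteq> M"
proof -
  \<comment> \<open>Each variable of \<open>N\<close> occurs once, so the vanishing of the
    nonnegative sum \<open>msum u m\<close> kills \<open>u\<close> at every element of
    \<open>N\<close>.\<close>
  define m where "m = (\<Sum>a\<in>N. single a (1::nat))"
  have lm: "lookup m a = of_bool (a \<in> N)" for a
    by (simp add: m_def lookup_sum lookup_single when_def of_bool_def)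
  have km: "keys m = N" by (auto simp: in_keys_iff lm)
  define n where "n = chain_form m"
  have n: "(straighten N)\<^sup>*\<^sup>* m n" "keys n \<subseteq> N" "chain_monom n"
    using straighten_chain_form[OF N(1), of m] chain_form km by (auto simp: n_def)
  obtain M where M: "cell w M" "keys n \<subseteq> M"
    using chain_in_cell[OF w, of "keys n"] n(3) unfolding chain_monom_def by blast
  obtain \<alpha> \<beta> where ab: "\<And>a. w $ a \<le> \<alpha> \<bullet> bv a + \<beta>" "\<And>a. a \<in> M \<longleftrightarrow> \<alpha> \<bullet> bv a + \<beta> = w $ a"
      "range bv \<subseteq> affine hull (bv ` M)"
    using M(1) unfolding cell_def by blast
  define u where "u = (\<lambda>a. (\<alpha> \<bullet> bv a + \<beta>) - w $ a)"
  have u0: "0 \<le> u a" for a using ab(1) by (simp add: u_def)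
  have "msum u n = msum u m"
  proof (rule straightens_msum[OF n(1)])
    fix a b assume "a \<in> N" "b \<in> N"
    then have "w $ a + w $ b = w $ sup a b + w $ inf a b" using N(2) by (simp add: modular_pair_def)
    then show "u a + u b = u (sup a b) + u (inf a b)"
      using affine_bv_modular[of \<alpha> a \<beta> b] unfolding u_def by linarith
  qed
  moreover have "msum u n = 0"
    unfolding msum_def
  proof (rule sum.neutral, rule ballI)
    fix a
    have "u a = 0" if "a \<in> keys n" using subsetD[OF M(2) that] ab(2)[of a] by (simp add: u_def)
    then show "of_nat (lookup n a) * u a = 0" by (cases "a \<in> keys n") (auto simp: in_keys_iff)
  qed
  moreover have "msum u m = (\<Sum>a\<in>N. u a)"
    unfolding msum_def lm by (simp add: sum.If_cases)
  ultimately have "(\<Sum>a\<in>N. u a) = 0" by simp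
  then have "u a = 0" if "a \<in> N" for a using that u0 by (simp add: sum_nonneg_eq_0_iff)
  then have "N \<subseteq> M" using ab(2) by (auto simp: u_def)
  with M(1) show thesis by (rule that)
qed

text \<open>Passing to a cell of \<open>w'\<close> above \<open>M\<close> and back to a cell of
  \<open>w\<close> encloses that cell of \<open>w'\<close> between two cells of \<open>w\<close>,
  which coincide.\<close>

lemma cell_transfer:
  assumes "supermodular w" "supermodular w'" "modular_pair w = modular_pair w'" "cell w M"
  shows "cell w' M"
proof -
  obtain M' where M': "cell w' M'" "M \<subseteq> M'"
    using modular_sublattice_in_cell[OF assms(2) cell_sublattice[OF assms(4,1)]]
      cell_modular_pair[OF assms(4,1)] unfolding assms(3) by blast
  obtain M'' where M'': "cell w M''" "M' \<subseteq> M''"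
    using modular_sublattice_in_cell[OF assms(1) cell_sublattice[OF M'(1) assms(2)]]
      cell_modular_pair[OF M'(1) assms(2)] unfolding assms(3) by blast
  have "M = M''" by (rule cell_unique[OF assms(4) M''(1)]) (use M' M'' in auto)
  then show ?thesis using M' M'' by auto
qed

text \<open>A modular pair is drawn into any cell containing the chain \<open>inf a b\<close>,
  \<open>sup a b\<close>. Hence the cells determine the modular pairs.\<close>

lemma modular_pair_iff_cell:
  assumes "supermodular w"
  shows "modular_pair w a b \<longleftrightarrow> (\<exists>M. cell w M \<and> a \<in> M \<and> b \<in> M)"
proof
  assume m: "modular_pair w a b"
  obtain M where "cell w M" "{sup a b, inf a b} \<subseteq> M"
    using chain_in_cell[OF assms, of "{sup a b, inf a b}"] by (metis insertE inf_sup_ord(1) le_supI1 order_refl singletonD)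
  then show "\<exists>M. cell w M \<and> a \<in> M \<and> b \<in> M" using cell_modular_iff[OF _ m] by blast
qed (use cell_modular_pair assms in blast)

lemma cells_eq_iff:
  assumes "supermodular w" "supermodular w'"
  shows "cell w = cell w' \<longleftrightarrow> modular_pair w = modular_pair w'"
proof
  assume "cell w = cell w'"
  then show "modular_pair w = modular_pair w'"
    by (intro ext) (simp add: modular_pair_iff_cell assms)
next
  assume "modular_pair w = modular_pair w'"
  then show "cell w = cell w'"
    using cell_transfer[OF assms] cell_transfer[OF assms(2,1)] by (intro ext iffI) simp_all
qed

section \<open>Linear functionals on polynomials\<close>

interpretation ideal: module "(*) :: 'x cpoly \<Rightarrow> 'x cpoly \<Rightarrow> 'x cpoly"
  by unfold_locales (auto simp: algebra_simps)

interpretation cspan: module "\<lambda>c (p :: 'x cpoly). single 0 c * p"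
  by unfold_locales (simp_all add: distrib_left distrib_right single_add mult.assoc[symmetric] mult_single)

text \<open>Evaluation at a point and summation of the coefficients of a fixed multidegree are both of this form.\<close>

definition linext :: "('x monom \<Rightarrow> complex) \<Rightarrow> 'x cpoly \<Rightarrow> complex" where
  "linext g p = (\<Sum>m\<in>keys p. lookup p m * g m)"

lemma linext_superset:
  assumes "finite S" "keys p \<subseteq> S"
  shows "linext g p = (\<Sum>m\<in>S. lookup p m * g m)"
  unfolding linext_def by (rule sum.mono_neutral_left) (use assms in \<open>auto simp: in_keys_iff\<close>)

lemma linext_zero [simp]: "linext g 0 = 0"
  by (simp add: linext_def)

lemma linext_single [simp]: "linext g (single m c) = c * g m"
  by (subst linext_superset[of "{m}"]) auto

lemma linext_add: "linext g (p + q) = linext g p + linext g q"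
proof -
  let ?S = "keys p \<union> keys q"
  have "keys (p + q) \<subseteq> ?S" by (rule keys_add)
  then show ?thesis
    by (simp add: linext_superset[of ?S] lookup_add distrib_right sum.distrib)
qed

lemma linext_uminus: "linext g (- p) = - linext g p"
  using linext_add[of g p "- p"] by (simp add: add_eq_0_iff2)

lemma linext_diff: "linext g (p - q) = linext g p - linext g q"
  using linext_add[of g p "- q"] by (simp add: linext_uminus)

lemma linext_sum: "linext g (\<Sum>i\<in>S. f i) = (\<Sum>i\<in>S. linext g (f i))"
  by (induction S rule: infinite_finite_induct) (auto simp: linext_add)

lemma cpoly_monom_sum: "(\<Sum>m\<in>keys p. single m (lookup p m)) = (p :: 'x cpoly)"
  by (rule poly_mapping_eqI) (simp add: lookup_sum lookup_single when_def in_keys_iff)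

lemma cpoly_induct [case_names zero add monom]:
  fixes p :: "'x cpoly"
  assumes "P 0" "\<And>p q. P p \<Longrightarrow> P q \<Longrightarrow> P (p + q)" "\<And>m c. P (single m c)"
  shows "P p"
proof -
  have "P (\<Sum>m\<in>S. single m (lookup p m))" for S
    by (induction S rule: infinite_finite_induct) (auto intro: assms)
  from this[of "keys p"] show ?thesis by (simp only: cpoly_monom_sum)
qed

lemma linext_monom_mult: "linext g (single n c * p) = c * linext (\<lambda>m. g (n + m)) p"
  by (induction p rule: cpoly_induct) (auto simp: distrib_left linext_add mult_single)

lemma var_mult: "var a * var b = single (single a 1 + single b 1) 1"
  by (simp add: var_def mult_single)

lemma monom_mult_var_mult: "single n 1 * (var a * var b) = single (n + single a 1 + single b 1) 1"
  by (simp add: var_mult mult_single add.assoc)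

abbreviation hibi_binomial :: "'a::lattice \<Rightarrow> 'a \<Rightarrow> 'a cpoly" where
  "hibi_binomial a b \<equiv> var a * var b - var (sup a b) * var (inf a b)"

lemma monom_mult_hibi_binomial:
  "single k 1 * hibi_binomial a b =
    single (k + single a 1 + single b 1) 1 - single (k + single (sup a b) 1 + single (inf a b) 1) 1"
  by (simp only: right_diff_distrib monom_mult_var_mult)

lemma hibi_binomial_comparable: "a \<le> b \<or> b \<le> a \<Longrightarrow> hibi_binomial a b = 0"
  by (auto simp: sup_absorb1 sup_absorb2 inf_absorb1 inf_absorb2 mult.commute)

lemma multidegree_step:
  fixes a b :: "'a::{finite,distrib_lattice}"
  shows "multidegree (n + single a 1 + single b 1) = multidegree (n + single (sup a b) 1 + single (inf a b) 1)"
proof -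
  have "msum (\<lambda>a. of_bool (p \<le> a) :: nat) (n + single a 1 + single b 1)
      = msum (\<lambda>a. of_bool (p \<le> a)) (n + single (sup a b) 1 + single (inf a b) 1)" if "p \<in> jirr" for p
    using of_bool_jirr_modular[OF that, of a b] by (simp only: msum_add msum_single add.assoc of_nat_1 mult_1)
  moreover have "msum (\<lambda>_. 1 :: nat) (n + single a 1 + single b 1)
      = msum (\<lambda>_. 1) (n + single (sup a b) 1 + single (inf a b) 1)"
    by (simp only: msum_add msum_single)
  ultimately show ?thesis unfolding multidegree_def by (intro prod_eqI ext) (simp_all only: fst_conv snd_conv if_True split: if_split, simp)
qed

text \<open>The functional reads off the coefficient of one torus monomial after the toric
  parametrization, whose kernel contains every Hibi binomial.\<close>

lemma multidegree_functional_hibi_ideal: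
  fixes p :: "'a::{finite,distrib_lattice} cpoly"
  assumes "p \<in> hibi_ideal"
  shows "linext (\<lambda>m. of_bool (multidegree m = \<tau>)) p = 0"
proof -
  \<comment> \<open>Quantifying over all shifts \<open>n\<close> makes the set closed under
    multiplication by monomials, hence an ideal.\<close>
  define Z where "Z = {p :: 'a cpoly. \<forall>n. linext (\<lambda>m. of_bool (multidegree (n + m) = \<tau>)) p = 0}"
  have monom: "single k c * q \<in> Z" if "q \<in> Z" for q k c
    using that by (auto simp: Z_def linext_monom_mult add.assoc[symmetric])
  have "ideal.subspace Z"
  proof (rule ideal.subspaceI)
    show "x + y \<in> Z" if "x \<in> Z" "y \<in> Z" for x y using that by (auto simp: Z_def linext_add)
    then show "c * x \<in> Z" if "x \<in> Z" for c x
      by (induction c rule: cpoly_induct) (use that monom in \<open>auto simp: distrib_right Z_def\<close>)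
  qed (auto simp: Z_def)
  moreover have "hibi_binomial a b \<in> Z" for a b
    using multidegree_step[of _ a b]
    by (simp add: Z_def linext_diff var_mult add.assoc)
  ultimately have "hibi_ideal \<subseteq> Z"
    unfolding hibi_ideal_def ideal_generated_def by (intro ideal.span_minimal) auto
  then have "p \<in> Z" using assms by blast
  then have "linext (\<lambda>m. of_bool (multidegree (0 + m) = \<tau>)) p = 0" unfolding Z_def by blast
  then show ?thesis by simp
qed

section \<open>Initial ideals of the Hibi ideal\<close>

text \<open>Comparable pairs are always modular and contribute only the zero binomial, which lets
  the two families range over all pairs.\<close>

definition initial_gens :: "(real, 'a::{finite,distrib_lattice}) vec \<Rightarrow> 'a cpoly set" where
  "initial_gens w = {hibi_binomial a b | a b. modular_pair w a b} \<union> {var a * var b | a b. \<not> modular_pair w a b}"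

lemma modular_pair_comparable: "a \<le> b \<or> b \<le> a \<Longrightarrow> modular_pair w a b"
  by (auto simp: modular_pair_def sup_absorb1 sup_absorb2 inf_absorb1 inf_absorb2)

text \<open>A modular step is a binomial relation between monomials of equal weight; any other step
  starts from a monomial in \<open>J\<close> and raises the weight. One step of the second kind on
  the path puts the starting monomial into \<open>J\<close>.\<close>

lemma straighten_weight:
  assumes "supermodular w" "(straighten UNIV)\<^sup>*\<^sup>* m n"
  defines "J \<equiv> ideal_generated (initial_gens w)"
  shows "(single m 1 - single n 1 \<in> J \<and> monom_grading w m = monom_grading w n) \<or>
         (single m 1 \<in> J \<and> monom_grading w m < monom_grading w n)"
  using assms(2)
proof (induction rule: rtranclp_induct)
  case base
  then show ?case by (simp add: J_def ideal_generated_def ideal.span_zero)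
next
  case (step n n')
  have "(single n 1 - single n' 1 \<in> J \<and> monom_grading w n = monom_grading w n') \<or>
        (single n 1 \<in> J \<and> monom_grading w n < monom_grading w n')"
    using step(2)
  proof (cases rule: straighten.cases)
    case (1 a b k)
    have g: "monom_grading w n = monom_grading w k + (w $ a + w $ b)"
      "monom_grading w n' = monom_grading w k + (w $ sup a b + w $ inf a b)"
      by (simp_all add: 1 monom_grading_msum msum_add msum_single)
    show ?thesis
    proof (cases "modular_pair w a b")
      case True
      then have "hibi_binomial a b \<in> initial_gens w" by (auto simp: initial_gens_def)
      then have "single k 1 * hibi_binomial a b \<in> J"
        unfolding J_def ideal_generated_def by (intro ideal.span_scale ideal.span_base)
      then have "single m 1 - single n' 1 \<in> J" if "m = n" for m
        unfolding that 1 monom_mult_hibi_binomial .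
      then show ?thesis using True unfolding g modular_pair_def by simp
    next
      case False
      then have "var a * var b \<in> initial_gens w" by (auto simp: initial_gens_def)
      then have "single k 1 * (var a * var b) \<in> J"
        unfolding J_def ideal_generated_def by (intro ideal.span_scale ideal.span_base)
      then have "single n 1 \<in> J" unfolding 1 monom_mult_var_mult .
      moreover have "w $ a + w $ b < w $ sup a b + w $ inf a b"
        using False assms(1) by (simp add: modular_pair_def supermodular_def less_le)
      ultimately show ?thesis unfolding g by simp
    qed
  qed
  moreover have "x + y \<in> J" if "x \<in> J" "y \<in> J" for x y
    using that unfolding J_def ideal_generated_def by (rule ideal.span_add)
  from this[of "single m 1 - single n 1" "single n 1 - single n' 1"] this[of "single m 1 - single n 1" "single n 1"]
  have "single m 1 - single n 1 \<in> J \<Longrightarrow> single n 1 - single n' 1 \<in> J \<Longrightarrow> single m 1 - single n' 1 \<in> J"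
    "single m 1 - single n 1 \<in> J \<Longrightarrow> single n 1 \<in> J \<Longrightarrow> single m 1 \<in> J" by auto
  ultimately show ?case using step.IH by auto
qed

lemma weight_le_chain_form:
  assumes "supermodular w"
  shows "monom_grading w m \<le> monom_grading w (chain_form m)"
  using straighten_weight[OF assms chain_form(3)[of m]] by auto

lemma initial_form_eq:
  "initial_form w p = (\<Sum>m | m \<in> keys p \<and> monom_grading w m = Min (monom_grading w ` keys p). single m (lookup p m))"
  by (simp add: initial_form_def graded_component_def)

lemma min_weight_le: "m \<in> keys p \<Longrightarrow> Min (monom_grading w ` keys p) \<le> monom_grading w m"
  by (rule Min_le) auto

text \<open>A monomial of \<open>p\<close> with chain form \<open>n\<close> has weight at most \<open>g\<close>, hence exactly \<open>g\<close>, so the sum runs over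
  all monomials of \<open>p\<close> of the multidegree of \<open>n\<close>.\<close>

lemma initial_part_cancels:
  assumes w: "supermodular w" and p: "p \<in> hibi_ideal" and n: "chain_monom n"
    and g: "g = Min (monom_grading w ` keys p)" "monom_grading w n = g"
  shows "(\<Sum>m | m \<in> keys p \<and> monom_grading w m = g \<and> chain_form m = n. lookup p m) = 0"
proof -
  have "(\<Sum>m | m \<in> keys p \<and> monom_grading w m = g \<and> chain_form m = n. lookup p m) =
        (\<Sum>m\<in>keys p. lookup p m * of_bool (multidegree m = multidegree n))"
  proof (rule sum.mono_neutral_cong_left)
    show "\<forall>i\<in>keys p - {m \<in> keys p. monom_grading w m = g \<and> chain_form m = n}.
             lookup p i * of_bool (multidegree i = multidegree n) = 0"
    proof
      fix i assume i: "i \<in> keys p - {m \<in> keys p. monom_grading w m = g \<and> chain_form m = n}"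
      have "multidegree i \<noteq> multidegree n"
      proof
        assume "multidegree i = multidegree n"
        then have c: "chain_form i = n" using n by (intro chain_form_eqI) auto
        then have "monom_grading w i \<le> g" using weight_le_chain_form[OF w, of i] g(2) by simp
        moreover have "g \<le> monom_grading w i" using min_weight_le[of i p w] i unfolding g(1) by blast
        ultimately show False using i c by simp
      qed
      then show "lookup p i * of_bool (multidegree i = multidegree n) = 0" by simp
    qed
    fix x assume "x \<in> {m \<in> keys p. monom_grading w m = g \<and> chain_form m = n}"
    then have "multidegree n = multidegree x" using chain_form(2)[of x] by auto
    then show "lookup p x = lookup p x * of_bool (multidegree x = multidegree n)" by simp
  qed auto
  also have "\<dots> = 0" using multidegree_functional_hibi_ideal[OF p, of "multidegree n"] by (simp add: linext_def)
  finally show ?thesis .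
qed

text \<open>An initial monomial with a heavier chain form lies in the ideal; the others are
  congruent to their chain forms, whose total coefficients vanish.\<close>

lemma initial_form_in_ideal:
  assumes w: "supermodular w" and p: "p \<in> hibi_ideal"
  shows "initial_form w p \<in> ideal_generated (initial_gens w)" (is "_ \<in> ?J")
proof -
  define g where "g = Min (monom_grading w ` keys p)"
  define K where "K = {m. m \<in> keys p \<and> monom_grading w m = g}"
  define K1 where "K1 = {m\<in>K. monom_grading w (chain_form m) = g}"
  have fin: "finite K" "finite K1" by (auto simp: K_def K1_def)
  have scale: "single m c \<in> ?J" if "single m 1 \<in> ?J" for m c
  proof -
    have "single 0 c * single m 1 \<in> ?J" using that unfolding ideal_generated_def by (rule ideal.span_scale)
    then show ?thesis by (simp add: mult_single)
  qed
  have scale2: "single m c - single n c \<in> ?J" if "single m 1 - single n 1 \<in> ?J" for m n c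
  proof -
    have "single 0 c * (single m 1 - single n 1) \<in> ?J" using that unfolding ideal_generated_def by (rule ideal.span_scale)
    then show ?thesis by (simp add: mult_single right_diff_distrib)
  qed
  have A: "single m (lookup p m) \<in> ?J" if "m \<in> K - K1" for m
  proof (rule scale)
    have "monom_grading w m \<noteq> monom_grading w (chain_form m)" using that unfolding K_def K1_def by force
    then show "single m 1 \<in> ?J" using straighten_weight[OF w chain_form(3)[of m]] by blast
  qed
  have B: "single m (lookup p m) - single (chain_form m) (lookup p m) \<in> ?J" if "m \<in> K1" for m
  proof (rule scale2)
    have "\<not> monom_grading w m < monom_grading w (chain_form m)" using that unfolding K_def K1_def by simp
    then show "single m 1 - single (chain_form m) 1 \<in> ?J" using straighten_weight[OF w chain_form(3)[of m]] by blast
  qed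
  have C: "(\<Sum>m\<in>K1. single (chain_form m) (lookup p m)) = 0"
  proof (rule poly_mapping_eqI)
    fix n
    have "lookup (\<Sum>m\<in>K1. single (chain_form m) (lookup p m)) n = (\<Sum>m\<in>K1. if chain_form m = n then lookup p m else 0)"
      by (simp add: lookup_sum lookup_single when_def)
    also have "\<dots> = (\<Sum>m | m \<in> K1 \<and> chain_form m = n. lookup p m)"
      by (rule sum.inter_filter[symmetric, OF fin(2)])
    also have "\<dots> = 0"
    proof (cases "chain_monom n \<and> monom_grading w n = g")
      case True
      then have "{m. m \<in> K1 \<and> chain_form m = n} = {m. m \<in> keys p \<and> monom_grading w m = g \<and> chain_form m = n}"
        by (auto simp: K_def K1_def)
      then show ?thesis using initial_part_cancels[OF w p, of n g] True g_def by simp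
    next
      case False
      then have "{m. m \<in> K1 \<and> chain_form m = n} = {}" using chain_form(1) by (auto simp: K1_def)
      then show ?thesis by (simp only: sum.empty)
    qed
    finally show "lookup (\<Sum>m\<in>K1. single (chain_form m) (lookup p m)) n = lookup 0 n" by simp
  qed
  have "initial_form w p = (\<Sum>m\<in>K. single m (lookup p m))"
    unfolding initial_form_eq K_def g_def ..
  also have "\<dots> = (\<Sum>m\<in>K - K1. single m (lookup p m)) + (\<Sum>m\<in>K1. single m (lookup p m))"
    using fin by (intro sum.subset_diff) (auto simp: K1_def)
  also have "\<dots> = (\<Sum>m\<in>K - K1. single m (lookup p m)) + (\<Sum>m\<in>K1. single m (lookup p m) - single (chain_form m) (lookup p m))"
    by (simp add: sum_subtractf C)
  also have "\<dots> \<in> ?J"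
    unfolding ideal_generated_def using A B unfolding ideal_generated_def
    by (intro ideal.span_add ideal.span_sum) auto
  finally show ?thesis .
qed

lemma monom_neq_of_incomparable:
  fixes a b :: "'a::lattice"
  assumes "\<not> a \<le> b" "\<not> b \<le> a"
  shows "n + single a 1 + single b 1 \<noteq> n + single (sup a b) 1 + single (inf a b) (1::nat)"
proof
  assume eq: "n + single a 1 + single b 1 = n + single (sup a b) 1 + single (inf a b) (1::nat)"
  have "sup a b \<noteq> a" "sup a b \<noteq> b" using assms by (metis sup.cobounded1 sup.cobounded2)+
  then show False using arg_cong[OF eq, of "\<lambda>m. lookup m (sup a b)"]
    by (simp add: lookup_add lookup_single when_def split: if_splits)
qed

lemma initial_form_binomial:
  assumes "m \<noteq> n"
  shows "monom_grading w m < monom_grading w n \<Longrightarrow> initial_form w (single m 1 - single n 1) = single m 1"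
    and "monom_grading w n < monom_grading w m \<Longrightarrow> initial_form w (single m 1 - single n 1) = - single n 1"
    and "monom_grading w n = monom_grading w m \<Longrightarrow> initial_form w (single m 1 - single n 1) = single m 1 - single n 1"
proof -
  let ?p = "single m 1 - single n 1 :: 'a cpoly"
  have k: "keys ?p = {m, n}"
    using assms by (auto simp: in_keys_iff lookup_minus lookup_single when_def split: if_splits)
  have l: "lookup ?p m = 1" "lookup ?p n = -1"
    using assms by (auto simp: lookup_minus lookup_single when_def)
  show "initial_form w ?p = single m 1" if "monom_grading w m < monom_grading w n"
  proof -
    have "{x. x \<in> {m, n} \<and> monom_grading w x = Min (monom_grading w ` {m, n})} = {m}" using that by auto
    then show ?thesis unfolding initial_form_eq k by (simp add: l)
  qed
  show "initial_form w ?p = - single n 1" if "monom_grading w n < monom_grading w m"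
  proof -
    have "{x. x \<in> {m, n} \<and> monom_grading w x = Min (monom_grading w ` {m, n})} = {n}" using that by auto
    then show ?thesis unfolding initial_form_eq k by (simp add: l single_uminus)
  qed
  show "initial_form w ?p = ?p" if "monom_grading w n = monom_grading w m"
  proof -
    have "{x. x \<in> {m, n} \<and> monom_grading w x = Min (monom_grading w ` {m, n})} = {m, n}" using that by auto
    then show ?thesis unfolding initial_form_eq k using assms by (simp add: l single_uminus)
  qed
qed

lemma initial_ideal_base: "p \<in> I \<Longrightarrow> p \<noteq> 0 \<Longrightarrow> initial_form w p \<in> initial_ideal w I"
  unfolding initial_ideal_def complex_span_def by (rule cspan.span_base) auto

lemma hibi_binomial_initial:
  fixes a b :: "'a::{finite,lattice}" and k :: "'a monom"
  assumes "\<not> a \<le> b" "\<not> b \<le> a"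
  defines "m \<equiv> k + single a 1 + single b 1" and "n \<equiv> k + single (sup a b) 1 + single (inf a b) 1"
  shows "initial_form w (single m 1 - single n 1) \<in> initial_ideal w hibi_ideal"
proof (rule initial_ideal_base)
  have "hibi_binomial a b \<in> hibi_ideal"
    unfolding hibi_ideal_def ideal_generated_def by (rule ideal.span_base) auto
  then have "single k 1 * hibi_binomial a b \<in> hibi_ideal"
    unfolding hibi_ideal_def ideal_generated_def by (rule ideal.span_scale)
  then show "single m 1 - single n 1 \<in> (hibi_ideal :: 'a cpoly set)"
    unfolding monom_mult_hibi_binomial m_def n_def .
  have "m \<noteq> n" unfolding m_def n_def by (rule monom_neq_of_incomparable[OF assms(1,2)])
  then have "lookup (single m 1 - single n (1::complex)) m = 1" by (simp add: lookup_minus lookup_single when_def)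
  then show "single m 1 - single n 1 \<noteq> (0 :: 'a cpoly)" by auto
qed

theorem initial_ideal_hibi:
  assumes w: "supermodular w"
  shows "initial_ideal w hibi_ideal = ideal_generated (initial_gens w)"
proof
  let ?J = "ideal_generated (initial_gens w)"
  let ?I = "initial_ideal w hibi_ideal"
  have "cspan.subspace ?J"
    by (rule cspan.subspaceI) (auto simp: ideal_generated_def ideal.span_zero ideal.span_add ideal.span_scale)
  then show "?I \<subseteq> ?J"
    unfolding initial_ideal_def complex_span_def
    by (intro cspan.span_minimal) (use initial_form_in_ideal[OF w] in auto)
  have add: "x + y \<in> ?I" if "x \<in> ?I" "y \<in> ?I" for x y
    using that unfolding initial_ideal_def complex_span_def by (rule cspan.span_add)
  have zero: "0 \<in> ?I" unfolding initial_ideal_def complex_span_def by (rule cspan.span_zero)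
  have scale: "single 0 c * x \<in> ?I" if "x \<in> ?I" for x c
    using that unfolding initial_ideal_def complex_span_def by (rule cspan.span_scale)
  \<comment> \<open>\<open>initial_ideal\<close> is only a linear span. Closure under multiplication
    comes from the fact that a monomial multiple of a generator is zero or itself an initial form of
    an element of the Hibi ideal.\<close>
  have gen: "single k 1 * g \<in> ?I" if "g \<in> initial_gens w" for g k
    using that unfolding initial_gens_def
  proof (elim UnE CollectE exE conjE)
    fix a b assume g: "g = hibi_binomial a b" and m: "modular_pair w a b"
    show ?thesis
    proof (cases "a \<le> b \<or> b \<le> a")
      case True
      then show ?thesis unfolding g hibi_binomial_comparable[OF True] by (simp add: zero)
    next
      case False
      then have nc: "\<not> a \<le> b" "\<not> b \<le> a" by auto
      let ?m = "k + single a 1 + single b 1" and ?n = "k + single (sup a b) 1 + single (inf a b) (1::nat)"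
      have "monom_grading w ?n = monom_grading w ?m"
        using m by (simp add: monom_grading_msum msum_add msum_single modular_pair_def)
      from initial_form_binomial(3)[OF monom_neq_of_incomparable[OF nc] this]
      show ?thesis using hibi_binomial_initial[OF nc, of w k] unfolding g monom_mult_hibi_binomial by simp
    qed
  next
    fix a b assume g: "g = var a * var b" and m: "\<not> modular_pair w a b"
    have nc: "\<not> a \<le> b" "\<not> b \<le> a" using m modular_pair_comparable by blast+
    let ?m = "k + single a 1 + single b 1" and ?n = "k + single (sup a b) 1 + single (inf a b) (1::nat)"
    have "monom_grading w ?m < monom_grading w ?n"
      using m w by (simp add: monom_grading_msum msum_add msum_single modular_pair_def supermodular_def less_le)
    from initial_form_binomial(1)[OF monom_neq_of_incomparable[OF nc] this]
    show ?thesis using hibi_binomial_initial[OF nc, of w k] unfolding g monom_mult_var_mult by simp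
  qed
  have mult: "q * g \<in> ?I" if "g \<in> initial_gens w" for q g
  proof (induction q rule: cpoly_induct)
    case (monom m c)
    have "single m c * g = single 0 c * (single m 1 * g)" by (simp add: mult.assoc[symmetric] mult_single)
    then show ?case using gen[OF that] scale by metis
  qed (auto simp: zero distrib_right add)
  show "?J \<subseteq> ?I"
  proof
    fix x assume "x \<in> ?J"
    then show "x \<in> ?I" unfolding ideal_generated_def
      by (induction rule: ideal.span_induct_alt) (auto simp: zero add mult)
  qed
qed

text \<open>A functional separates: it collects the coefficients of monomials with chain form
  \<open>n\<close> and the weight of \<open>n\<close>, kills all initial forms and takes the value 1
  on \<open>n\<close>.\<close>

lemma chain_monom_notin_initial_ideal:
  assumes w: "supermodular w" and n: "chain_monom n"
  shows "single n 1 \<notin> initial_ideal w hibi_ideal"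
proof
  let ?\<Psi> = "linext (\<lambda>m. of_bool (chain_form m = n \<and> monom_grading w m = monom_grading w n))"
  have "cspan.subspace {p. ?\<Psi> p = 0}"
    by (rule cspan.subspaceI) (auto simp: linext_add linext_monom_mult)
  moreover have "?\<Psi> (initial_form w p) = 0" if p: "p \<in> hibi_ideal" "p \<noteq> 0" for p
  proof -
    define g where "g = Min (monom_grading w ` keys p)"
    define K where "K = {m. m \<in> keys p \<and> monom_grading w m = g}"
    have "finite K" by (simp add: K_def)
    have "?\<Psi> (initial_form w p) = (\<Sum>m\<in>K. lookup p m * of_bool (chain_form m = n \<and> monom_grading w m = monom_grading w n))"
      unfolding initial_form_eq linext_sum linext_single K_def g_def ..
    also have "\<dots> = 0"
    proof (cases "monom_grading w n = g")
      case True
      have "(\<Sum>m\<in>K. lookup p m * of_bool (chain_form m = n \<and> monom_grading w m = monom_grading w n))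
          = (\<Sum>m | m \<in> keys p \<and> monom_grading w m = g \<and> chain_form m = n. lookup p m)"
        by (rule sum.mono_neutral_cong_right) (use True \<open>finite K\<close> in \<open>auto simp: K_def\<close>)
      then show ?thesis using initial_part_cancels[OF w p(1) n g_def True] by simp
    next
      case False
      then show ?thesis by (intro sum.neutral) (auto simp: K_def)
    qed
    finally show ?thesis .
  qed
  ultimately have "initial_ideal w hibi_ideal \<subseteq> {p. ?\<Psi> p = 0}"
    unfolding initial_ideal_def complex_span_def by (intro cspan.span_minimal) auto
  moreover assume "single n 1 \<in> initial_ideal w hibi_ideal"
  moreover have "chain_form n = n" by (rule chain_form_eqI[OF n refl])
  ultimately show False by (auto simp: subset_iff)
qed

lemma chain_monom_pair: "x \<le> y \<or> y \<le> x \<Longrightarrow> chain_monom (single x 1 + single y (1::nat))"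
  by (auto simp: chain_monom_def keys_add_nat)

text \<open>Both properties are detected by chain monomials, which the initial ideal avoids: a
  violation of supermodularity makes a chain monomial initial, and a pair modular for only one of
  the weights puts both the binomial and its first term into the ideal.\<close>

lemma initial_ideal_eq_iff:
  assumes w: "supermodular w"
  shows "initial_ideal w' hibi_ideal = initial_ideal w hibi_ideal \<longleftrightarrow>
    supermodular w' \<and> modular_pair w' = modular_pair w"
proof
  assume "supermodular w' \<and> modular_pair w' = modular_pair w"
  then show "initial_ideal w' hibi_ideal = initial_ideal w hibi_ideal"
    using w by (simp add: initial_ideal_hibi initial_gens_def)
next
  assume eq: "initial_ideal w' hibi_ideal = initial_ideal w hibi_ideal"
  have no: "single (single (sup a b) 1 + single (inf a b) 1) 1 \<notin> initial_ideal w hibi_ideal" for a b :: 'a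
    by (rule chain_monom_notin_initial_ideal[OF w chain_monom_pair]) (simp add: le_infI1)
  have sm: "supermodular w'"
    unfolding supermodular_def
  proof (intro allI, rule ccontr)
    fix a b assume h: "\<not> w' $ a + w' $ b \<le> w' $ sup a b + w' $ inf a b"
    have nc: "\<not> a \<le> b" "\<not> b \<le> a"
      using h modular_pair_comparable[of a b w'] by (auto simp: modular_pair_def)
    let ?m = "single a 1 + single b 1" and ?n = "single (sup a b) 1 + single (inf a b) (1::nat)"
    have "monom_grading w' ?n < monom_grading w' ?m"
      using h by (simp add: monom_grading_msum msum_add msum_single)
    then have "- single ?n 1 \<in> initial_ideal w' hibi_ideal"
      using hibi_binomial_initial[OF nc, of w' 0] monom_neq_of_incomparable[OF nc, of 0]
      by (simp add: initial_form_binomial)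
    then have "single ?n 1 \<in> initial_ideal w hibi_ideal"
      unfolding eq unfolding initial_ideal_def complex_span_def using cspan.span_neg by fastforce
    with no show False by blast
  qed
  have half: "modular_pair v a b \<Longrightarrow> modular_pair u a b"
    if h: "supermodular v" "supermodular u" "initial_ideal v hibi_ideal = initial_ideal u hibi_ideal"
     "initial_ideal u hibi_ideal = initial_ideal w hibi_ideal" for u v a b
  proof (rule ccontr)
    assume m: "modular_pair v a b" "\<not> modular_pair u a b"
    let ?I = "initial_ideal w hibi_ideal"
    have hb: "hibi_binomial a b \<in> ?I" using m h unfolding h(4)[symmetric] h(3)[symmetric]
      by (auto simp: initial_ideal_hibi initial_gens_def ideal_generated_def intro!: ideal.span_base)
    have "var a * var b \<in> ?I" using m h unfolding h(4)[symmetric]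
      by (auto simp: initial_ideal_hibi initial_gens_def ideal_generated_def intro!: ideal.span_base)
    then have "var a * var b - hibi_binomial a b \<in> ?I"
      using hb unfolding initial_ideal_def complex_span_def by (rule cspan.span_diff)
    then have "single (single (sup a b) 1 + single (inf a b) 1) 1 \<in> ?I" by (simp add: var_mult)
    with no show False by blast
  qed
  have "modular_pair w' = modular_pair w"
    using half[OF sm w eq refl] half[OF w sm eq[symmetric] eq] by (intro ext iffI)
  with sm show "supermodular w' \<and> modular_pair w' = modular_pair w" ..
qed

section \<open>The cone of supermodular functions\<close>

lemma exists_strictly_supermodular:
  "\<exists>s :: (real, 'a::{finite,distrib_lattice}) vec. supermodular s \<and> (\<forall>a b. modular_pair s a b \<longrightarrow> a \<le> b \<or> b \<le> a)"
proof -
  define s :: "(real, 'a) vec" where "s = (\<chi> a. real ((card (birkhoff a))\<^sup>2))"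
  have strict: "s $ a + s $ b < s $ sup a b + s $ inf a b" if "\<not> a \<le> b" "\<not> b \<le> a" for a b
    using card_birkhoff_strict[OF that] unfolding s_def vec_lambda_beta by linarith
  have "supermodular s"
    unfolding supermodular_def
  proof (intro allI)
    fix a b show "s $ a + s $ b \<le> s $ sup a b + s $ inf a b"
      using strict[of a b] modular_pair_comparable[of a b s] unfolding modular_pair_def by fastforce
  qed
  moreover have "a \<le> b \<or> b \<le> a" if "modular_pair s a b" for a b
    using strict[of a b] that unfolding modular_pair_def by force
  ultimately show ?thesis by blast
qed

lemma initial_ideal_strict:
  assumes "supermodular s" "\<And>a b. modular_pair s a b \<Longrightarrow> a \<le> b \<or> b \<le> a"
  shows "initial_ideal s hibi_ideal = monomial_hibi_ideal"
proof -
  have mp: "modular_pair s a b \<longleftrightarrow> a \<le> b \<or> b \<le> a" for a b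
    using assms(2) modular_pair_comparable by blast
  let ?G = "{var a * var b | a b :: 'a. \<not> a \<le> b \<and> \<not> b \<le> a}"
  have "initial_gens s \<subseteq> ideal.span ?G"
    unfolding initial_gens_def
  proof (intro Un_least subsetI)
    fix x assume "x \<in> {hibi_binomial a b |a b. modular_pair s a b}"
    then obtain a b where "x = hibi_binomial a b" "a \<le> b \<or> b \<le> a" using mp by blast
    then have "x = 0" using hibi_binomial_comparable by blast
    then show "x \<in> ideal.span ?G" by (simp add: ideal.span_zero)
  next
    fix x assume "x \<in> {var a * var b |a b. \<not> modular_pair s a b}"
    then show "x \<in> ideal.span ?G" using mp by (intro ideal.span_base) blast
  qed
  moreover have "?G \<subseteq> ideal.span (initial_gens s)"
    unfolding initial_gens_def mp by (rule subsetI, rule ideal.span_base) blast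
  ultimately have "ideal.span (initial_gens s) = ideal.span ?G"
    by (intro antisym ideal.span_minimal ideal.subspace_span)
  then show ?thesis
    unfolding initial_ideal_hibi[OF assms(1)] monomial_hibi_ideal_def ideal_generated_def .
qed

lemma supermodular_add_scale:
  assumes "supermodular w" "supermodular s" "0 \<le> e" "0 \<le> d"
  shows "supermodular (d *\<^sub>R w + e *\<^sub>R s)"
  unfolding supermodular_def
proof (intro allI)
  fix a b
  have "d * (w $ a + w $ b) \<le> d * (w $ sup a b + w $ inf a b)"
    using assms by (intro mult_left_mono) (auto simp: supermodular_def)
  moreover have "e * (s $ a + s $ b) \<le> e * (s $ sup a b + s $ inf a b)"
    using assms by (intro mult_left_mono) (auto simp: supermodular_def)
  ultimately show "(d *\<^sub>R w + e *\<^sub>R s) $ a + (d *\<^sub>R w + e *\<^sub>R s) $ b \<le> (d *\<^sub>R w + e *\<^sub>R s) $ sup a b + (d *\<^sub>R w + e *\<^sub>R s) $ inf a b"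
    by (simp add: algebra_simps)
qed

text \<open>The defects of \<open>w\<close> and \<open>s\<close> are nonnegative, so they cannot
  cancel in a positive combination.\<close>

lemma modular_pair_add_scale:
  assumes "supermodular w" "supermodular s" "0 < e" "0 < d"
  shows "modular_pair (d *\<^sub>R w + e *\<^sub>R s) a b \<longleftrightarrow> modular_pair w a b \<and> modular_pair s a b"
proof -
  define x where "x = w $ sup a b + w $ inf a b - (w $ a + w $ b)"
  define y where "y = s $ sup a b + s $ inf a b - (s $ a + s $ b)"
  have nn: "0 \<le> x" "0 \<le> y" using assms(1,2) by (auto simp: x_def y_def supermodular_def)
  have "modular_pair (d *\<^sub>R w + e *\<^sub>R s) a b \<longleftrightarrow> d * x + e * y = 0"
    unfolding modular_pair_def x_def y_def by (auto simp: algebra_simps)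
  also have "\<dots> \<longleftrightarrow> x = 0 \<and> y = 0" using nn assms(3,4) by (simp add: add_nonneg_eq_0_iff)
  also have "\<dots> \<longleftrightarrow> modular_pair w a b \<and> modular_pair s a b" unfolding modular_pair_def x_def y_def by auto
  finally show ?thesis .
qed

text \<open>Adding a small multiple of a strictly supermodular weight moves any supermodular one
  into C(I^h, I^m); the other inclusion holds because weak inequalities are closed
  conditions.\<close>

theorem hibi_cone_supermodular: "hibi_cone = {w :: (real, 'a::{finite,distrib_lattice}) vec. supermodular w}"
proof -
  obtain s :: "(real, 'a) vec" where s: "supermodular s" "\<And>a b. modular_pair s a b \<Longrightarrow> a \<le> b \<or> b \<le> a"
    using exists_strictly_supermodular by blast
  have mps: "modular_pair s a b \<longleftrightarrow> a \<le> b \<or> b \<le> a" for a b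
    using s(2) modular_pair_comparable by blast
  have ic: "initial_cone hibi_ideal monomial_hibi_ideal = {w. supermodular w \<and> modular_pair w = modular_pair s}"
  proof -
    have "initial_cone hibi_ideal monomial_hibi_ideal = {w. initial_ideal w hibi_ideal = initial_ideal s hibi_ideal}"
      by (simp only: initial_cone_def initial_ideal_strict[OF s])
    then show ?thesis by (simp only: initial_ideal_eq_iff[OF s(1)])
  qed
  have "closed {w :: (real, 'a) vec. \<forall>a b. w $ a + w $ b \<le> w $ sup a b + w $ inf a b}"
    by (intro closed_Collect_all closed_Collect_le continuous_intros)
  then have "closed {w :: (real, 'a) vec. supermodular w}" by (simp add: supermodular_def)
  moreover have "w \<in> closure {w. supermodular w \<and> modular_pair w = modular_pair s}" if w: "supermodular w" for w
    unfolding closure_approachable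
  proof (intro allI impI)
    fix e :: real assume e: "e > 0"
    \<comment> \<open>The summand 1 keeps the denominator positive; the shift then has norm at most
      \<open>e / 2\<close>.\<close>
    define d where "d = e / 2 / (norm s + 1)"
    have d: "0 < d" using e by (auto simp: d_def intro!: divide_pos_pos add_nonneg_pos)
    have "d * norm s < e"
    proof -
      have "d * norm s \<le> d * (norm s + 1)" using d by simp
      also have "\<dots> = e / 2"
      proof -
        have "norm s + 1 \<noteq> 0" using norm_ge_zero[of s] by linarith
        then show ?thesis using nonzero_eq_divide_eq[of "norm s + 1" d "e / 2"] d_def by blast
      qed
      finally show ?thesis using e by simp
    qed
    then have "dist (1 *\<^sub>R w + d *\<^sub>R s) w < e" using d by (simp add: dist_norm)
    moreover have "modular_pair (1 *\<^sub>R w + d *\<^sub>R s) = modular_pair s"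
      using mps modular_pair_comparable[of _ _ w] modular_pair_add_scale[OF w s(1) d, of 1] by (intro ext) auto
    moreover have "supermodular (1 *\<^sub>R w + d *\<^sub>R s)" using supermodular_add_scale[OF w s(1), of d 1] d by simp
    ultimately show "\<exists>y\<in>{w. supermodular w \<and> modular_pair w = modular_pair s}. dist y w < e" by blast
  qed
  ultimately show ?thesis
    unfolding hibi_cone_def ic by (intro antisym closure_minimal) auto
qed

section \<open>Faces of the cone and their relative interiors\<close>

lemma convex_combination_of_prolonged:
  fixes w y :: "'v::real_vector"
  assumes "e > 1"
  shows "w = (1 / e) *\<^sub>R ((1 - e) *\<^sub>R y + e *\<^sub>R w) + ((e - 1) / e) *\<^sub>R y"
proof -
  define z where "z = (1 - e) *\<^sub>R y + e *\<^sub>R w"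
  have "e *\<^sub>R w = z + (e - 1) *\<^sub>R y" by (simp add: z_def algebra_simps)
  then have "(1 / e) *\<^sub>R (e *\<^sub>R w) = (1 / e) *\<^sub>R (z + (e - 1) *\<^sub>R y)" by simp
  then show ?thesis using assms unfolding z_def[symmetric] by (simp add: scaleR_add_right)
qed

text \<open>Where the defect of \<open>w\<close> is positive, it absorbs a small multiple of the
  defect of \<open>y\<close>; where it vanishes, so does that of \<open>y\<close>.\<close>

lemma supermodular_prolong:
  assumes w: "supermodular w" and y: "supermodular y" and E: "\<And>a b. modular_pair w a b \<Longrightarrow> modular_pair y a b"
  obtains e where "e > 0" "supermodular ((1 + e) *\<^sub>R w - e *\<^sub>R y)"
    "\<And>a b. modular_pair y a b \<Longrightarrow> modular_pair w a b \<Longrightarrow> modular_pair ((1 + e) *\<^sub>R w - e *\<^sub>R y) a b"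
proof -
  define D where "D = (\<lambda>v :: (real, 'a) vec. \<lambda>(a, b). v $ sup a b + v $ inf a b - (v $ a + v $ b))"
  have D0: "modular_pair v a b \<longleftrightarrow> D v (a, b) = 0" for v a b by (auto simp: D_def modular_pair_def)
  have Dn: "supermodular v \<longleftrightarrow> (\<forall>x. 0 \<le> D v x)" for v by (auto simp: D_def supermodular_def)
  have Dlin: "D ((1 + e) *\<^sub>R w - e *\<^sub>R y) x = (1 + e) * D w x - e * D y x" for e x
    by (cases x) (simp add: D_def algebra_simps)
  define N where "N = {x. D w x > 0}"
  \<comment> \<open>The entry 1 covers an empty \<open>N\<close>, and the summand 1 in the
    denominators avoids division by a zero defect.\<close>
  define e where "e = Min (insert 1 ((\<lambda>x. D w x / (D y x + 1)) ` N))"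
  have nw: "\<And>x. 0 \<le> D w x" and ny: "\<And>x. 0 \<le> D y x" using w y Dn by auto
  have pos: "0 < e" unfolding e_def
    by (subst Min_gr_iff) (auto simp: N_def add_nonneg_pos ny)
  have le: "e * D y x \<le> (1 + e) * D w x" for x
  proof (cases "x \<in> N")
    case True
    then have "e \<le> D w x / (D y x + 1)" unfolding e_def by (intro Min_le) auto
    moreover have "0 < D y x + 1" using ny[of x] by linarith
    ultimately have "e * (D y x + 1) \<le> D w x" by (simp add: pos_le_divide_eq)
    moreover have "e * D y x \<le> e * (D y x + 1)" using pos by simp
    moreover have "D w x \<le> (1 + e) * D w x" using pos nw[of x] by (simp add: mult_le_cancel_right1)
    ultimately show ?thesis by linarith
  next
    case False
    then have "D w x = 0" using nw[of x] by (simp add: N_def)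
    then have "D y x = 0" using E D0 by (cases x) auto
    then show ?thesis using \<open>D w x = 0\<close> by simp
  qed
  show thesis
  proof (rule that[OF pos])
    show "supermodular ((1 + e) *\<^sub>R w - e *\<^sub>R y)" unfolding Dn Dlin using le by simp
    show "modular_pair ((1 + e) *\<^sub>R w - e *\<^sub>R y) a b" if "modular_pair y a b" "modular_pair w a b" for a b
      using that unfolding D0 Dlin by simp
  qed
qed

text \<open>For supermodular \<open>w\<close>, the smallest face of the cone that contains
  \<open>w\<close>.\<close>

definition modular_face :: "(real, 'a::{finite,distrib_lattice}) vec \<Rightarrow> (real, 'a) vec set" where
  "modular_face w = {y. supermodular y \<and> (\<forall>a b. modular_pair w a b \<longrightarrow> modular_pair y a b)}"

lemma modular_face_face_of:
  shows "modular_face w face_of hibi_cone"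
  unfolding face_of_def hibi_cone_supermodular
proof (intro conjI)
  show "modular_face w \<subseteq> {w. supermodular w}" by (auto simp: modular_face_def)
  show "convex (modular_face w)"
  proof (rule convexI)
    fix x y :: "(real, 'a) vec" and u v :: real
    assume h: "x \<in> modular_face w" "y \<in> modular_face w" "0 \<le> u" "0 \<le> v" "u + v = 1"
    have "modular_pair (u *\<^sub>R x + v *\<^sub>R y) a b" if "modular_pair w a b" for a b
    proof -
      have "x $ a + x $ b = x $ sup a b + x $ inf a b" "y $ a + y $ b = y $ sup a b + y $ inf a b"
        using h that by (auto simp: modular_face_def modular_pair_def)
      then have "u * (x $ a + x $ b) + v * (y $ a + y $ b) = u * (x $ sup a b + x $ inf a b) + v * (y $ sup a b + y $ inf a b)"
        by simp
      then show ?thesis by (simp add: modular_pair_def algebra_simps)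
    qed
    then show "u *\<^sub>R x + v *\<^sub>R y \<in> modular_face w"
      using h by (auto simp: modular_face_def supermodular_add_scale)
  qed
  show "\<forall>x\<in>{w. supermodular w}. \<forall>y\<in>{w. supermodular w}. \<forall>z\<in>modular_face w.
    z \<in> open_segment x y \<longrightarrow> x \<in> modular_face w \<and> y \<in> modular_face w"
  proof (intro ballI impI)
    fix x y z :: "(real, 'a) vec"
    assume h: "x \<in> {w. supermodular w}" "y \<in> {w. supermodular w}" "z \<in> modular_face w" "z \<in> open_segment x y"
    then obtain u where u: "0 < u" "u < 1" "z = (1 - u) *\<^sub>R x + u *\<^sub>R y" by (auto simp: in_segment)
    have "modular_pair z a b \<longleftrightarrow> modular_pair x a b \<and> modular_pair y a b" for a b
      unfolding u(3) by (rule modular_pair_add_scale) (use h u in auto)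
    then show "x \<in> modular_face w \<and> y \<in> modular_face w" using h by (auto simp: modular_face_def)
  qed
qed

text \<open>Relative interiority means that segments of the face ending at the point can be
  prolonged. \<open>supermodular_prolong\<close> supplies this when the modular pairs agree;
  conversely, prolonging from \<open>w\<close> rules out further modular pairs.\<close>

lemma rel_interior_modular_face:
  assumes "supermodular w"
  shows "rel_interior (modular_face w) = {y. supermodular y \<and> modular_pair y = modular_pair w}"
proof -
  have conv: "convex (modular_face w)" using modular_face_face_of face_of_imp_convex by blast
  have ne: "modular_face w \<noteq> {}" using assms by (auto simp: modular_face_def)
  note iff = convex_rel_interior_iff[OF conv ne]
  show ?thesis
  proof (intro equalityI subsetI CollectI)
    fix y assume y: "y \<in> {y. supermodular y \<and> modular_pair y = modular_pair w}"
    show "y \<in> rel_interior (modular_face w)" unfolding iff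
    proof
      fix x assume x: "x \<in> modular_face w"
      obtain e where e: "e > 0" "supermodular ((1 + e) *\<^sub>R y - e *\<^sub>R x)"
        "\<And>a b. modular_pair x a b \<Longrightarrow> modular_pair y a b \<Longrightarrow> modular_pair ((1 + e) *\<^sub>R y - e *\<^sub>R x) a b"
        using supermodular_prolong[of y x] x y by (auto simp: modular_face_def)
      have "(1 - (1 + e)) *\<^sub>R x + (1 + e) *\<^sub>R y = (1 + e) *\<^sub>R y - e *\<^sub>R x" by simp
      then show "\<exists>e>1. (1 - e) *\<^sub>R x + e *\<^sub>R y \<in> modular_face w"
        using e x y by (intro exI[of _ "1 + e"]) (auto simp: modular_face_def)
    qed
  next
    fix y assume y: "y \<in> rel_interior (modular_face w)"
    then have yF: "y \<in> modular_face w" using rel_interior_subset by blast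
    have "w \<in> modular_face w" using assms by (simp add: modular_face_def)
    then obtain e where e: "e > 1" "(1 - e) *\<^sub>R w + e *\<^sub>R y \<in> modular_face w" using y iff by blast
    define z where "z = (1 - e) *\<^sub>R w + e *\<^sub>R y"
    have z: "supermodular z" using e by (simp add: z_def modular_face_def)
    have "y = (1 / e) *\<^sub>R z + ((e - 1) / e) *\<^sub>R w"
      unfolding z_def by (rule convex_combination_of_prolonged[OF e(1)])
    then have "modular_pair y a b \<Longrightarrow> modular_pair w a b" for a b
      using modular_pair_add_scale[OF z assms, of "(e - 1) / e" "1 / e"] e by simp
    then show "supermodular y \<and> modular_pair y = modular_pair w"
      using yF by (auto simp: modular_face_def fun_eq_iff)
  qed
qed

text \<open>Segments from points of \<open>F\<close> to \<open>w\<close> can be prolonged inside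
  \<open>F\<close>, so modularity passes from \<open>w\<close> to all of \<open>F\<close>.
  Conversely, a point of \<open>modular_face w\<close> other than \<open>w\<close> is an end of a
  segment of the cone through \<open>w\<close>, and the face property captures it.\<close>

lemma hibi_face_eq_modular_face:
  assumes F: "F \<in> hibi_faces" and w: "w \<in> rel_interior F"
  shows "supermodular w" "F = modular_face w"
proof -
  have face: "F face_of {w. supermodular w}" and "F \<noteq> {}" using F by (auto simp: hibi_faces_def hibi_cone_supermodular)
  have sub: "F \<subseteq> {w. supermodular w}" using face by (rule face_of_imp_subset)
  have wF: "w \<in> F" using w rel_interior_subset by blast
  show sw: "supermodular w" using wF sub by auto
  have conv: "convex F" using face by (rule face_of_imp_convex)
  show "F = modular_face w"
  proof
    show "F \<subseteq> modular_face w"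
    proof
      fix y assume y: "y \<in> F"
      then obtain e where e: "e > 1" "(1 - e) *\<^sub>R y + e *\<^sub>R w \<in> F"
        using w convex_rel_interior_iff[OF conv \<open>F \<noteq> {}\<close>] by blast
      define z where "z = (1 - e) *\<^sub>R y + e *\<^sub>R w"
      have z: "supermodular z" "supermodular y" using e sub y by (auto simp: z_def)
      have "w = (1 / e) *\<^sub>R z + ((e - 1) / e) *\<^sub>R y"
        unfolding z_def by (rule convex_combination_of_prolonged[OF e(1)])
      then have "modular_pair w a b \<Longrightarrow> modular_pair y a b" for a b
        using modular_pair_add_scale[OF z, of "(e - 1) / e" "1 / e"] e by simp
      then show "y \<in> modular_face w" using z by (auto simp: modular_face_def)
    qed
    show "modular_face w \<subseteq> F"
    proof
      fix y assume y: "y \<in> modular_face w"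
      show "y \<in> F"
      proof (cases "y = w")
        case False
        have "supermodular y" "\<And>a b. modular_pair w a b \<Longrightarrow> modular_pair y a b"
          using y by (auto simp: modular_face_def)
        from supermodular_prolong[OF sw this]
        obtain e where e: "e > 0" "supermodular ((1 + e) *\<^sub>R w - e *\<^sub>R y)" by metis
        define z where "z = (1 + e) *\<^sub>R w - e *\<^sub>R y"
        have "w = (1 - e / (1 + e)) *\<^sub>R z + (e / (1 + e)) *\<^sub>R y"
        proof -
          have c: "1 - e / (1 + e) = 1 / (1 + e)" using e by (simp add: field_simps)
          have "(1 / (1 + e)) *\<^sub>R z + (e / (1 + e)) *\<^sub>R y = (1 / (1 + e)) *\<^sub>R (z + e *\<^sub>R y)" by (simp add: scaleR_add_right)
          also have "z + e *\<^sub>R y = (1 + e) *\<^sub>R w" by (simp add: z_def)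
          finally show ?thesis using e c by simp
        qed
        moreover have "z \<noteq> y"
        proof
          assume "z = y"
          then have "(1 + e) *\<^sub>R w = (1 + e) *\<^sub>R y" by (simp add: z_def algebra_simps)
          then show False using e False by simp
        qed
        ultimately have "w \<in> open_segment z y" using e
          unfolding in_segment by (intro conjI exI[of _ "e / (1 + e)"]) auto
        then show ?thesis using face wF e y unfolding face_of_def z_def modular_face_def by blast
      qed (use wF in simp)
    qed
  qed
qed

lemma modular_face_in_hibi_faces: "supermodular w \<Longrightarrow> modular_face w \<in> hibi_faces"
  using modular_face_face_of by (auto simp: hibi_faces_def modular_face_def)

lemma hibi_face_obtain:
  assumes "F \<in> hibi_faces"
  obtains w where "supermodular w" "F = modular_face w"
proof -
  have "convex F" "F \<noteq> {}" using assms face_of_imp_convex by (auto simp: hibi_faces_def)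
  then obtain w where "w \<in> rel_interior F" using rel_interior_eq_empty by blast
  then show thesis using hibi_face_eq_modular_face[OF assms] that by blast
qed

lemma face_ideal_modular_face:
  assumes "supermodular w"
  shows "face_ideal (modular_face w) = initial_ideal w hibi_ideal"
  unfolding face_ideal_def rel_interior_modular_face[OF assms]
  by (rule the_equality) (use assms initial_ideal_eq_iff[OF assms] in auto)

lemma initial_cone_face_ideal:
  assumes "supermodular w"
  shows "initial_cone hibi_ideal (face_ideal (modular_face w)) = rel_interior (modular_face w)"
  unfolding face_ideal_modular_face[OF assms] rel_interior_modular_face[OF assms] initial_cone_def
    initial_ideal_eq_iff[OF assms] ..

section \<open>Evaluation and projective zero sets\<close>

definition monom_eval :: "('x \<Rightarrow> complex) \<Rightarrow> 'x monom \<Rightarrow> complex" where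
  "monom_eval x m = (\<Prod>a\<in>keys m. x a ^ lookup m a)"

lemma monom_eval_superset:
  assumes "finite S" "keys m \<subseteq> S"
  shows "monom_eval x m = (\<Prod>a\<in>S. x a ^ lookup m a)"
  unfolding monom_eval_def by (rule prod.mono_neutral_left) (use assms in \<open>auto simp: in_keys_iff\<close>)

lemma monom_eval_zero [simp]: "monom_eval x 0 = 1"
  by (simp add: monom_eval_def)

lemma monom_eval_single [simp]: "monom_eval x (single a k) = x a ^ k"
  by (subst monom_eval_superset[of "{a}"]) auto

lemma monom_eval_add: "monom_eval x (m + n) = monom_eval x m * monom_eval x n"
  by (simp add: monom_eval_superset[of "keys m \<union> keys n"] keys_add_nat lookup_add power_add prod.distrib)

lemma monom_eval_sum: "monom_eval x (\<Sum>i\<in>S. f i) = (\<Prod>i\<in>S. monom_eval x (f i))"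
  by (induction S rule: infinite_finite_induct) (auto simp: monom_eval_add)

lemma eval_poly_linext: "eval_poly x p = linext (monom_eval x) p"
  by (simp add: eval_poly_def linext_def monom_eval_def)

lemma eval_poly_single [simp]: "eval_poly x (single m c) = c * monom_eval x m"
  by (simp add: eval_poly_linext)

lemma eval_poly_one [simp]: "eval_poly x 1 = 1"
  using eval_poly_single[of x 0 1] by simp

lemma eval_poly_zero [simp]: "eval_poly x 0 = 0"
  by (simp add: eval_poly_linext)

lemma eval_poly_add [simp]: "eval_poly x (p + q) = eval_poly x p + eval_poly x q"
  by (simp add: eval_poly_linext linext_add)

lemma eval_poly_diff [simp]: "eval_poly x (p - q) = eval_poly x p - eval_poly x q"
  by (simp add: eval_poly_linext linext_diff)

lemma linext_scale: "linext (\<lambda>m. c * g m) p = c * linext g p"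
  by (simp add: linext_def sum_distrib_left mult.left_commute)

lemma eval_poly_mult [simp]: "eval_poly x (p * q) = eval_poly x p * eval_poly x q"
proof (induction p rule: cpoly_induct)
  case (monom m c)
  then show ?case by (simp add: eval_poly_linext linext_monom_mult monom_eval_add linext_scale)
qed (auto simp: distrib_right)

lemma eval_poly_var [simp]: "eval_poly x (var a) = x a"
  by (simp add: var_def)

lemma homogeneous_var: "homogeneous 1 (var a)"
  by (auto simp: homogeneous_def var_def lookup_single when_def split: if_splits)

lemma homogeneous_mult: "homogeneous d p \<Longrightarrow> homogeneous e q \<Longrightarrow> homogeneous (d + e) (p * q)"
  unfolding homogeneous_def using keys_mult[of p q] by (fastforce simp: lookup_add sum.distrib)

lemma homogeneous_diff: "homogeneous d p \<Longrightarrow> homogeneous d q \<Longrightarrow> homogeneous d (p - q)"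
  unfolding homogeneous_def using keys_diff[of p q] by blast

lemma homogeneous_hibi_binomial: "homogeneous 2 (hibi_binomial a b)"
  using homogeneous_diff[OF homogeneous_mult[OF homogeneous_var homogeneous_var] homogeneous_mult[OF homogeneous_var homogeneous_var]]
  by (metis one_add_one)

lemma monom_eval_scale:
  fixes m :: "'a::finite monom"
  shows "monom_eval (\<lambda>a. c * x a) m = c ^ (\<Sum>a\<in>UNIV. lookup m a) * monom_eval x m"
  by (simp add: monom_eval_superset[of UNIV] power_mult_distrib prod.distrib power_sum)

lemma eval_poly_homogeneous_scale:
  assumes "homogeneous d p"
  shows "eval_poly (($) (c *s x)) p = c ^ d * eval_poly (($) x) p"
proof -
  have "($) (c *s x) = (\<lambda>a. c * x $ a)" by (simp add: fun_eq_iff)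
  then have "eval_poly (($) (c *s x)) p = (\<Sum>m\<in>keys p. lookup p m * (c ^ d * monom_eval (($) x) m))"
    unfolding eval_poly_linext linext_def using assms
    by (intro sum.cong) (auto simp: monom_eval_scale homogeneous_def)
  also have "\<dots> = c ^ d * eval_poly (($) x) p"
    by (simp add: eval_poly_linext linext_def sum_distrib_left mult.left_commute)
  finally show ?thesis .
qed

lemma proj_line_self: "x \<in> proj_line x"
  unfolding proj_line_def by (auto intro: exI[of _ 1])

lemma proj_line_scale: "c \<noteq> 0 \<Longrightarrow> proj_line (c *s x) = proj_line x"
  unfolding proj_line_def
proof (intro equalityI subsetI; clarify)
  fix d assume c: "c \<noteq> 0"
  show "\<exists>c'. d *s (c *s x) = c' *s x \<and> True" by (intro exI[of _ "d * c"]) (simp add: vector_smult_assoc)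
  show "\<exists>c'. d *s x = c' *s (c *s x) \<and> True" using c by (intro exI[of _ "d / c"]) (simp add: vector_smult_assoc)
qed

lemma proj_line_memD: "y \<in> proj_line x \<Longrightarrow> \<exists>c. y = c *s x"
  by (auto simp: proj_line_def)

lemma proj_line_eq: "y \<in> proj_line x \<Longrightarrow> y \<noteq> 0 \<Longrightarrow> proj_line y = proj_line x"
  using proj_line_memD[of y x] proj_line_scale[of _ x] by (metis vector_smult_lzero)

lemma proj_spaceE:
  assumes "L \<in> proj_space" obtains x where "x \<noteq> 0" "L = proj_line x"
  using assms by (auto simp: proj_space_def)

lemma proj_zeros_line_iff:
  assumes "\<And>p. p \<in> S \<Longrightarrow> \<exists>d. homogeneous d p" "x \<noteq> 0"
  shows "proj_line x \<in> proj_zeros S \<longleftrightarrow> (\<forall>p\<in>S. eval_poly (($) x) p = 0)"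
proof -
  have "eval_poly (($) y) p = 0" if h: "p \<in> S" "eval_poly (($) x) p = 0" "y \<in> proj_line x" for p y
  proof -
    obtain d where "homogeneous d p" using assms(1) h(1) by blast
    moreover obtain c where "y = c *s x" using h(3) proj_line_memD by blast
    ultimately show ?thesis using h(2) eval_poly_homogeneous_scale[of d p c x] by simp
  qed
  then show ?thesis using proj_line_self assms(2) unfolding proj_zeros_def proj_space_def by blast
qed

lemma proj_zeros_ideal_generated: "proj_zeros (ideal_generated S) = proj_zeros S"
proof -
  have "(\<forall>p\<in>ideal_generated S. \<forall>x\<in>L. eval_poly (($) x) p = 0) \<longleftrightarrow> (\<forall>p\<in>S. \<forall>x\<in>L. eval_poly (($) x) p = 0)" for L
  proof
    assume h: "\<forall>p\<in>S. \<forall>x\<in>L. eval_poly (($) x) p = 0"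
    have "ideal.subspace {p. \<forall>x\<in>L. eval_poly (($) x) p = 0}"
      by (rule ideal.subspaceI) auto
    then have "ideal_generated S \<subseteq> {p. \<forall>x\<in>L. eval_poly (($) x) p = 0}"
      unfolding ideal_generated_def using h by (intro ideal.span_minimal) auto
    then show "\<forall>p\<in>ideal_generated S. \<forall>x\<in>L. eval_poly (($) x) p = 0" by blast
  qed (auto simp: ideal_generated_def intro: ideal.span_base)
  then show ?thesis by (simp add: proj_zeros_def)
qed

section \<open>Zariski-closed sets and irreducible components\<close>

lemma zariski_closed_Un:
  assumes "zariski_closed A" "zariski_closed B"
  shows "zariski_closed (A \<union> B)"
proof -
  obtain S T where S: "\<forall>p\<in>S. \<exists>d. homogeneous d p" "A = proj_zeros S"
    and T: "\<forall>p\<in>T. \<exists>d. homogeneous d p" "B = proj_zeros T"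
    using assms unfolding zariski_closed_def by blast
  let ?U = "{p * q | p q. p \<in> S \<and> q \<in> T}"
  have U: "\<exists>d. homogeneous d r" if "r \<in> ?U" for r
    using that S(1) T(1) homogeneous_mult by blast
  have "L \<in> A \<union> B \<longleftrightarrow> L \<in> proj_zeros ?U" for L
  proof (cases "L \<in> proj_space")
    case True
    then obtain x where x: "x \<noteq> 0" "L = proj_line x" by (rule proj_spaceE)
    have "L \<in> A \<longleftrightarrow> (\<forall>p\<in>S. eval_poly (($) x) p = 0)" "L \<in> B \<longleftrightarrow> (\<forall>p\<in>T. eval_poly (($) x) p = 0)"
      "L \<in> proj_zeros ?U \<longleftrightarrow> (\<forall>r\<in>?U. eval_poly (($) x) r = 0)"
      unfolding x(2) S(2) T(2) using S(1) T(1) U x(1) by (intro proj_zeros_line_iff; blast)+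
    moreover have "(\<forall>r\<in>?U. eval_poly (($) x) r = 0) \<longleftrightarrow> (\<forall>p\<in>S. \<forall>q\<in>T. eval_poly (($) x) (p * q) = 0)" by blast
    ultimately show ?thesis unfolding eval_poly_mult by auto
  qed (auto simp: S(2) T(2) proj_zeros_def)
  then have "A \<union> B = proj_zeros ?U" by blast
  then show ?thesis unfolding zariski_closed_def using U by blast
qed

lemma zariski_closed_empty: "zariski_closed ({} :: (complex, 'a::finite) vec set set)"
  unfolding zariski_closed_def
proof (intro exI conjI)
  show "\<forall>p\<in>{single 0 1 :: 'a cpoly}. \<exists>d. homogeneous d p" by (auto simp: homogeneous_def)
  show "{} = proj_zeros {single 0 1 :: 'a cpoly}"
    using proj_line_self by (auto simp: proj_zeros_def proj_space_def)
qed

lemma zariski_closed_Union: "finite \<A> \<Longrightarrow> (\<And>A. A \<in> \<A> \<Longrightarrow> zariski_closed A) \<Longrightarrow> zariski_closed (\<Union>\<A>)"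
  by (induction \<A> rule: finite_induct) (auto simp: zariski_closed_empty zariski_closed_Un)

lemma zariski_irreducible_Union:
  assumes "finite \<A>" "\<And>A. A \<in> \<A> \<Longrightarrow> zariski_closed A" "zariski_irreducible Z" "Z \<subseteq> \<Union>\<A>"
  shows "\<exists>A\<in>\<A>. Z \<subseteq> A"
  using assms
proof (induction \<A> rule: finite_induct)
  case empty
  then show ?case by (auto simp: zariski_irreducible_def)
next
  case (insert A \<A>)
  then have "Z \<subseteq> A \<or> Z \<subseteq> \<Union>\<A>"
    using zariski_closed_Union[of \<A>] unfolding zariski_irreducible_def by simp
  then show ?case using insert by auto
qed

lemma irreducible_components_Union:
  assumes "finite \<A>" "\<And>A. A \<in> \<A> \<Longrightarrow> zariski_closed A" "\<And>A. A \<in> \<A> \<Longrightarrow> zariski_irreducible A"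
    and anti: "\<And>A B. A \<in> \<A> \<Longrightarrow> B \<in> \<A> \<Longrightarrow> A \<subseteq> B \<Longrightarrow> A = B"
  shows "irreducible_components (\<Union>\<A>) = \<A>"
proof
  show "irreducible_components (\<Union>\<A>) \<subseteq> \<A>"
  proof
    fix Z assume "Z \<in> irreducible_components (\<Union>\<A>)"
    then have Z: "Z \<subseteq> \<Union>\<A>" "zariski_irreducible Z"
      "\<And>Z'. Z' \<subseteq> \<Union>\<A> \<Longrightarrow> zariski_irreducible Z' \<Longrightarrow> Z \<subseteq> Z' \<Longrightarrow> Z' = Z"
      unfolding irreducible_components_def by blast+
    obtain A where "A \<in> \<A>" "Z \<subseteq> A" using zariski_irreducible_Union[OF assms(1,2) Z(2,1)] by blast
    then show "Z \<in> \<A>" using Z(3)[of A] assms(3) by blast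
  qed
  show "\<A> \<subseteq> irreducible_components (\<Union>\<A>)"
  proof
    fix A assume A: "A \<in> \<A>"
    have "Z' = A" if h: "Z' \<subseteq> \<Union>\<A>" "zariski_irreducible Z'" "A \<subseteq> Z'" for Z'
    proof -
      obtain B where "B \<in> \<A>" "Z' \<subseteq> B" using zariski_irreducible_Union[OF assms(1,2) h(2,1)] by blast
      then show ?thesis using anti[OF A, of B] h(3) by blast
    qed
    then show "A \<in> irreducible_components (\<Union>\<A>)"
      unfolding irreducible_components_def using A assms(3) by blast
  qed
qed

section \<open>Hibi varieties\<close>

definition hibi_point :: "'a::{finite,lattice} set \<Rightarrow> (complex, 'a) vec \<Rightarrow> bool" where
  "hibi_point M x \<longleftrightarrow> (\<forall>c. c \<notin> M \<longrightarrow> x $ c = 0) \<and> (\<forall>a\<in>M. \<forall>b\<in>M. x $ a * x $ b = x $ sup a b * x $ inf a b)"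

lemma hibi_variety_gens_homogeneous:
  assumes "p \<in> {var c | c. c \<notin> M} \<union> {hibi_binomial a b | a b. a \<in> M \<and> b \<in> M}"
  shows "\<exists>d. homogeneous d (p :: 'a::{finite,lattice} cpoly)"
  using assms homogeneous_var homogeneous_hibi_binomial by blast

lemma hibi_variety_closed: "zariski_closed (hibi_variety M)"
  unfolding zariski_closed_def hibi_variety_def using hibi_variety_gens_homogeneous by blast

lemma hibi_variety_line_iff: "x \<noteq> 0 \<Longrightarrow> proj_line x \<in> hibi_variety M \<longleftrightarrow> hibi_point M x"
proof -
  assume x: "x \<noteq> 0"
  let ?G = "{var c | c. c \<notin> M} \<union> {hibi_binomial a b | a b. a \<in> M \<and> b \<in> M}"
  have "proj_line x \<in> proj_zeros ?G \<longleftrightarrow> (\<forall>p\<in>?G. eval_poly (($) x) p = 0)"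
    by (rule proj_zeros_line_iff[OF hibi_variety_gens_homogeneous x])
  also have "\<dots> \<longleftrightarrow> (\<forall>c. c \<notin> M \<longrightarrow> eval_poly (($) x) (var c) = 0) \<and>
      (\<forall>a\<in>M. \<forall>b\<in>M. eval_poly (($) x) (hibi_binomial a b) = 0)" by blast
  also have "\<dots> \<longleftrightarrow> hibi_point M x" by (simp add: hibi_point_def)
  finally show ?thesis unfolding hibi_variety_def .
qed

lemma hibi_varietyE:
  assumes "L \<in> hibi_variety M"
  obtains x where "x \<noteq> 0" "L = proj_line x" "hibi_point M x"
proof -
  have "L \<in> proj_space" using assms by (simp add: hibi_variety_def proj_zeros_def)
  then obtain x where "x \<noteq> 0" "L = proj_line x" by (rule proj_spaceE)
  then show thesis using assms that hibi_variety_line_iff by blast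
qed

lemma initial_gens_homogeneous: "p \<in> initial_gens w \<Longrightarrow> \<exists>d. homogeneous d p"
  unfolding initial_gens_def
  using homogeneous_hibi_binomial homogeneous_mult[OF homogeneous_var homogeneous_var] by blast

lemma initial_zeros_line_iff:
  assumes "x \<noteq> 0"
  shows "proj_line x \<in> proj_zeros (initial_gens w) \<longleftrightarrow>
    (\<forall>a b. x $ a * x $ b = (if modular_pair w a b then x $ sup a b * x $ inf a b else 0))"
proof -
  have "proj_line x \<in> proj_zeros (initial_gens w) \<longleftrightarrow> (\<forall>p\<in>initial_gens w. eval_poly (($) x) p = 0)"
    by (rule proj_zeros_line_iff[OF initial_gens_homogeneous assms])
  also have "\<dots> \<longleftrightarrow> (\<forall>a b. (modular_pair w a b \<longrightarrow> eval_poly (($) x) (hibi_binomial a b) = 0) \<and>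
      (\<not> modular_pair w a b \<longrightarrow> eval_poly (($) x) (var a * var b) = 0))"
    unfolding initial_gens_def by blast
  also have "\<dots> \<longleftrightarrow> (\<forall>a b. x $ a * x $ b = (if modular_pair w a b then x $ sup a b * x $ inf a b else 0))"
    by simp
  finally show ?thesis .
qed

theorem proj_zeros_initial_ideal:
  assumes w: "supermodular w"
  shows "proj_zeros (initial_ideal w hibi_ideal) = \<Union>{hibi_variety M | M. cell w M}"
  unfolding initial_ideal_hibi[OF w] proj_zeros_ideal_generated
proof (intro equalityI subsetI)
  fix L assume L: "L \<in> proj_zeros (initial_gens w)"
  then have "L \<in> proj_space" by (simp add: proj_zeros_def)
  then obtain x where x: "x \<noteq> 0" "L = proj_line x" by (rule proj_spaceE)
  have eq: "x $ a * x $ b = (if modular_pair w a b then x $ sup a b * x $ inf a b else 0)" for a b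
    using L initial_zeros_line_iff[OF x(1)] unfolding x(2) by blast
  define N where "N = {a. x $ a \<noteq> 0}"
  have mp: "modular_pair w a b" if "a \<in> N" "b \<in> N" for a b
    using eq[of a b] that by (auto simp: N_def split: if_splits)
  have "sublattice N"
    unfolding sublattice_def
  proof (intro ballI)
    fix a b assume "a \<in> N" "b \<in> N"
    then show "sup a b \<in> N \<and> inf a b \<in> N" using eq[of a b] mp[of a b] by (auto simp: N_def)
  qed
  then obtain M where M: "cell w M" "N \<subseteq> M" using modular_sublattice_in_cell[OF w _ mp] by blast
  have "hibi_point M x"
    using M(2) eq cell_modular_pair[OF M(1) w] unfolding hibi_point_def N_def by auto
  then have "L \<in> hibi_variety M" using x hibi_variety_line_iff by blast
  with M(1) show "L \<in> \<Union>{hibi_variety M | M. cell w M}" by blast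
next
  fix L assume "L \<in> \<Union>{hibi_variety M | M. cell w M}"
  then obtain M where M: "cell w M" "L \<in> hibi_variety M" by blast
  obtain x where x: "x \<noteq> 0" "L = proj_line x" "hibi_point M x" using M(2) by (rule hibi_varietyE)
  have "x $ a * x $ b = (if modular_pair w a b then x $ sup a b * x $ inf a b else 0)" for a b
  proof (cases "modular_pair w a b")
    case True
    \<comment> \<open>A modular pair not contained in \<open>M\<close> has its join or its meet
      outside \<open>M\<close> as well, so both products vanish.\<close>
    then show ?thesis using cell_modular_iff[OF M(1) True] x(3) unfolding hibi_point_def by force
  next
    case False
    then have "\<not> (a \<in> M \<and> b \<in> M)" using cell_modular_pair[OF M(1) w] by blast
    then show ?thesis using False x(3) unfolding hibi_point_def by auto
  qed
  then show "L \<in> proj_zeros (initial_gens w)" using initial_zeros_line_iff[OF x(1)] x(2) by blast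
qed

subsection \<open>The dense torus\<close>

text \<open>The parameter s of the toric parametrization is omitted: it only rescales the vector and
  is invisible on projective lines.\<close>

definition torus_char :: "('a::{finite,lattice} \<Rightarrow> complex) \<Rightarrow> 'a \<Rightarrow> complex" where
  "torus_char t a = (\<Prod>p\<in>birkhoff a. t p)"

definition torus_point :: "'a::{finite,lattice} set \<Rightarrow> ('a \<Rightarrow> complex) \<Rightarrow> (complex, 'a) vec" where
  "torus_point M t = (\<chi> a. if a \<in> M then torus_char t a else 0)"

lemma torus_char_modular:
  "torus_char t a * torus_char t b = torus_char t (sup a b) * torus_char t (inf a (b::'a::{finite,distrib_lattice}))"
  unfolding torus_char_def birkhoff_sup birkhoff_inf by (rule prod.union_inter[symmetric]) auto

lemma torus_char_mult: "torus_char (\<lambda>p. s p * t p) a = torus_char s a * torus_char t a"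
  by (simp add: torus_char_def prod.distrib)

lemma hibi_point_torus:
  assumes "sublattice (M :: 'a::{finite,distrib_lattice} set)"
  shows "hibi_point M (torus_point M t)"
  using assms torus_char_modular[of t] by (auto simp: hibi_point_def torus_point_def sublattice_def)

text \<open>Dedekind's argument: translating by a suitable \<open>s\<close> and subtracting a
  multiple of the original relation removes \<open>\<tau>0\<close>, while the chosen
  \<open>\<sigma>\<close> keeps a nonzero factor.\<close>

lemma characters_independent:
  fixes T :: "('a::finite \<Rightarrow> nat) set" and C :: "('a \<Rightarrow> nat) \<Rightarrow> complex"
  assumes "finite T" "\<And>t. (\<And>p. t p \<noteq> 0) \<Longrightarrow> (\<Sum>\<tau>\<in>T. C \<tau> * (\<Prod>p\<in>UNIV. t p ^ \<tau> p)) = 0"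
  shows "\<forall>\<tau>\<in>T. C \<tau> = 0"
  using assms
proof (induction T arbitrary: C rule: finite_induct)
  case (insert \<tau>0 T)
  let ?c = "\<lambda>\<tau> (t :: 'a \<Rightarrow> complex). \<Prod>p\<in>UNIV. t p ^ \<tau> p"
  have zero: "C \<sigma> = 0" if s: "\<sigma> \<in> T" for \<sigma>
  proof -
    have "\<sigma> \<noteq> \<tau>0" using s insert.hyps by auto
    then obtain p where p: "\<sigma> p \<noteq> \<tau>0 p" by auto
    \<comment> \<open>The number 2 is not a root of unity, so the different exponents at
      \<open>p\<close> give different factors.\<close>
    define s :: "'a \<Rightarrow> complex" where "s = (\<lambda>q. if q = p then 2 else 1)"
    have s0: "s q \<noteq> 0" for q by (simp add: s_def)
    have cs: "?c \<tau> s = 2 ^ \<tau> p" for \<tau>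
    proof -
      have "?c \<tau> s = (\<Prod>q\<in>UNIV. if q = p then 2 ^ \<tau> p else 1)" by (rule prod.cong) (auto simp: s_def)
      then show ?thesis by simp
    qed
    have "\<forall>\<tau>\<in>T. C \<tau> * (?c \<tau> s - ?c \<tau>0 s) = 0"
    proof (rule insert.IH)
      fix t :: "'a \<Rightarrow> complex" assume t: "\<And>p. t p \<noteq> 0"
      have e1: "(\<Sum>\<tau>\<in>insert \<tau>0 T. C \<tau> * ?c \<tau> (\<lambda>p. s p * t p)) = 0"
        by (rule insert.prems) (use s0 t in auto)
      have e2: "(\<Sum>\<tau>\<in>insert \<tau>0 T. C \<tau> * ?c \<tau> t) = 0"
        by (rule insert.prems) (use t in auto)
      have "(\<Sum>\<tau>\<in>T. C \<tau> * (?c \<tau> s - ?c \<tau>0 s) * ?c \<tau> t) = (\<Sum>\<tau>\<in>insert \<tau>0 T. C \<tau> * (?c \<tau> s - ?c \<tau>0 s) * ?c \<tau> t)"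
        using insert.hyps by simp
      also have "\<dots> = (\<Sum>\<tau>\<in>insert \<tau>0 T. C \<tau> * ?c \<tau> (\<lambda>p. s p * t p)) - ?c \<tau>0 s * (\<Sum>\<tau>\<in>insert \<tau>0 T. C \<tau> * ?c \<tau> t)"
        unfolding sum_distrib_left sum_subtractf[symmetric]
        by (rule sum.cong) (simp_all add: power_mult_distrib prod.distrib algebra_simps)
      also have "\<dots> = 0" using e1 e2 by simp
      finally show "(\<Sum>\<tau>\<in>T. C \<tau> * (?c \<tau> s - ?c \<tau>0 s) * ?c \<tau> t) = 0" .
    qed
    then have "C \<sigma> * (2 ^ \<sigma> p - 2 ^ \<tau>0 p) = 0" using s cs by metis
    moreover have "(2::complex) ^ \<sigma> p \<noteq> 2 ^ \<tau>0 p"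
    proof
      assume "(2::complex) ^ \<sigma> p = 2 ^ \<tau>0 p"
      then have "(of_nat (2 ^ \<sigma> p) :: complex) = of_nat (2 ^ \<tau>0 p)" by simp
      then have "(2::nat) ^ \<sigma> p = 2 ^ \<tau>0 p" by (simp only: of_nat_eq_iff)
      then show False using p by simp
    qed
    ultimately show ?thesis by simp
  qed
  moreover have "(\<Sum>\<tau>\<in>insert \<tau>0 T. C \<tau> * ?c \<tau> (\<lambda>_. 1)) = 0" by (rule insert.prems) simp
  then have "C \<tau>0 = 0" using zero insert.hyps by simp
  ultimately show ?case by simp
qed simp

lemma hibi_point_straighten:
  assumes "hibi_point M x" "(straighten M)\<^sup>*\<^sup>* m n"
  shows "monom_eval (($) x) m = monom_eval (($) x) n"
  using assms(2)
proof (induction rule: rtranclp_induct)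
  case (step n n')
  from step(2) have "monom_eval (($) x) n = monom_eval (($) x) n'"
  proof (cases rule: straighten.cases)
    case (1 a b k)
    then show ?thesis using assms(1) by (simp add: monom_eval_add hibi_point_def mult.assoc)
  qed
  with step show ?case by simp
qed simp

lemma monom_eval_torus_point:
  fixes m :: "'a::{finite,distrib_lattice} monom"
  assumes "keys m \<subseteq> M"
  shows "monom_eval (($) (torus_point M t)) m = (\<Prod>p\<in>UNIV. t p ^ snd (multidegree m) p)"
proof -
  have "monom_eval (($) (torus_point M t)) m = (\<Prod>a\<in>keys m. torus_char t a ^ lookup m a)"
    unfolding monom_eval_def using assms by (intro prod.cong) (auto simp: torus_point_def)
  also have "\<dots> = (\<Prod>a\<in>UNIV. torus_char t a ^ lookup m a)"
    by (rule prod.mono_neutral_left) (auto simp: in_keys_iff)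
  also have "\<dots> = (\<Prod>a\<in>UNIV. \<Prod>p\<in>UNIV. t p ^ (lookup m a * of_bool (p \<in> birkhoff a)))"
  proof (rule prod.cong[OF refl])
    fix a
    have "torus_char t a = (\<Prod>p\<in>UNIV. t p ^ of_bool (p \<in> birkhoff a))"
      unfolding torus_char_def by (rule prod.mono_neutral_cong_left) auto
    then show "torus_char t a ^ lookup m a = (\<Prod>p\<in>UNIV. t p ^ (lookup m a * of_bool (p \<in> birkhoff a)))"
      by (simp add: prod_power_distrib flip: power_mult add: mult.commute)
  qed
  also have "\<dots> = (\<Prod>p\<in>UNIV. \<Prod>a\<in>UNIV. t p ^ (lookup m a * of_bool (p \<in> birkhoff a)))"
    by (rule prod.swap)
  also have "\<dots> = (\<Prod>p\<in>UNIV. t p ^ snd (multidegree m) p)"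
  proof (rule prod.cong[OF refl])
    fix p
    have "snd (multidegree m) p = (\<Sum>a\<in>UNIV. lookup m a * of_bool (p \<in> birkhoff a))"
      by (simp add: multidegree_def msum_def birkhoff_def)
    then show "(\<Prod>a\<in>UNIV. t p ^ (lookup m a * of_bool (p \<in> birkhoff a))) = t p ^ snd (multidegree m) p"
      by (simp only: power_sum)
  qed
  finally show ?thesis .
qed

text \<open>The relations of the Hibi variety identify monomials of equal multidegree, and the sum of the coefficients
  of a fixed multidegree is the coefficient of a character of the torus.\<close>

lemma torus_dense:
  fixes M :: "'a::{finite,distrib_lattice} set"
  assumes M: "sublattice M" and f: "homogeneous d f"
    and zero: "\<And>t. (\<And>p. t p \<noteq> 0) \<Longrightarrow> eval_poly (($) (torus_point M t)) f = 0"
    and x: "hibi_point M x"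
  shows "eval_poly (($) x) f = 0"
proof -
  define A where "A = {m\<in>keys f. keys m \<subseteq> M}"
  define \<sigma> where "\<sigma> = (\<lambda>m :: 'a monom. snd (multidegree m))"
  have fin: "finite A" by (simp add: A_def)
  have restrict: "eval_poly (($) y) f = (\<Sum>m\<in>A. lookup f m * monom_eval (($) y) m)" if y: "hibi_point M y" for y
    unfolding eval_poly_linext linext_def
  proof (rule sum.mono_neutral_right)
    show "\<forall>m\<in>keys f - A. lookup f m * monom_eval (($) y) m = 0"
    proof
      fix m assume "m \<in> keys f - A"
      then obtain a where "a \<in> keys m" "a \<notin> M" by (auto simp: A_def)
      then have "y $ a ^ lookup m a = 0" using y by (simp add: hibi_point_def in_keys_iff)
      then have "monom_eval (($) y) m = 0" unfolding monom_eval_def using \<open>a \<in> keys m\<close> by (intro prod_zero) auto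
      then show "lookup f m * monom_eval (($) y) m = 0" by simp
    qed
  qed (auto simp: A_def)
  \<comment> \<open>Homogeneity fixes the degree component, so the exponents of the torus
    coordinates alone determine the multidegree.\<close>
  have multidegree_eq: "multidegree m = multidegree n" if "m \<in> A" "n \<in> A" "\<sigma> m = \<sigma> n" for m n
  proof -
    have "fst (multidegree m) = d" if "m \<in> A" for m using f that by (simp add: A_def homogeneous_def multidegree_def msum_def)
    then show ?thesis using that by (simp add: \<sigma>_def prod_eq_iff)
  qed
  define C where "C = (\<lambda>\<tau>. \<Sum>m | m \<in> A \<and> \<sigma> m = \<tau>. lookup f m)"
  have C0: "\<forall>\<tau>\<in>\<sigma> ` A. C \<tau> = 0"
  proof (rule characters_independent)
    fix t :: "'a \<Rightarrow> complex" assume t: "\<And>p. t p \<noteq> 0"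
    have "0 = (\<Sum>m\<in>A. lookup f m * monom_eval (($) (torus_point M t)) m)"
      using zero[of t, OF t] restrict[OF hibi_point_torus[OF M, of t]] by simp
    also have "\<dots> = (\<Sum>m\<in>A. lookup f m * (\<Prod>p\<in>UNIV. t p ^ \<sigma> m p))"
      unfolding \<sigma>_def by (rule sum.cong) (auto simp: A_def monom_eval_torus_point)
    also have "\<dots> = (\<Sum>\<tau>\<in>\<sigma> ` A. \<Sum>m | m \<in> A \<and> \<sigma> m = \<tau>. lookup f m * (\<Prod>p\<in>UNIV. t p ^ \<sigma> m p))"
      by (rule sum.image_gen[OF fin])
    also have "\<dots> = (\<Sum>\<tau>\<in>\<sigma> ` A. C \<tau> * (\<Prod>p\<in>UNIV. t p ^ \<tau> p))"
      unfolding C_def sum_distrib_right by (intro sum.cong) auto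
    finally show "(\<Sum>\<tau>\<in>\<sigma> ` A. C \<tau> * (\<Prod>p\<in>UNIV. t p ^ \<tau> p)) = 0" by simp
  qed (simp add: fin)
  have E: "eval_poly (($) x) f = (\<Sum>\<tau>\<in>\<sigma> ` A. \<Sum>m | m \<in> A \<and> \<sigma> m = \<tau>. lookup f m * monom_eval (($) x) m)"
    unfolding restrict[OF x] by (rule sum.image_gen[OF fin])
  have Z: "(\<Sum>m | m \<in> A \<and> \<sigma> m = \<tau>. lookup f m * monom_eval (($) x) m) = 0" if \<tau>: "\<tau> \<in> \<sigma> ` A" "C \<tau> = 0" for \<tau>
  proof -
    obtain n where n: "n \<in> A" "\<tau> = \<sigma> n" using \<tau>(1) by auto
    have st: "monom_eval (($) x) m = monom_eval (($) x) (chain_form m)" if "m \<in> A" for m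
      by (rule hibi_point_straighten[OF x straighten_chain_form(1)[OF M]]) (use that in \<open>auto simp: A_def\<close>)
    have "monom_eval (($) x) m = monom_eval (($) x) n" if "m \<in> A" "\<sigma> m = \<tau>" for m
      using st[OF that(1)] st[OF n(1)] chain_form_cong[OF multidegree_eq[OF that(1) n(1)]] that n by simp
    then have "(\<Sum>m | m \<in> A \<and> \<sigma> m = \<tau>. lookup f m * monom_eval (($) x) m) = C \<tau> * monom_eval (($) x) n"
      unfolding C_def sum_distrib_right by (intro sum.cong) auto
    then show ?thesis using \<tau>(2) by simp
  qed
  show ?thesis unfolding E using C0 Z by (intro sum.neutral) blast
qed

context separating_sublattice
begin

lemma least_in_sublattice: obtains z where "z \<in> M" "birkhoff z = {}" "\<And>t. torus_char t z = 1"
  using exists_bottom unfolding torus_char_def by (metis prod.empty)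

lemma torus_point_nonzero: "torus_point M t \<noteq> 0"
proof -
  obtain z where "z \<in> M" "torus_char t z = 1" using least_in_sublattice by metis
  then have "torus_point M t $ z \<noteq> 0 $ z" by (simp add: torus_point_def)
  then show ?thesis by metis
qed

lemma torus_point_in_hibi_variety: "proj_line (torus_point M t) \<in> hibi_variety M"
  using hibi_variety_line_iff[OF torus_point_nonzero] hibi_point_torus[OF sublattice] by blast

text \<open>Density is condensed into one polynomial whose nonvanishing at a torus point keeps that
  point out of \<open>A\<close>; nonvanishing of two such polynomials can then be arranged along a
  curve.\<close>

lemma hibi_variety_not_subset_imp_torus:
  assumes "zariski_closed A" "\<not> hibi_variety M \<subseteq> A"
  shows "\<exists>f t. (\<forall>p. t p \<noteq> 0) \<and> eval_poly (($) (torus_point M t)) f \<noteq> 0 \<and>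
    (\<forall>t. eval_poly (($) (torus_point M t)) f \<noteq> 0 \<longrightarrow> proj_line (torus_point M t) \<notin> A)"
proof -
  obtain S where S: "\<forall>p\<in>S. \<exists>d. homogeneous d p" "A = proj_zeros S"
    using assms(1) unfolding zariski_closed_def by blast
  then have zeros_iff: "proj_line x \<in> A \<longleftrightarrow> (\<forall>p\<in>S. eval_poly (($) x) p = 0)" if "x \<noteq> 0" for x
    using that proj_zeros_line_iff[of S x] by blast
  obtain L where L: "L \<in> hibi_variety M" "L \<notin> A" using assms(2) by blast
  obtain x where x: "x \<noteq> 0" "L = proj_line x" "hibi_point M x" using L(1) by (rule hibi_varietyE)
  obtain f where f: "f \<in> S" "eval_poly (($) x) f \<noteq> 0" using L(2) x zeros_iff by blast
  obtain d where d: "homogeneous d f" using S f by blast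
  have "\<not> (\<forall>t. (\<forall>p. t p \<noteq> 0) \<longrightarrow> eval_poly (($) (torus_point M t)) f = 0)"
    using torus_dense[OF sublattice d _ x(3)] f(2) by blast
  then obtain t where t: "\<And>p. t p \<noteq> 0" "eval_poly (($) (torus_point M t)) f \<noteq> 0" by blast
  then show ?thesis using zeros_iff[OF torus_point_nonzero] f(1) by blast
qed

text \<open>Two points of the torus lie on a rational curve, along which nonvanishing is an open condition.\<close>

lemma hibi_variety_irreducible: "zariski_irreducible (hibi_variety M)"
  unfolding zariski_irreducible_def
proof (intro conjI allI impI)
  show "hibi_variety M \<noteq> {}" using torus_point_in_hibi_variety by blast
  fix A B :: "(complex, 'a) vec set set"
  assume AB: "zariski_closed A \<and> zariski_closed B \<and> hibi_variety M \<subseteq> A \<union> B"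
  show "hibi_variety M \<subseteq> A \<or> hibi_variety M \<subseteq> B"
  proof (rule ccontr)
    assume "\<not> ?thesis"
    then have nA: "\<not> hibi_variety M \<subseteq> A" and nB: "\<not> hibi_variety M \<subseteq> B" by auto
    obtain f s where f: "\<forall>p. s p \<noteq> 0" "eval_poly (($) (torus_point M s)) f \<noteq> 0"
      "\<forall>t. eval_poly (($) (torus_point M t)) f \<noteq> 0 \<longrightarrow> proj_line (torus_point M t) \<notin> A"
      using hibi_variety_not_subset_imp_torus[OF conjunct1[OF AB] nA] by blast
    obtain g u where g: "\<forall>p. u p \<noteq> 0" "eval_poly (($) (torus_point M u)) g \<noteq> 0"
      "\<forall>t. eval_poly (($) (torus_point M t)) g \<noteq> 0 \<longrightarrow> proj_line (torus_point M t) \<notin> B"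
      using hibi_variety_not_subset_imp_torus[OF conjunct1[OF conjunct2[OF AB]] nB] by blast
    \<comment> \<open>The line may leave the torus at some \<open>z\<close>; this is harmless, as
      \<open>torus_point\<close> gives a point of the Hibi variety even for vanishing
      coordinates.\<close>
    define \<gamma> where "\<gamma> = (\<lambda>z p. (1 - z) * s p + z * u p)"
    have poly_ex: "\<exists>F. \<forall>z. poly F z = eval_poly (($) (torus_point M (\<gamma> z))) h" for h
    proof (induction h rule: cpoly_induct)
      case zero
      then show ?case by (intro exI[of _ 0]) simp
    next
      case (add p q)
      then obtain F G where "\<forall>z. poly F z = eval_poly (($) (torus_point M (\<gamma> z))) p"
        "\<forall>z. poly G z = eval_poly (($) (torus_point M (\<gamma> z))) q" by blast
      then show ?case by (intro exI[of _ "F + G"]) simp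
    next
      case (monom m c)
      define H where "H = (\<lambda>a. if a \<in> M then \<Prod>p\<in>birkhoff a. [:s p, u p - s p:] else 0)"
      have H: "poly (H a) z = torus_point M (\<gamma> z) $ a" for a z
        by (auto simp: H_def torus_point_def torus_char_def poly_prod \<gamma>_def algebra_simps)
      show ?case
        by (intro exI[of _ "smult c (\<Prod>a\<in>keys m. H a ^ lookup m a)"])
          (simp add: poly_prod H monom_eval_def)
    qed
    obtain F where F: "\<And>z. poly F z = eval_poly (($) (torus_point M (\<gamma> z))) f" using poly_ex by blast
    obtain G where G: "\<And>z. poly G z = eval_poly (($) (torus_point M (\<gamma> z))) g" using poly_ex by blast
    have "\<gamma> 0 = s" "\<gamma> 1 = u" by (auto simp: \<gamma>_def)
    then have "poly F 0 \<noteq> 0" "poly G 1 \<noteq> 0" using F f(2) G g(2) by auto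
    then have "F * G \<noteq> 0" by auto
    then have "finite {z. poly (F * G) z = 0}" by (rule poly_roots_finite)
    then obtain z where "poly (F * G) z \<noteq> 0"
      using infinite_UNIV_char_0[where 'a = complex] by (metis (mono_tags) UNIV_eq_I mem_Collect_eq)
    then have "proj_line (torus_point M (\<gamma> z)) \<notin> A \<union> B" using f(3) g(3) F G by auto
    then show False using AB torus_point_in_hibi_variety by blast
  qed
qed

section \<open>Torus coordinates on Hibi varieties\<close>

lemma order_ideal_in_sublattice:
  assumes sub: "S \<subseteq> jirr" and down: "\<And>x q. q \<in> S \<Longrightarrow> (x, q) \<in> order_of M \<Longrightarrow> x \<in> S"
  obtains a where "a \<in> M" "birkhoff a = S"
proof -
  obtain a where a: "birkhoff a = S"
  proof (rule birkhoff_surj[OF sub])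
    fix x q assume "q \<in> S" "x \<in> jirr" "x \<le> q"
    moreover from this have "(x, q) \<in> order_of M"
      using jirr_order_subset_order_of[of M] sub by (auto simp: jirr_order_def)
    ultimately show "x \<in> S" using down by blast
  qed
  have "birkhoff a \<in> order_ideals (order_of M)"
    unfolding a order_ideals_def mem_Collect_eq using sub down by blast
  then have "a \<in> M" using sublattice_of_order_of by (auto simp: sublattice_of_order_def)
  then show thesis using a that by blast
qed

lemma exists_covers:
  assumes "p \<in> jirr"
  obtains a b where "a \<in> M" "b \<in> M" "birkhoff a = {q. (q, p) \<in> order_of M}" "birkhoff b = {q. (q, p) \<in> order_of M} - {p}"
proof -
  obtain a where a: "a \<in> M" "birkhoff a = {q. (q, p) \<in> order_of M}" using exists_least_above[OF assms] .
  let ?S = "{q. (q, p) \<in> order_of M} - {p}"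
  have tr: "trans (order_of M)" and an: "antisym (order_of M)"
    using partial_order by (auto simp: partial_order_on_def preorder_on_def)
  have down: "x \<in> ?S" if "q \<in> ?S" "(x, q) \<in> order_of M" for x q
    using that transD[OF tr, of x q p] antisymD[OF an, of q p] by blast
  have "?S \<subseteq> jirr" by (auto simp: order_of_def)
  then obtain b where "b \<in> M" and b: "birkhoff b = ?S" using down by (rule order_ideal_in_sublattice)
  then show thesis using a b that by blast
qed

text \<open>The two covers differ exactly by \<open>p\<close>, so that the torus coordinate \<open>t p\<close> is the quotient of their coordinates.\<close>

definition upper_cover where "upper_cover p = (SOME a. a \<in> M \<and> birkhoff a = {q. (q, p) \<in> order_of M})"
definition lower_cover where "lower_cover p = (SOME b. b \<in> M \<and> birkhoff b = {q. (q, p) \<in> order_of M} - {p})"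

lemma covers:
  assumes "p \<in> jirr"
  shows "upper_cover p \<in> M" "birkhoff (upper_cover p) = {q. (q, p) \<in> order_of M}"
    "lower_cover p \<in> M" "birkhoff (lower_cover p) = {q. (q, p) \<in> order_of M} - {p}"
proof -
  obtain a b where ab: "a \<in> M \<and> birkhoff a = {q. (q, p) \<in> order_of M}" "b \<in> M \<and> birkhoff b = {q. (q, p) \<in> order_of M} - {p}"
    using exists_covers[OF assms] by metis
  show "upper_cover p \<in> M" "birkhoff (upper_cover p) = {q. (q, p) \<in> order_of M}"
    using someI[where P = "\<lambda>a. a \<in> M \<and> birkhoff a = {q. (q, p) \<in> order_of M}", OF ab(1)] unfolding upper_cover_def by auto
  show "lower_cover p \<in> M" "birkhoff (lower_cover p) = {q. (q, p) \<in> order_of M} - {p}"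
    using someI[where P = "\<lambda>b. b \<in> M \<and> birkhoff b = {q. (q, p) \<in> order_of M} - {p}", OF ab(2)] unfolding lower_cover_def by auto
qed

lemma torus_char_cover:
  assumes "p \<in> jirr"
  shows "torus_char t (upper_cover p) = t p * torus_char t (lower_cover p)"
proof -
  have "p \<in> birkhoff (upper_cover p)" using covers(2)[OF assms] assms by (simp add: order_of_def)
  then show ?thesis
    unfolding torus_char_def covers(2)[OF assms] covers(4)[OF assms] by (subst prod.remove[of _ p]) auto
qed

lemma torus_char_nonzero: "(\<And>p. p \<in> jirr \<Longrightarrow> t p \<noteq> 0) \<Longrightarrow> torus_char t a \<noteq> (0 :: complex)"
  by (auto simp: torus_char_def birkhoff_def)

text \<open>The removed \<open>p\<close> is maximal in the ideal for \<open>order_of M\<close>. The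
  Hibi relation for \<open>a'\<close> and \<open>upper_cover p\<close> then expresses the coordinate
  at \<open>a\<close> by that at \<open>a'\<close> and the ratio of the coordinates at the two
  covers of \<open>p\<close>.\<close>

lemma remove_maximal:
  assumes "a \<in> M" "birkhoff a \<noteq> {}"
  obtains p a' where "p \<in> birkhoff a" "a' \<in> M" "birkhoff a' = birkhoff a - {p}"
    "a = sup a' (upper_cover p)" "inf a' (upper_cover p) = lower_cover p"
proof -
  let ?r = "order_of M"
  have tr: "trans ?r" and an: "antisym ?r"
    using partial_order by (auto simp: partial_order_on_def preorder_on_def)
  have sub: "birkhoff a \<subseteq> jirr" by (auto simp: birkhoff_def)
  have ideal: "x \<in> birkhoff a" if "q \<in> birkhoff a" "(x, q) \<in> ?r" for x q
    using that assms(1) unfolding birkhoff_def order_of_def by blast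
  \<comment> \<open>The size of the principal ideal grows strictly along \<open>order_of M\<close>,
    so its maximum is attained at a maximal element.\<close>
  define h where "h = (\<lambda>p. card {q. (q, p) \<in> ?r})"
  have "Max (h ` birkhoff a) \<in> h ` birkhoff a" using assms(2) by (intro Max_in) auto
  then obtain p where p: "p \<in> birkhoff a" "h p = Max (h ` birkhoff a)" by auto
  have pj: "p \<in> jirr" using p sub by auto
  have max: "q = p" if "q \<in> birkhoff a" "(p, q) \<in> ?r" for q
  proof (rule ccontr)
    assume "q \<noteq> p"
    then have "(q, p) \<notin> ?r" using antisymD[OF an that(2)] by blast
    moreover have "(q, q) \<in> ?r" using that sub by (auto simp: order_of_def)
    moreover have "{x. (x, p) \<in> ?r} \<subseteq> {x. (x, q) \<in> ?r}" using that transD[OF tr] by blast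
    ultimately have "{x. (x, p) \<in> ?r} \<subset> {x. (x, q) \<in> ?r}" by blast
    then have "h p < h q" unfolding h_def by (intro psubset_card_mono) auto
    moreover have "h q \<le> Max (h ` birkhoff a)" using that by (intro Max_ge) auto
    ultimately show False using p(2) by simp
  qed
  have down: "x \<in> birkhoff a - {p}" if "q \<in> birkhoff a - {p}" "(x, q) \<in> ?r" for x q
    using that ideal max by blast
  have "birkhoff a - {p} \<subseteq> jirr" using sub by auto
  then obtain a' where a'M: "a' \<in> M" and a': "birkhoff a' = birkhoff a - {p}"
    using down by (rule order_ideal_in_sublattice)
  have low: "{q. (q, p) \<in> ?r} \<subseteq> birkhoff a" using ideal p(1) by blast
  have pp: "(p, p) \<in> ?r" using pj by (simp add: order_of_def)
  have "birkhoff a = birkhoff (sup a' (upper_cover p))"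
    unfolding birkhoff_sup a' covers(2)[OF pj] using low pp by blast
  moreover have "birkhoff (inf a' (upper_cover p)) = birkhoff (lower_cover p)"
    unfolding birkhoff_inf a' covers(2)[OF pj] covers(4)[OF pj] using low by blast
  ultimately show thesis using p(1) a'M a' that by simp
qed

text \<open>Removing maximal elements one by one telescopes each coordinate into the bottom
  coordinate times ratios at covers; the bottom coordinate is the constant \<open>c\<close>.\<close>

lemma hibi_point_eq_torus_point:
  assumes x: "hibi_point M x" and nz: "\<And>a. a \<in> M \<Longrightarrow> x $ a \<noteq> 0"
    and t: "\<And>p. p \<in> jirr \<Longrightarrow> t p = x $ upper_cover p / x $ lower_cover p"
  obtains c where "c \<noteq> 0" "x = c *s torus_point M t"
proof -
  obtain z where z: "z \<in> M" "birkhoff z = {}" using exists_bottom .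
  have "x $ a = x $ z * torus_char t a" if "a \<in> M" for a
    using that
  proof (induction "card (birkhoff a)" arbitrary: a rule: less_induct)
    case (less a)
    show ?case
    proof (cases "birkhoff a = {}")
      case True
      then have "a = z" using z by (metis birkhoff_eq_iff)
      then show ?thesis by (simp add: torus_char_def z)
    next
      case False
      obtain p a' where p: "p \<in> birkhoff a" "a' \<in> M" "birkhoff a' = birkhoff a - {p}"
        "a = sup a' (upper_cover p)" "inf a' (upper_cover p) = lower_cover p"
        using remove_maximal[OF less.prems False] .
      have pj: "p \<in> jirr" using p(1) by (simp add: birkhoff_def)
      have eq: "x $ a' * x $ upper_cover p = x $ a * x $ lower_cover p"
        using x covers(1)[OF pj] p unfolding hibi_point_def by metis
      have nzl: "x $ lower_cover p \<noteq> 0" by (rule nz[OF covers(3)[OF pj]])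
      then have "x $ a * x $ lower_cover p = (x $ a' * t p) * x $ lower_cover p" using t[OF pj] eq by simp
      then have "x $ a = x $ a' * t p" using nzl by simp
      also have "x $ a' = x $ z * torus_char t a'"
      proof (rule less.hyps[OF _ p(2)])
        show "card (birkhoff a') < card (birkhoff a)" unfolding p(3) using p(1) by (intro psubset_card_mono) auto
      qed
      also have "x $ z * torus_char t a' * t p = x $ z * torus_char t a"
        unfolding torus_char_def p(3) using p(1) prod.remove[of "birkhoff a" p t] by simp
      finally show ?thesis .
    qed
  qed
  then have "x = x $ z *s torus_point M t"
    using x by (auto simp: vec_eq_iff torus_point_def hibi_point_def)
  then show thesis using nz[OF z(1)] that by blast
qed

theorem hibi_variety_toric: "toric_variety (hibi_variety M)"
proof -
  define n where "n = card (jirr :: 'a set)"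
  \<comment> \<open>An enumeration of the join-irreducibles, which places the torus coordinate of
    \<open>p\<close> at position \<open>e p\<close> below \<open>n\<close>.\<close>
  obtain e where e: "bij_betw e (jirr :: 'a set) {0..<n}"
    using ex_bij_betw_finite_nat[of "jirr :: 'a set"] unfolding n_def by auto
  have e_lt: "p \<in> jirr \<Longrightarrow> e p < n" for p using e by (auto simp: bij_betw_def)
  have e_surj: "\<exists>p\<in>jirr. i = e p" if "i < n" for i
  proof -
    have "i \<in> e ` jirr" using e that by (simp add: bij_betw_def)
    then show ?thesis by blast
  qed
  define pt where "pt = (\<lambda>t :: nat \<Rightarrow> complex. torus_point M (\<lambda>p. t (e p)))"
  define \<phi> where "\<phi> = (\<lambda>t. proj_line (pt t))"
  \<comment> \<open>The zero set of the product of all coordinates in \<open>M\<close>; its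
    complement in the Hibi variety is the torus orbit.\<close>
  define A where "A = proj_zeros {single (\<Sum>a\<in>M. single a (1::nat)) (1::complex)}"
  define U where "U = hibi_variety M - A"
  \<comment> \<open>Each coordinate is scaled by its own character, which turns the parametrization
    into an orbit map.\<close>
  define scal where "scal = (\<lambda>(t :: nat \<Rightarrow> complex) (y :: (complex, 'a) vec). \<chi> a. torus_char (\<lambda>p. t (e p)) a * y $ a)"
  define act where "act = (\<lambda>t L. scal t ` L)"
  have pt0: "pt t \<noteq> 0" for t unfolding pt_def by (rule torus_point_nonzero)
  have homA: "homogeneous (card M) (single (\<Sum>a\<in>M. single a (1::nat)) (1::complex))"
    by (auto simp: homogeneous_def lookup_sum lookup_single when_def sum.If_cases)
  have A_iff: "proj_line x \<in> A \<longleftrightarrow> (\<exists>a\<in>M. x $ a = 0)" if "x \<noteq> 0" for x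
  proof -
    have "proj_line x \<in> A \<longleftrightarrow> (\<forall>p\<in>{single (\<Sum>a\<in>M. single a (1::nat)) (1::complex)}. eval_poly (($) x) p = 0)"
      unfolding A_def by (rule proj_zeros_line_iff) (use homA that in auto)
    then show ?thesis by (simp add: monom_eval_sum)
  qed
  have closedA: "zariski_closed A" unfolding zariski_closed_def A_def using homA by blast
  have tnz: "t (e p) \<noteq> 0" if "t \<in> alg_torus n" "p \<in> jirr" for t p
    using that e_lt by (auto simp: alg_torus_def)
  have char_nz: "torus_char (\<lambda>p. t (e p)) a \<noteq> 0" if "t \<in> alg_torus n" for t a
    by (rule torus_char_nonzero) (rule tnz[OF that])
  have \<phi>U: "\<phi> t \<in> U" if t: "t \<in> alg_torus n" for t
    unfolding U_def \<phi>_def using A_iff[OF pt0] char_nz[OF t] torus_point_in_hibi_variety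
    by (auto simp: pt_def torus_point_def)
  \<comment> \<open>Ratios of coordinates do not depend on the representative of the line; they give
    the inverse of \<open>\<phi>\<close>.\<close>
  have ratio: "x $ upper_cover p / x $ lower_cover p = t (e p)"
    if h: "t \<in> alg_torus n" "x \<in> \<phi> t" "x \<noteq> 0" "p \<in> jirr" for t x p
  proof -
    obtain c where c: "x = c *s pt t" using h(2) proj_line_memD unfolding \<phi>_def by blast
    have "c \<noteq> 0" using c h(3) by auto
    then show ?thesis
      using char_nz[OF h(1), of "lower_cover p"] torus_char_cover[OF h(4), of "\<lambda>p. t (e p)"] covers[OF h(4)]
      by (simp add: c pt_def torus_point_def)
  qed
  have inj: "inj_on \<phi> (alg_torus n)"
  proof (rule inj_onI, rule ext)
    fix s t i assume st: "s \<in> alg_torus n" "t \<in> alg_torus n" "\<phi> s = \<phi> t"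
    show "s i = t i"
    proof (cases "i < n")
      case True
      then obtain p where p: "p \<in> jirr" "i = e p" using e_surj by blast
      have "pt s \<in> \<phi> s" "pt s \<in> \<phi> t" using st(3) proj_line_self unfolding \<phi>_def by metis+
      then show ?thesis using ratio[OF st(1) _ pt0 p(1)] ratio[OF st(2) _ pt0 p(1)] p(2) by metis
    next
      case False
      then show ?thesis using st by (simp add: alg_torus_def)
    qed
  qed
  have surj: "L \<in> \<phi> ` alg_torus n" if L: "L \<in> U" for L
  proof -
    have "L \<in> hibi_variety M" using L by (simp add: U_def)
    then obtain x where x: "x \<noteq> 0" "L = proj_line x" "hibi_point M x" by (rule hibi_varietyE)
    have nz: "\<And>a. a \<in> M \<Longrightarrow> x $ a \<noteq> 0" using L A_iff[OF x(1)] x(2) by (auto simp: U_def)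
    \<comment> \<open>The value 1 from position \<open>n\<close> on is the padding required by
      \<open>alg_torus\<close>.\<close>
    define t where "t = (\<lambda>i. if i < n then (let p = inv_into jirr e i in x $ upper_cover p / x $ lower_cover p) else 1)"
    have te: "t (e p) = x $ upper_cover p / x $ lower_cover p" if "p \<in> jirr" for p
      using that e_lt[OF that] e by (simp add: t_def bij_betw_def)
    have tt: "t \<in> alg_torus n"
      unfolding alg_torus_def
    proof (intro CollectI conjI allI impI)
      fix i assume "i < n"
      then obtain p where p: "p \<in> jirr" "i = e p" using e_surj by blast
      then show "t i \<noteq> 0" using te[OF p(1)] nz covers[OF p(1)] by simp
    qed (simp add: t_def)
    obtain c where "c \<noteq> 0" "x = c *s torus_point M (\<lambda>p. t (e p))"
      using hibi_point_eq_torus_point[OF x(3) nz, of "\<lambda>p. t (e p)"] te by metis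
    then have "L = \<phi> t" unfolding x(2) \<phi>_def pt_def using proj_line_scale by metis
    with tt show ?thesis by blast
  qed
  have bij: "bij_betw \<phi> (alg_torus n) U"
    unfolding bij_betw_def using inj \<phi>U surj by blast
  have scal_line: "scal t ` proj_line x = proj_line (scal t x)" for t x
  proof -
    have "scal t (c *s x) = c *s scal t x" for c by (simp add: scal_def vec_eq_iff)
    then show ?thesis unfolding proj_line_def by (auto simp: image_iff) metis
  qed
  have scal_nz: "scal t x \<noteq> 0" if "t \<in> alg_torus n" "x \<noteq> 0" for t x
    using that char_nz[OF that(1)] by (auto simp: scal_def vec_eq_iff)
  have scal_hibi: "hibi_point M (scal t x)" if "hibi_point M x" for t x
    unfolding hibi_point_def
  proof (intro conjI allI impI ballI)
    show "scal t x $ c = 0" if "c \<notin> M" for c using \<open>hibi_point M x\<close> that by (simp add: scal_def hibi_point_def)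
    fix a b assume "a \<in> M" "b \<in> M"
    then have "x $ a * x $ b = x $ sup a b * x $ inf a b" using that by (simp add: hibi_point_def)
    then show "scal t x $ a * scal t x $ b = scal t x $ sup a b * scal t x $ inf a b"
      using torus_char_modular[of "\<lambda>p. t (e p)" a b] by (simp add: scal_def) (metis mult.assoc mult.left_commute)
  qed
  have act_X: "act t L \<in> hibi_variety M" if t: "t \<in> alg_torus n" and L: "L \<in> hibi_variety M" for t L
  proof -
    obtain x where x: "x \<noteq> 0" "L = proj_line x" "hibi_point M x" using L by (rule hibi_varietyE)
    then show ?thesis unfolding act_def x(2) scal_line using scal_nz[OF t] scal_hibi hibi_variety_line_iff by blast
  qed
  have scal_mult: "scal (\<lambda>i. s i * t i) y = scal s (scal t y)" for s t y
    by (simp add: scal_def vec_eq_iff torus_char_mult mult.assoc)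
  have scal_one: "scal (\<lambda>_. 1) y = y" for y by (simp add: scal_def vec_eq_iff torus_char_def)
  have action: "torus_action n (hibi_variety M) act"
    unfolding torus_action_def using act_X by (auto simp: act_def scal_mult scal_one image_image)
  have morph: "torus_morphism n \<phi>"
    unfolding torus_morphism_def
  proof
    define G where "G = (\<lambda>a. if a \<in> M then single (\<Sum>p\<in>birkhoff a. single (e p) 1) 1 else 0 :: nat cpoly)"
    have ev: "(\<chi> a. eval_poly t (G a)) = pt t" for t
      by (auto simp: vec_eq_iff G_def pt_def torus_point_def torus_char_def monom_eval_sum)
    show "\<exists>G. (\<chi> a. eval_poly t0 (G a)) \<noteq> 0 \<and> (\<forall>t\<in>alg_torus n. (\<chi> a. eval_poly t (G a)) \<noteq> 0 \<longrightarrow>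
        \<phi> t = proj_line (\<chi> a. eval_poly t (G a)))" for t0
      by (rule exI[of _ G]) (simp add: ev pt0 \<phi>_def)
  qed
  have inverse_morph: "morphism_to_torus n U (the_inv_into (alg_torus n) \<phi>)"
    unfolding morphism_to_torus_def
  proof (intro conjI ballI allI impI)
    show "the_inv_into (alg_torus n) \<phi> ` U \<subseteq> alg_torus n"
      using bij_betw_the_inv_into[OF bij] by (simp add: bij_betw_def)
    fix L0 i assume L0: "L0 \<in> U" and i: "i < n"
    obtain p where p: "p \<in> jirr" "i = e p" using e_surj[OF i] by blast
    obtain t0 where t0: "t0 \<in> alg_torus n" "L0 = \<phi> t0" using surj[OF L0] by blast
    have "\<exists>x\<in>L0. eval_poly (($) x) (var (lower_cover p)) \<noteq> 0"
    proof (rule bexI[of _ "pt t0"])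
      show "eval_poly (($) (pt t0)) (var (lower_cover p)) \<noteq> 0"
        using char_nz[OF t0(1)] covers[OF p(1)] by (simp add: pt_def torus_point_def)
    qed (simp add: t0 \<phi>_def proj_line_self)
    moreover have "the_inv_into (alg_torus n) \<phi> L i = eval_poly (($) x) (var (upper_cover p)) / eval_poly (($) x) (var (lower_cover p))"
      if L: "L \<in> U" "x \<in> L" "eval_poly (($) x) (var (lower_cover p)) \<noteq> 0" for L x
    proof -
      obtain t where t: "t \<in> alg_torus n" "L = \<phi> t" using surj[OF L(1)] by blast
      have "x \<noteq> 0" using L(3) by auto
      then show ?thesis using ratio[OF t(1) _ _ p(1), of x] L(2) t p by (simp add: the_inv_into_f_f[OF inj])
    qed
    ultimately show "\<exists>d g h. homogeneous d g \<and> homogeneous d h \<and>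
       (\<exists>x\<in>L0. eval_poly (($) x) h \<noteq> 0) \<and>
       (\<forall>L\<in>U. \<forall>x\<in>L. eval_poly (($) x) h \<noteq> 0 \<longrightarrow>
          the_inv_into (alg_torus n) \<phi> L i = eval_poly (($) x) g / eval_poly (($) x) h)"
      using homogeneous_var by blast
  qed
  have times_morph: "torus_times_morphism n (hibi_variety M) act"
    unfolding torus_times_morphism_def
  proof (intro ballI)
    fix t0 L0 assume t0: "t0 \<in> alg_torus n" and L0: "L0 \<in> hibi_variety M"
    define G :: "'a \<Rightarrow> (nat + 'a) cpoly" where
      "G = (\<lambda>a. single ((\<Sum>p\<in>birkhoff a. single (Inl (e p)) 1) + single (Inr a) 1) 1)"
    have ev: "(\<chi> a. eval_poly (case_sum t (($) x)) (G a)) = scal t x" for t x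
      by (simp add: vec_eq_iff G_def scal_def monom_eval_add monom_eval_sum torus_char_def)
    have deg: "(\<Sum>b\<in>UNIV. lookup m (Inr b)) = 1" if "m \<in> keys (G a)" for a m
      using that by (simp add: G_def lookup_add lookup_sum lookup_single when_def)
    obtain x0 where x0: "x0 \<noteq> 0" "L0 = proj_line x0" using L0 by (rule hibi_varietyE)
    have "\<exists>x\<in>L0. scal t0 x \<noteq> 0" using scal_nz[OF t0 x0(1)] proj_line_self x0(2) by blast
    moreover have "act t L = proj_line (scal t x)"
      if h: "t \<in> alg_torus n" "L \<in> hibi_variety M" "x \<in> L" "scal t x \<noteq> 0" for t L x
    proof -
      obtain y where y: "y \<noteq> 0" "L = proj_line y" using h(2) by (rule hibi_varietyE)
      have "x \<noteq> 0" using h(4) by (auto simp: scal_def vec_eq_iff)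
      then have "L = proj_line x" using proj_line_eq h(3) y(2) by blast
      then show ?thesis by (simp add: act_def scal_line)
    qed
    ultimately show "\<exists>d. \<exists>G :: 'a \<Rightarrow> (nat + 'a) cpoly.
       (\<forall>a. \<forall>m\<in>keys (G a). (\<Sum>b\<in>UNIV. lookup m (Inr b)) = d) \<and>
       (\<exists>x\<in>L0. (\<chi> a. eval_poly (case_sum t0 (($) x)) (G a)) \<noteq> 0) \<and>
       (\<forall>t\<in>alg_torus n. \<forall>L\<in>hibi_variety M. \<forall>x\<in>L.
          (\<chi> a. eval_poly (case_sum t (($) x)) (G a)) \<noteq> 0 \<longrightarrow>
          act t L = proj_line (\<chi> a. eval_poly (case_sum t (($) x)) (G a)))"
      using deg by (intro exI[of _ 1] exI[of _ G]) (simp only: ev, blast)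
  qed
  have equivariant: "act s (\<phi> t) = \<phi> (\<lambda>i. s i * t i)" for s t
  proof -
    have "scal s (pt t) = pt (\<lambda>i. s i * t i)"
      by (auto simp: scal_def pt_def torus_point_def vec_eq_iff torus_char_mult)
    then show ?thesis by (simp add: act_def \<phi>_def scal_line)
  qed
  have "\<exists>A. zariski_closed A \<and> U = hibi_variety M - A" using closedA U_def by blast
  then show ?thesis
    unfolding toric_variety_def
    using hibi_variety_closed hibi_variety_irreducible bij morph inverse_morph action times_morph equivariant
    by blast
qed

end

section \<open>Components of the degenerations and the correspondence with subdivisions\<close>

lemma hibi_variety_subset_imp:
  assumes "separating_sublattice M" "hibi_variety M \<subseteq> hibi_variety N"
  shows "M \<subseteq> N"
proof
  fix a assume a: "a \<in> M"
  interpret separating_sublattice M by fact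
  \<comment> \<open>The unit point of the torus has support exactly \<open>M\<close>, so it detects
    the inclusion.\<close>
  have "hibi_point N (torus_point M (\<lambda>_. 1))"
    using torus_point_in_hibi_variety assms(2) hibi_variety_line_iff[OF torus_point_nonzero] by blast
  moreover have "torus_point M (\<lambda>_. 1) $ a = 1" using a by (simp add: torus_point_def torus_char_def)
  ultimately show "a \<in> N" unfolding hibi_point_def by (metis zero_neq_one)
qed

text \<open>Distinct cells are incomparable, so their Hibi varieties form an antichain of
  irreducible closed sets and are the components of their union.\<close>

lemma hibi_cells:
  assumes w: "supermodular w"
  shows "irreducible_components (proj_zeros (initial_ideal w hibi_ideal)) = {hibi_variety M | M. cell w M}"
    and "semitoric (proj_zeros (initial_ideal w hibi_ideal))"
proof -
  let ?A = "{hibi_variety M | M. cell w M}"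
  have fin: "finite ?A" by simp
  have closed: "zariski_closed A" if "A \<in> ?A" for A using that hibi_variety_closed by blast
  have toric: "toric_variety A" if "A \<in> ?A" for A
    using that cell_separating[OF _ w] separating_sublattice.hibi_variety_toric by blast
  show comp: "irreducible_components (proj_zeros (initial_ideal w hibi_ideal)) = ?A"
    unfolding proj_zeros_initial_ideal[OF w]
  proof (rule irreducible_components_Union[OF fin closed])
    show "zariski_irreducible A" if "A \<in> ?A" for A
      using that cell_separating[OF _ w] separating_sublattice.hibi_variety_irreducible by blast
    show "A = B" if AB: "A \<in> ?A" "B \<in> ?A" "A \<subseteq> B" for A B
    proof -
      obtain M N where MN: "cell w M" "A = hibi_variety M" "cell w N" "B = hibi_variety N" using AB(1,2) by blast
      have "M \<subseteq> N" using hibi_variety_subset_imp[OF cell_separating[OF MN(1) w]] AB(3) MN by blast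
      then have "M = N" using cell_unique[OF MN(1,3)] by blast
      then show ?thesis using MN by simp
    qed
  qed
  show "semitoric (proj_zeros (initial_ideal w hibi_ideal))"
    unfolding semitoric_def comp using toric zariski_closed_Union[OF fin closed]
    unfolding proj_zeros_initial_ideal[OF w] by blast
qed

theorem theorem2p2:
  shows "\<exists>(m :: (real, 'a::{finite,distrib_lattice}) vec set \<Rightarrow> nat)
          (ords :: (real, 'a) vec set \<Rightarrow> nat \<Rightarrow> 'a rel).
    (\<forall>F\<in>hibi_faces.
       (\<forall>i\<in>{1..m F}. partial_order_on join_irreducibles (ords F i)) \<and>
       inj_on (ords F) {1..m F} \<and>
       initial_cone hibi_ideal (face_ideal F) = rel_interior F \<and>
       (\<forall>w\<in>initial_cone hibi_ideal (face_ideal F).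
          regular_subdivision (order_polytope jirr_order) (psi w) =
            {order_polytope (ords F i) | i. i \<in> {1..m F}})) \<and>
    (\<forall>F\<in>hibi_faces.
       semitoric (face_variety F) \<and>
       irreducible_components (face_variety F) =
         {hibi_variety (sublattice_of_order (ords F i)) | i. i \<in> {1..m F}}) \<and>
    bij_betw (\<lambda>F. {order_polytope (ords F i) | i. i \<in> {1..m F}})
      hibi_faces
      {\<Theta>. (\<exists>c. \<Theta> = regular_subdivision (order_polytope (jirr_order :: 'a rel)) c) \<and>
           (\<forall>Q\<in>\<Theta>. \<exists>r. partial_order_on join_irreducibles r \<and> Q = order_polytope r)}"
proof -
  let ?O = "order_polytope (jirr_order :: 'a rel)"
  have "\<forall>F\<in>hibi_faces. \<exists>w :: (real, 'a) vec. supermodular w \<and> F = modular_face w"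
    using hibi_face_obtain by metis
  then obtain W :: "(real, 'a) vec set \<Rightarrow> (real, 'a) vec" where
    W: "\<And>F. F \<in> hibi_faces \<Longrightarrow> supermodular (W F)" "\<And>F. F \<in> hibi_faces \<Longrightarrow> F = modular_face (W F)"
    by metis
  \<comment> \<open>The cells of one chosen weight \<open>W F\<close> in the relative interior of
    \<open>F\<close> are counted by \<open>m F\<close> and enumerated by \<open>h F\<close>; every
    other weight there has the same cells.\<close>
  define m where "m = (\<lambda>F. card {M. cell (W F) M})"
  have "\<exists>h. bij_betw h {1..m F} {M. cell (W F) M}" for F
    unfolding m_def using ex_bij_betw_nat_finite_1[of "{M. cell (W F) M}"] by simp
  then obtain h where h: "\<And>F. bij_betw (h F) {1..m F} {M. cell (W F) M}" by metis
  define ords where "ords = (\<lambda>F i. order_of (h F i))"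
  let ?\<Q> = "\<lambda>F. {order_polytope (ords F i) | i. i \<in> {1..m F}}"
  let ?\<R> = "{\<Theta>. (\<exists>c. \<Theta> = regular_subdivision ?O c) \<and> (\<forall>Q\<in>\<Theta>. \<exists>r. partial_order_on jirr r \<and> Q = order_polytope r)}"
  have h_cell: "cell (W F) (h F i)" if "i \<in> {1..m F}" for F i
    using h[of F] that by (auto simp: bij_betw_def)
  have sep: "separating_sublattice M" if "F \<in> hibi_faces" "cell (W F) M" for F M
    using cell_separating[OF that(2) W(1)[OF that(1)]] .
  have image: "{f (ords F i) | i. i \<in> {1..m F}} = {f (order_of M) | M. cell (W F) M}" for f :: "'a rel \<Rightarrow> 'b" and F
  proof -
    have "{f (ords F i) | i. i \<in> {1..m F}} = (\<lambda>M. f (order_of M)) ` h F ` {1..m F}" by (auto simp: ords_def)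
    also have "h F ` {1..m F} = {M. cell (W F) M}" using h[of F] by (simp add: bij_betw_def)
    finally show ?thesis by auto
  qed
  have subdiv: "?\<Q> F = regular_subdivision ?O (psi (W F))" if F: "F \<in> hibi_faces" for F :: "(real, 'a) vec set"
    unfolding image regular_subdivision_cells
    using separating_sublattice.order_polytope_order_of[OF sep[OF F]] by (metis (no_types, lifting))
  have cone: "initial_cone hibi_ideal (face_ideal F) = rel_interior F" if F: "F \<in> hibi_faces" for F :: "(real, 'a) vec set"
    using initial_cone_face_ideal[OF W(1)[OF F]] W(2)[OF F] by simp
  have rel_int: "w \<in> rel_interior F \<longleftrightarrow> supermodular w \<and> modular_pair w = modular_pair (W F)" if F: "F \<in> hibi_faces" for F :: "(real, 'a) vec set" and w
    using rel_interior_modular_face[OF W(1)[OF F]] W(2)[OF F] by simp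
  have var: "face_variety F = proj_zeros (initial_ideal (W F) hibi_ideal)" if F: "F \<in> hibi_faces" for F :: "(real, 'a) vec set"
    using face_ideal_modular_face[OF W(1)[OF F]] W(2)[OF F] by (simp add: face_variety_def)
  have inj: "inj_on (ords F) {1..m F}" if F: "F \<in> hibi_faces" for F :: "(real, 'a) vec set"
  proof (rule inj_onI)
    fix i j assume ij: "i \<in> {1..m F}" "j \<in> {1..m F}" "ords F i = ords F j"
    have "order_of (h F i) = order_of (h F j)" using ij(3) by (simp only: ords_def)
    then have "h F i = h F j"
      using separating_sublattice.sublattice_of_order_of[OF sep[OF F h_cell[OF ij(1)]]]
        separating_sublattice.sublattice_of_order_of[OF sep[OF F h_cell[OF ij(2)]]]
      by metis
    then show "i = j" using h[of F] ij by (auto simp: bij_betw_def dest: inj_onD)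
  qed
  have part_a: "(\<forall>i\<in>{1..m F}. partial_order_on jirr (ords F i)) \<and> inj_on (ords F) {1..m F} \<and>
       initial_cone hibi_ideal (face_ideal F) = rel_interior F \<and>
       (\<forall>w\<in>initial_cone hibi_ideal (face_ideal F).
          regular_subdivision ?O (psi w) = ?\<Q> F)" if F: "F \<in> hibi_faces" for F :: "(real, 'a) vec set"
  proof (intro conjI ballI)
    show "partial_order_on jirr (ords F i)" if "i \<in> {1..m F}" for i
      unfolding ords_def by (rule separating_sublattice.partial_order[OF sep[OF F h_cell[OF that]]])
    fix w assume "w \<in> initial_cone hibi_ideal (face_ideal F)"
    then have "supermodular w" "modular_pair w = modular_pair (W F)" using rel_int[OF F] cone[OF F] by auto
    then have "cell w = cell (W F)" using cells_eq_iff W(1)[OF F] by blast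
    then show "regular_subdivision ?O (psi w) = ?\<Q> F"
      unfolding subdiv[OF F] regular_subdivision_cells by simp
  qed (use inj[OF F] cone[OF F] in auto)
  have part_b: "semitoric (face_variety F) \<and> irreducible_components (face_variety F) =
         {hibi_variety (sublattice_of_order (ords F i)) | i. i \<in> {1..m F}}" if F: "F \<in> hibi_faces" for F :: "(real, 'a) vec set"
  proof -
    have "{hibi_variety (sublattice_of_order (ords F i)) | i. i \<in> {1..m F}} = {hibi_variety M | M. cell (W F) M}"
      unfolding image[of "\<lambda>r. hibi_variety (sublattice_of_order r)"]
      using separating_sublattice.sublattice_of_order_of[OF sep[OF F]] by (metis (no_types, lifting))
    then show ?thesis using hibi_cells[OF W(1)[OF F]] unfolding var[OF F] by simp
  qed
  have part_c: "bij_betw ?\<Q> hibi_faces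
      ?\<R>"
    unfolding bij_betw_def
  proof
    have cells_inj: "cell w = cell v" if "regular_subdivision ?O (psi w) = regular_subdivision ?O (psi v)" for w v
    proof (rule ext)
      fix M
      have "cell w M \<longleftrightarrow> convex hull (bv ` M) \<in> regular_subdivision ?O (psi w)" for w
        by (simp add: regular_subdivision_cells cell_hull_inj)
      then show "cell w M = cell v M" using that by simp
    qed
    show "inj_on ?\<Q> hibi_faces"
    proof (rule inj_onI)
      fix F G :: "(real, 'a) vec set"
      assume F: "F \<in> hibi_faces" and G: "G \<in> hibi_faces"
        and eq: "?\<Q> F = ?\<Q> G"
      have "cell (W F) = cell (W G)" by (rule cells_inj) (use eq subdiv[OF F] subdiv[OF G] in simp)
      then have "modular_pair (W F) = modular_pair (W G)" using cells_eq_iff W(1)[OF F] W(1)[OF G] by blast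
      then have "modular_face (W F) = modular_face (W G)" by (simp add: modular_face_def)
      then show "F = G" using W(2)[OF F] W(2)[OF G] by simp
    qed
    show "?\<Q> ` hibi_faces =
      ?\<R>"
    proof (intro equalityI subsetI)
      fix \<Theta> assume "\<Theta> \<in> ?\<Q> ` hibi_faces"
      then obtain F where F: "F \<in> hibi_faces" "\<Theta> = ?\<Q> F" by blast
      have r: "\<exists>r. partial_order_on jirr r \<and> Q = order_polytope r" if "Q \<in> \<Theta>" for Q
      proof -
        obtain i where "i \<in> {1..m F}" "Q = order_polytope (ords F i)" using \<open>Q \<in> \<Theta>\<close> F(2) by blast
        then show ?thesis using conjunct1[OF part_a[OF F(1)]] by blast
      qed
      have "\<Theta> = regular_subdivision ?O (psi (W F))" using F subdiv by simp
      then show "\<Theta> \<in> ?\<R>"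
        by (intro CollectI conjI exI[of _ "psi (W F)"] ballI r)
    next
      fix \<Theta> assume h: "\<Theta> \<in> ?\<R>"
      then obtain c where c: "\<Theta> = regular_subdivision ?O c" by (elim CollectE conjE exE)
      from h have "\<forall>Q\<in>\<Theta>. \<exists>r. partial_order_on jirr r \<and> Q = order_polytope r" by (elim CollectE conjE)
      then have r: "\<forall>Q\<in>\<Theta>. \<exists>r. Q = order_polytope r" by fast
      define w :: "(real, 'a) vec" where "w = (\<chi> a. c (bv a))"
      have \<Theta>: "\<Theta> = regular_subdivision ?O (psi w)" unfolding c w_def by (rule regular_subdivision_psi)
      have "supermodular w"
      proof (rule order_cells_imp_supermodular)
        fix M assume "cell w M"
        then have "convex hull (bv ` M) \<in> \<Theta>" unfolding \<Theta> regular_subdivision_cells by blast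
        then show "\<exists>r. convex hull (bv ` M) = order_polytope r" using r by blast
      qed
      \<comment> \<open>The face with \<open>w\<close> in its relative interior, so that part (a)
        identifies its image with the given subdivision.\<close>
      define F where "F = modular_face w"
      have F: "F \<in> hibi_faces" unfolding F_def by (rule modular_face_in_hibi_faces) fact
      have "w \<in> initial_cone hibi_ideal (face_ideal F)"
        unfolding cone[OF F] unfolding F_def rel_interior_modular_face[OF \<open>supermodular w\<close>] using \<open>supermodular w\<close> by simp
      moreover have "\<forall>w\<in>initial_cone hibi_ideal (face_ideal F). regular_subdivision ?O (psi w) = ?\<Q> F"
        using part_a[OF F] by (elim conjE)
      ultimately have "\<Theta> = ?\<Q> F" unfolding \<Theta> by (elim bspec[rotated])
      then show "\<Theta> \<in> ?\<Q> ` hibi_faces" using F by blast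
    qed
  qed
  show ?thesis
    by (rule exI[of _ m], rule exI[of _ ords])
      (rule conjI, rule ballI, erule part_a, rule conjI, rule ballI, erule part_b, rule part_c)
qed

end
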